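(* Let $G=\mathbb T$, so that its dual group is $\Gamma=\mathbb Z$. Suppose $E\subset\mathbb N$ is a finite union of Hadamard gap sequences. Then $E$ is an analytic Sidon set.
   Context: A Hadamard gap sequence is a sequence $(\lambda_k)_{k=1}^\infty$ of positive integers such that for some $q>1$ one has $\lambda_{k+1}/\lambda_k\ge q$ for all $k\ge1$. The integer $n\in\mathbb Z$ is identified with the character $z\mapsto z^n$ of $\mathbb T$. All spaces are over $\mathbb C$. Every quasi-Banach space $X$ is assumed to carry a quasinorm which is an $r$-norm for some $0<r<1$, i.e. $\|x+y\|^r\le\|x\|^r+\|y\|^r$ for all $x,y\in X$ (so the quasinorm is continuous). A quasinorm on $X$ is plurisubharmonic if $\|x\|\le\int_0^{2\pi}\|x+e^{i\theta}y\|\frac{d\theta}{2\pi}$ for all $x,y\in X$. A quasi-Banach space is A-convex if it has an equivalent plurisubharmonic quasinorm (again an $r$-norm for some $0<r<1$, by the convention above). For a compact abelian group $G$ with normalized Haar measure and a Borel map $\phi:G\to X$, $\|\phi\|_\infty=\operatorname{ess\,sup}_{g\in G}\|\phi(g)\|$. Let $\Delta=\{\pm1\}^{\mathbb N}$ be the Cantor group (a compact abelian group) and let $\epsilon_k(t)$ denote the $k$-th coordinate of $t\in\Delta$. Property $\mathcal C_\infty(X)$: a subset $E$ of the dual group $\Gamma$ of $G$ has property $\mathcal C_\infty(X)$ if there is a constant $M$ (which may depend on $E$, $X$) such that for every finite subset $\{\gamma_1,\dots,\gamma_n\}$ of $E$ (distinct elements) and all $x_1,\dots,x_n\in X$, $$M^{-1}\Big\|\sum_{k=1}^n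 x_k\epsilon_k\Big\|_\infty\le\Big\|\sum_{k=1}^n x_k\gamma_k\Big\|_\infty\le M\Big\|\sum_{k=1}^n x_k\epsilon_k\Big\|_\infty,$$ where the outer norms are taken over $\Delta$ and the middle one over $G$. A set $E\subset\Gamma$ is an analytic Sidon set if $E$ satisfies $\mathcal C_\infty(X)$ for every A-convex quasi-Banach space $X$. *)

theory Defs
  imports "HOL-Probability.Probability"
begin

text \<open>
  A complex quasi-Banach space is given by a type \<open>'a\<close> of class \<open>ab_group_add\<close> together with a
  scalar multiplication \<open>smul\<close> and a quasinorm \<open>N\<close>. Every quasinorm is required to be an
  \<open>r\<close>-norm for some \<open>0 < r < 1\<close>; the usual quasi-triangle inequality and the continuity of \<open>N\<close>
  follow from this.
\<close>

definition quasinorm :: "(complex \<Rightarrow> 'a \<Rightarrow> 'a) \<Rightarrow> ('a::ab_group_add \<Rightarrow> real) \<Rightarrow> bool" where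
  "quasinorm smul N \<longleftrightarrow>
     (\<forall>x. 0 \<le> N x) \<and>
     (\<forall>x. N x = 0 \<longleftrightarrow> x = 0) \<and>
     (\<forall>a x. N (smul a x) = cmod a * N x) \<and>
     (\<exists>r. 0 < r \<and> r < 1 \<and> (\<forall>x y. N (x + y) powr r \<le> N x powr r + N y powr r))"

definition quasinorm_complete :: "('a::ab_group_add \<Rightarrow> real) \<Rightarrow> bool" where
  "quasinorm_complete N \<longleftrightarrow>
     (\<forall>X :: nat \<Rightarrow> 'a.
        (\<forall>e>0. \<exists>K. \<forall>m\<ge>K. \<forall>n\<ge>K. N (X m - X n) < e) \<longrightarrow>
        (\<exists>l. (\<lambda>n. N (X n - l)) \<longlonglongrightarrow> 0))"

definition quasi_banach_space :: "(complex \<Rightarrow> 'a \<Rightarrow> 'a) \<Rightarrow> ('a::ab_group_add \<Rightarrow> real) \<Rightarrow> bool" where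
  "quasi_banach_space smul N \<longleftrightarrow>
     vector_space smul \<and> quasinorm smul N \<and> quasinorm_complete N"

definition plurisubharmonic :: "(complex \<Rightarrow> 'a \<Rightarrow> 'a) \<Rightarrow> ('a::ab_group_add \<Rightarrow> real) \<Rightarrow> bool" where
  "plurisubharmonic smul N \<longleftrightarrow>
     (\<forall>x y. N x \<le> integral {0..2 * pi} (\<lambda>\<theta>. N (x + smul (cis \<theta>) y)) / (2 * pi))"

definition equivalent_quasinorms :: "('a \<Rightarrow> real) \<Rightarrow> ('a \<Rightarrow> real) \<Rightarrow> bool" where
  "equivalent_quasinorms N N' \<longleftrightarrow>
     (\<exists>c C. 0 < c \<and> 0 < C \<and> (\<forall>x. c * N x \<le> N' x \<and> N' x \<le> C * N x))"

definition A_convex :: "(complex \<Rightarrow> 'a \<Rightarrow> 'a) \<Rightarrow> ('a::ab_group_add \<Rightarrow> real) \<Rightarrow> bool" where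
  "A_convex smul N \<longleftrightarrow>
     (\<exists>N'. quasinorm smul N' \<and> equivalent_quasinorms N N' \<and> plurisubharmonic smul N')"

text \<open>
  The norm \<open>\<parallel>\<phi>\<parallel>\<^sub>\<infinity>\<close> of a map \<open>\<phi>\<close> from a probability space into \<open>(X, N)\<close>. It is an extended real
  because \<open>esssup\<close> needs a complete linear order; on the finite sums below it is finite.
\<close>

definition sup_norm :: "'g measure \<Rightarrow> ('a \<Rightarrow> real) \<Rightarrow> ('g \<Rightarrow> 'a) \<Rightarrow> ereal" where
  "sup_norm \<mu> N \<phi> = esssup \<mu> (\<lambda>g. ereal (N (\<phi> g)))"

text \<open>
  The Cantor group \<open>{\<plusminus>1}\<^sup>\<nat>\<close> with its Haar measure, the product of the uniform measures. The
  \<open>k\<close>-th coordinate function is \<open>\<lambda>t. t k\<close>.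
\<close>

definition cantor_haar :: "(nat \<Rightarrow> complex) measure" where
  "cantor_haar = (\<Pi>\<^sub>M k\<in>UNIV. uniform_count_measure {-1, 1})"

text \<open>
  Property \<open>C\<^sub>\<infinity>(X)\<close> for a set \<open>E\<close> of characters of a compact abelian group \<open>G\<close>, where \<open>\<mu>\<close> is the
  normalized Haar measure of \<open>G\<close>. The points of \<open>G\<close> are those of \<open>space \<mu>\<close>.
\<close>

definition C_infty ::
  "(complex \<Rightarrow> 'a \<Rightarrow> 'a) \<Rightarrow> ('a::ab_group_add \<Rightarrow> real) \<Rightarrow> 'g measure \<Rightarrow> ('g \<Rightarrow> complex) set \<Rightarrow> bool" where
  "C_infty smul N \<mu> E \<longleftrightarrow>
     (\<exists>M::real. M > 0 \<and>
       (\<forall>(n::nat) (\<gamma> :: nat \<Rightarrow> 'g \<Rightarrow> complex) (x :: nat \<Rightarrow> 'a).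
          inj_on \<gamma> {..<n} \<and> \<gamma> ` {..<n} \<subseteq> E \<longrightarrow>
            ereal (inverse M) * sup_norm cantor_haar N (\<lambda>t. \<Sum>k<n. smul (t k) (x k))
              \<le> sup_norm \<mu> N (\<lambda>g. \<Sum>k<n. smul (\<gamma> k g) (x k)) \<and>
            sup_norm \<mu> N (\<lambda>g. \<Sum>k<n. smul (\<gamma> k g) (x k))
              \<le> ereal M * sup_norm cantor_haar N (\<lambda>t. \<Sum>k<n. smul (t k) (x k))))"

text \<open>
  HOL cannot quantify over types inside a formula, so the underlying additive group of the
  quasi-Banach space is the type argument. A theorem with a free type variable \<open>'a\<close> covers all
  A-convex quasi-Banach spaces.
\<close>

definition analytic_sidon :: "'a::ab_group_add itself \<Rightarrow> 'g measure \<Rightarrow> ('g \<Rightarrow> complex) set \<Rightarrow> bool" where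
  "analytic_sidon _ \<mu> E \<longleftrightarrow>
     (\<forall>(smul :: complex \<Rightarrow> 'a \<Rightarrow> 'a) (N :: 'a \<Rightarrow> real).
        quasi_banach_space smul N \<and> A_convex smul N \<longrightarrow> C_infty smul N \<mu> E)"

text \<open>
  The circle group as a subset of the complex plane: its normalized Haar measure is the image of
  normalized Lebesgue measure on \<open>[0, 2\<pi>)\<close>, and \<open>n \<in> \<int>\<close> is identified with \<open>z \<mapsto> z\<^sup>n\<close>.
\<close>

definition circle_haar :: "complex measure" where
  "circle_haar =
     distr (uniform_measure lborel {0..<2 * pi}) (restrict_space borel (sphere 0 1)) cis"

definition circle_character :: "int \<Rightarrow> complex \<Rightarrow> complex" where
  "circle_character n = (\<lambda>z. z powi n)"

definition hadamard_gap_sequence :: "(nat \<Rightarrow> nat) \<Rightarrow> bool" where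
  "hadamard_gap_sequence l \<longleftrightarrow>
     (\<forall>k. 0 < l k) \<and> (\<exists>q::real. q > 1 \<and> (\<forall>k. q \<le> real (l (Suc k)) / real (l k)))"

definition finite_union_of_hadamard :: "nat set \<Rightarrow> bool" where
  "finite_union_of_hadamard E \<longleftrightarrow>
     (\<exists>F. finite F \<and> (\<forall>l\<in>F. hadamard_gap_sequence l) \<and> E = (\<Union>l\<in>F. range l))"

end

theory Submission
  imports Defs "HOL-Real_Asymp.Real_Asymp"
begin

text \<open>
  Pass to an equivalent plurisubharmonic \<open>r\<close>-norm \<open>N\<close>, fix a finite set \<open>F\<close> of frequencies in \<open>E\<close> and
  vectors \<open>x\<^sub>l\<close>, and consider \<open>\<Psi>(m) = N(\<Sum>\<^sub>l m\<^sub>l x\<^sub>l)\<^sup>r\<close> on coefficient vectors \<open>m\<close>. Let \<open>A\<close> be the supremum of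
  \<open>\<Psi>\<close> over the characters \<open>(w\<^sup>l)\<^sub>l\<close> with \<open>|w| = 1\<close>, and \<open>B\<close> its supremum over all \<open>m\<close> with \<open>|m\<^sub>l| \<le> 1\<close>. Up
  to constants \<open>B\<close> is the norm on the Cantor group, since a number in \<open>[-1, 1]\<close> has a binary expansion
  with digits \<open>\<plusminus>1\<close> and \<open>\<Sum> 2\<^bsup>-jr\<^esup>\<close> converges. As \<open>A \<le> B\<close>, the theorem amounts to \<open>B \<le> C A\<close>, with \<open>C\<close>
  depending only on \<open>r\<close> and on the density of \<open>E\<close>: a bound \<open>k\<close> on the number of elements in \<open>[x, e\<^sup>t x]\<close>.

  Three operations keep \<open>\<Psi>\<close> under the control of \<open>A\<close>: taking characters, taking sums with a bounded
  number of terms, and passing from the boundary of an analytic disc to its interior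
  (\<open>psh_maximum_principle\<close>). Moreover an error vector whose entries are at most \<open>s\<close> costs at most
  \<open>s\<^sup>r B\<close>, and a small multiple of \<open>B\<close> may be absorbed at the end. So it is enough to approximate.

  Let \<open>J\<close> be a very lacunary subset of \<open>F\<close>. One finds \<open>w\<close> with prescribed values \<open>w\<^sup>\<mu> = a\<^sub>\<mu>\<close> for all
  \<open>\<mu> \<in> J\<close> by treating the pins \<open>\<mu>\<close> in increasing order: a rotation by an angle of at most \<open>2\<pi>/\<mu>\<close> adjusts
  \<open>w\<^sup>\<mu>\<close> and hardly moves \<open>w\<^sup>l\<close> for \<open>l\<close> much smaller than \<open>\<mu>\<close>. In front of each rotation \<open>w\<close> is multiplied by
  a free unimodular \<open>Z\<close>, and the maximum principle moves \<open>Z\<close> to a point \<open>\<rho> < 1\<close> for which \<open>\<rho>\<^sup>l\<close> is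
  close to \<open>1\<close> up to the previous pin and negligible far above it. A frequency \<open>\<mu> + D\<close> near a later pin
  \<open>\<mu>\<close> feels \<open>Z\<close> only through \<open>Z\<^sup>D\<close>, because the rotation at \<open>\<mu>\<close> will reset \<open>w\<^sup>\<mu>\<close> to \<open>a\<^sub>\<mu>\<close>. Hence it is
  annihilated when the scale of \<open>D\<close> is passed, while \<open>\<mu>\<close> itself survives (\<open>pinned_approximation\<close>).

  This needs \<open>D \<ge> 0\<close>, for otherwise \<open>Z\<^sup>D\<close> is not analytic, and it needs \<open>D\<close> not to be comparable to a
  pin, for the rotation there is not analytic in \<open>Z\<close>. The first condition holds if \<open>J\<close> consists of bottoms
  of clusters; removing all bottoms lowers the density, which gives an induction on \<open>k\<close>. The second one is
  achieved by a greedy colouring of the bottoms. What remains are frequencies comparable to a pin but not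
  close to it. They are removed by an explicit multiplier (\<open>comparable_multiplier\<close>), which is possible
  because each pin has boundedly many of them. Together this bounds \<open>\<Psi>\<close> on each colour class
  (\<open>lacunary_class_bound\<close>). With precision \<open>\<kappa>\<close> the error is of order \<open>\<kappa>\<^sup>r B\<close> per class and the number of
  classes is of order \<open>log (1/\<kappa>)\<close>, so for small \<open>\<kappa>\<close> the total error is absorbed (\<open>psh_bound_windows\<close>).
\<close>

section \<open>Maximum principle for plurisubharmonic quasinorms\<close>

lemma sum_powr_le:
  fixes N :: "'a::ab_group_add \<Rightarrow> real"
  assumes N0: "\<And>x. 0 \<le> N x" "N 0 = 0"
    and tri: "\<And>x y. N (x + y) powr r \<le> N x powr r + N y powr r" and "finite I"
  shows "N (\<Sum>i\<in>I. x i) powr r \<le> (\<Sum>i\<in>I. N (x i) powr r)"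
  using \<open>finite I\<close>
proof (induction I rule: finite_induct)
  case (insert i I)
  have "N (x i + (\<Sum>i\<in>I. x i)) powr r \<le> N (x i) powr r + N (\<Sum>i\<in>I. x i) powr r" by (rule tri)
  with insert show ?case by simp
qed (simp add: N0)

text \<open>
  The quasinorm need not be Lipschitz, but its \<open>r\<close>-th power is subadditive, so continuity is proved for
  that power.
\<close>

lemma quasinorm_sum_tendsto:
  fixes smul :: "complex \<Rightarrow> 'a::ab_group_add \<Rightarrow> 'a" and c :: "'i \<Rightarrow> 'b \<Rightarrow> complex"
  assumes vs: "vector_space smul" and q: "quasinorm smul N" and "finite I"
    and lim: "\<And>i. i \<in> I \<Longrightarrow> ((\<lambda>t. c i t) \<longlongrightarrow> l i) F"
  shows "((\<lambda>t. N (\<Sum>i\<in>I. smul (c i t) (x i))) \<longlongrightarrow> N (\<Sum>i\<in>I. smul (l i) (x i))) F"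
proof -
  interpret vector_space smul by (rule vs)
  obtain r where r: "0 < r" "r < 1" and tri: "\<And>x y. N (x + y) powr r \<le> N x powr r + N y powr r"
    using q unfolding quasinorm_def by blast
  have N0: "0 \<le> N x" "N x = 0 \<longleftrightarrow> x = 0" and hom: "N (smul a x) = cmod a * N x" for x a
    using q unfolding quasinorm_def by blast+
  define S where "S = (\<lambda>t. \<Sum>i\<in>I. smul (c i t) (x i))"
  define L where "L = (\<Sum>i\<in>I. smul (l i) (x i))"
  define E where "E = (\<lambda>t. \<Sum>i\<in>I. (cmod (c i t - l i) * N (x i)) powr r)"
  have E0: "(E \<longlongrightarrow> 0) F"
  proof -
    have "((\<lambda>t. (cmod (c i t - l i) * N (x i)) powr r) \<longlongrightarrow> (0 * N (x i)) powr r) F" if "i \<in> I" for i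
      using lim[OF that] r
      by (intro tendsto_powr2 tendsto_mult tendsto_const) (auto simp: tendsto_norm_zero_iff LIM_zero_iff N0(1))
    then have "(E \<longlongrightarrow> (\<Sum>i\<in>I. (0 * N (x i)) powr r)) F"
      unfolding E_def by (intro tendsto_sum) auto
    then show ?thesis by simp
  qed
  have d1: "N (S t - L) powr r \<le> E t" and d2: "N (L - S t) powr r \<le> E t" for t
  proof -
    have "S t - L = (\<Sum>i\<in>I. smul (c i t - l i) (x i))"
      by (simp add: S_def L_def scale_left_diff_distrib sum_subtractf)
    then show 1: "N (S t - L) powr r \<le> E t"
      unfolding E_def using sum_powr_le[of N r I "\<lambda>i. smul (c i t - l i) (x i)"] N0 tri assms(3)
      by (simp add: hom)
    have "L - S t = smul (-1) (S t - L)" by simp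
    then have "N (L - S t) = N (S t - L)" by (simp only: hom) simp
    then show "N (L - S t) powr r \<le> E t" using 1 by simp
  qed
  have "((\<lambda>t. N (S t) powr r) \<longlongrightarrow> N L powr r) F"
  proof (rule tendsto_sandwich[where f = "\<lambda>t. N L powr r - E t" and h = "\<lambda>t. N L powr r + E t"])
    have "N L powr r - E t \<le> N (S t) powr r" for t
      using tri[of "S t" "L - S t"] d2[of t] by simp
    then show "\<forall>\<^sub>F t in F. N L powr r - E t \<le> N (S t) powr r" by simp
    have "N (S t) powr r \<le> N L powr r + E t" for t
      using tri[of L "S t - L"] d1[of t] by simp
    then show "\<forall>\<^sub>F t in F. N (S t) powr r \<le> N L powr r + E t" by simp
    show "((\<lambda>t. N L powr r - E t) \<longlongrightarrow> N L powr r) F"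
      using tendsto_diff[OF tendsto_const E0, of "N L powr r"] by simp
    show "((\<lambda>t. N L powr r + E t) \<longlongrightarrow> N L powr r) F"
      using tendsto_add[OF tendsto_const E0, of "N L powr r"] by simp
  qed
  then have "((\<lambda>t. (N (S t) powr r) powr (1 / r)) \<longlongrightarrow> (N L powr r) powr (1 / r)) F"
    by (rule tendsto_powr2[OF _ tendsto_const]) (use r in auto)
  then show ?thesis using r N0 by (simp add: powr_powr S_def L_def)
qed

lemma quasinorm_sum_continuous:
  fixes smul :: "complex \<Rightarrow> 'a::ab_group_add \<Rightarrow> 'a" and c :: "'i \<Rightarrow> 'b::topological_space \<Rightarrow> complex"
  assumes "vector_space smul" "quasinorm smul N" "finite I" "\<And>i. i \<in> I \<Longrightarrow> continuous_on S (c i)"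
  shows "continuous_on S (\<lambda>t. N (\<Sum>i\<in>I. smul (c i t) (x i)))"
  unfolding continuous_on_def
proof
  fix s assume "s \<in> S"
  then show "((\<lambda>t. N (\<Sum>i\<in>I. smul (c i t) (x i))) \<longlongrightarrow> N (\<Sum>i\<in>I. smul (c i s) (x i))) (at s within S)"
    using assms by (intro quasinorm_sum_tendsto) (auto simp: continuous_on_def)
qed

lemma has_integral_cis_multiple:
  assumes "0 < (k::nat)"
  shows "((\<lambda>\<theta>. cis (k * \<theta>)) has_integral 0) {0..2 * pi}"
proof -
  have "((\<lambda>\<theta>. cis (k * \<theta>)) has_integral (cis (k * (2 * pi)) / (\<i> * k) - cis (real k * 0) / (\<i> * k))) {0..2 * pi}"
  proof (rule fundamental_theorem_of_calculus)
    fix x :: real assume "x \<in> {0..2 * pi}"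
    have d: "((\<lambda>z. exp (c * z) / c) has_field_derivative exp (c * w)) (at w)" if "c \<noteq> 0" for c w :: complex
      using that by (auto intro!: derivative_eq_intros)
    have "\<i> * of_nat k \<noteq> 0" using assms by simp
    from has_vector_derivative_real_field[OF d[OF this, of "of_real x"]]
    have "((\<lambda>\<theta>. exp (\<i> * (of_nat k * of_real \<theta>)) / (\<i> * k)) has_vector_derivative
        exp (\<i> * (of_nat k * of_real x))) (at x within {0..2 * pi})"
      by (simp add: mult.assoc)
    then show "((\<lambda>\<theta>. cis (k * \<theta>) / (\<i> * k)) has_vector_derivative cis (k * x)) (at x within {0..2 * pi})"
      by (simp add: cis_conv_exp)
  qed auto
  moreover have "cis (k * (2 * pi)) = 1"
    using cis_multiple_2pi[of "real k"] by (simp add: mult_ac)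
  ultimately show ?thesis by simp
qed

text \<open>
  The left-hand power is what the \<open>r\<close>-triangle inequality gives for a vector of quasinorm \<open>A\<close> perturbed by
  one of size \<open>\<rho>\<close>. It exceeds \<open>A\<close> by little for small \<open>\<rho>\<close> and grows linearly, so a steep quadratic penalty
  makes the perturbation harmless for every \<open>\<rho>\<close>.
\<close>

lemma penalty_absorbs_growth:
  fixes A L r \<epsilon> :: real
  assumes r: "0 < r" and A: "0 \<le> A" and L: "0 \<le> L" and \<epsilon>: "0 < \<epsilon>"
  obtains C where "0 < C" "\<And>\<rho>. 0 \<le> \<rho> \<Longrightarrow> (A powr r + L * \<rho> powr r) powr (1 / r) - C * \<rho>\<^sup>2 \<le> A + \<epsilon>"
proof -
  define h where "h = (\<lambda>\<rho>::real. (A powr r + L * \<rho> powr r) powr (1 / r))"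
  have "(h \<longlongrightarrow> (A powr r + L * 0 powr r) powr (1 / r)) (at_right 0)"
  proof -
    have "((\<lambda>\<rho>::real. \<rho> powr r) \<longlongrightarrow> 0 powr r) (at_right 0)"
      by (intro tendsto_powr2 tendsto_ident_at tendsto_const) (use r in \<open>auto simp: eventually_at_filter\<close>)
    then have "((\<lambda>\<rho>::real. A powr r + L * \<rho> powr r) \<longlongrightarrow> A powr r + L * 0 powr r) (at_right 0)"
      by (intro tendsto_add tendsto_mult tendsto_const)
    then show ?thesis unfolding h_def
      by (rule tendsto_powr2[OF _ tendsto_const]) (use r L in auto)
  qed
  then have "(h \<longlongrightarrow> A) (at_right 0)" using r A by (simp add: powr_powr)
  then have "\<forall>\<^sub>F \<rho> in at_right 0. h \<rho> < A + \<epsilon>" using \<epsilon> by (intro order_tendstoD) auto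
  then obtain b where b: "0 < b" "\<And>\<rho>. 0 < \<rho> \<Longrightarrow> \<rho> < b \<Longrightarrow> h \<rho> < A + \<epsilon>"
    unfolding eventually_at_right_field by auto
  define D where "D = (A powr r / b powr r + L) powr (1 / r)"
  have D: "0 \<le> D" by (simp add: D_def)
  show ?thesis
  proof (rule that[of "D / b + 1"])
    show "0 < D / b + 1" using D b by (simp add: add_nonneg_pos)
    fix \<rho> :: real assume \<rho>: "0 \<le> \<rho>"
    consider "\<rho> = 0" | "0 < \<rho>" "\<rho> < b" | "b \<le> \<rho>" using \<rho> by linarith
    then show "(A powr r + L * \<rho> powr r) powr (1 / r) - (D / b + 1) * \<rho>\<^sup>2 \<le> A + \<epsilon>"
    proof cases
      case 1
      then show ?thesis using r A \<epsilon> by (simp add: powr_powr)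
    next
      case 2
      then have "h \<rho> < A + \<epsilon>" by (rule b)
      moreover have "0 \<le> (D / b + 1) * \<rho>\<^sup>2" using D b by simp
      ultimately show ?thesis unfolding h_def by linarith
    next
      case 3
      have "A powr r = A powr r / b powr r * b powr r" using b by simp
      also have "\<dots> \<le> A powr r / b powr r * \<rho> powr r"
        using 3 b r by (intro mult_left_mono powr_mono2) auto
      finally have "A powr r + L * \<rho> powr r \<le> (A powr r / b powr r + L) * \<rho> powr r"
        by (simp add: distrib_right)
      then have "(A powr r + L * \<rho> powr r) powr (1 / r) \<le> ((A powr r / b powr r + L) * \<rho> powr r) powr (1 / r)"
        using r L by (intro powr_mono2) auto
      also have "\<dots> = D * \<rho>" using r L \<rho> by (simp add: powr_mult powr_powr D_def)
      also have "\<dots> \<le> D / b * \<rho>\<^sup>2"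
      proof -
        have "D * \<rho> * b \<le> D * \<rho> * \<rho>" using 3 D \<rho> by (intro mult_left_mono) auto
        then show ?thesis using b by (simp add: field_simps power2_eq_square)
      qed
      also have "\<dots> \<le> (D / b + 1) * \<rho>\<^sup>2" by (simp add: distrib_right)
      finally show ?thesis using A \<epsilon> by linarith
    qed
  qed
qed

text \<open>
  Points of \<open>\<complex>\<^bsup>m+1\<^esup>\<close> are encoded as functions on \<open>nat\<close> that vanish beyond \<open>m\<close>, since the dimension is
  the degree of a polynomial and varies with it.
\<close>

lemma compact_finite_box:
  "compact {s :: nat \<Rightarrow> complex. \<forall>j. s j \<in> (if j \<le> m then cball 0 R else {0})}"
proof -
  have "{s :: nat \<Rightarrow> complex. \<forall>j. s j \<in> (if j \<le> m then cball 0 R else {0})} =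
      PiE UNIV (\<lambda>j. if j \<le> m then cball 0 R else {0})" by (auto simp: PiE_def Pi_def)
  moreover have "compactin (product_topology (\<lambda>_. euclidean) UNIV) (PiE UNIV (\<lambda>j::nat. if j \<le> m then cball (0::complex) R else {0}))"
    unfolding compactin_PiE by auto
  ultimately show ?thesis
    by (simp add: euclidean_product_topology)
qed

text \<open>
  The remainder of the first-order expansion on a small circle contains only the frequencies
  \<open>2, \<dots>, j\<close> in \<open>\<theta>\<close>. It therefore has mean zero, which is used besides its size \<open>O(h\<^sup>2)\<close>.
\<close>

lemma affine_remainder:
  fixes z :: complex and h \<theta> :: real
  shows "(z + h * cis \<theta>) ^ j = z ^ j + h * cis \<theta> * (j * z ^ (j - 1)) +
     (\<Sum>i\<in>{2..j}. of_nat (j choose i) * z ^ (j - i) * of_real (h ^ i) * cis (i * \<theta>))"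
proof -
  have "(z + h * cis \<theta>) ^ j = (\<Sum>i\<le>j. of_nat (j choose i) * (h * cis \<theta>) ^ i * z ^ (j - i))"
    using binomial_ring[of "h * cis \<theta>" z j] by (simp add: add.commute)
  also have "\<dots> = (\<Sum>i\<le>j. of_nat (j choose i) * z ^ (j - i) * of_real (h ^ i) * cis (i * \<theta>))"
    by (intro sum.cong refl) (simp add: power_mult_distrib Complex.DeMoivre mult_ac)
  also have "\<dots> = (\<Sum>i\<in>{..j} \<inter> {..<2}. of_nat (j choose i) * z ^ (j - i) * of_real (h ^ i) * cis (i * \<theta>)) +
      (\<Sum>i\<in>{2..j}. of_nat (j choose i) * z ^ (j - i) * of_real (h ^ i) * cis (i * \<theta>))"
    by (subst sum.union_disjoint[symmetric]) (auto intro!: sum.cong)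
  also have "(\<Sum>i\<in>{..j} \<inter> {..<2}. of_nat (j choose i) * z ^ (j - i) * of_real (h ^ i) * cis (i * \<theta>)) =
      z ^ j + h * cis \<theta> * (j * z ^ (j - 1))"
  proof (cases "j = 0")
    case True
    then have "{..j} \<inter> {..<2} = {0}" by auto
    then show ?thesis using True by simp
  next
    case False
    then have "{..j} \<inter> {..<2} = {0, 1}" by auto
    then show ?thesis by simp
  qed
  finally show ?thesis .
qed

lemma affine_remainder_bound:
  fixes z :: complex and h \<theta> :: real
  assumes "cmod z \<le> 1" "0 \<le> h" "h \<le> 1"
  shows "cmod (\<Sum>i\<in>{2..j}. of_nat (j choose i) * z ^ (j - i) * of_real (h ^ i) * cis (i * \<theta>)) \<le> 2 ^ j * h\<^sup>2"
proof -
  have "cmod (\<Sum>i\<in>{2..j}. of_nat (j choose i) * z ^ (j - i) * of_real (h ^ i) * cis (i * \<theta>)) \<le>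
      (\<Sum>i\<in>{2..j}. real (j choose i) * h\<^sup>2)"
  proof (rule sum_norm_le)
    fix i assume i: "i \<in> {2..j}"
    have "cmod z ^ (j - i) * h ^ i \<le> 1 * h\<^sup>2"
      using assms i by (intro mult_mono power_le_one power_decreasing) auto
    then have "real (j choose i) * (cmod z ^ (j - i) * h ^ i) \<le> real (j choose i) * h\<^sup>2"
      by (intro mult_left_mono) auto
    then show "cmod (of_nat (j choose i) * z ^ (j - i) * of_real (h ^ i) * cis (i * \<theta>)) \<le> real (j choose i) * h\<^sup>2"
      using assms by (simp add: norm_mult norm_power mult_ac)
  qed
  also have "\<dots> \<le> (\<Sum>i\<le>j. real (j choose i) * h\<^sup>2)"
    by (intro sum_mono2) auto
  also have "\<dots> = 2 ^ j * h\<^sup>2"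
    using choose_row_sum[of j] by (simp flip: sum_distrib_right of_nat_sum)
  finally show ?thesis .
qed

text \<open>
  Plurisubharmonicity speaks only about affine discs, whereas a polynomial curve agrees with its tangent
  up to \<open>O(h\<^sup>2)\<close>; since \<open>N\<close> is merely Hoelder continuous, this error cannot simply be neglected. The remedy
  is a sup-convolution: maximise \<open>N(\<Sum>\<^sub>j (z\<^sup>j + s\<^sub>j) y\<^sub>j) - C |s|\<^sup>2 + \<epsilon> |z|\<^sup>2\<close> over \<open>z\<close> in the disc and all
  perturbations \<open>s\<close>. If the maximum were attained at \<open>(z\<^sub>1, s\<^sub>1)\<close> with \<open>|z\<^sub>1| < 1\<close>, compare with the
  affine disc tangent to the curve at \<open>z\<^sub>1\<close>: it is again of the form above if \<open>s\<close> takes up the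
  remainder. That remainder has mean zero and size \<open>O(h\<^sup>2)\<close>, so the penalty grows by \<open>O(h\<^sup>4)\<close> on
  average, less than the gain \<open>\<epsilon> h\<^sup>2\<close> from the last term. Hence \<open>|z\<^sub>1| = 1\<close>, and then
  \<open>penalty_absorbs_growth\<close> removes \<open>s\<^sub>1\<close>.
\<close>

theorem psh_maximum_principle:
  fixes smul :: "complex \<Rightarrow> 'a::ab_group_add \<Rightarrow> 'a" and N :: "'a \<Rightarrow> real" and y :: "nat \<Rightarrow> 'a"
  assumes vs: "vector_space smul" and q: "quasinorm smul N" and psh: "plurisubharmonic smul N"
    and bound: "\<And>z. cmod z = 1 \<Longrightarrow> N (\<Sum>j\<le>m. smul (z ^ j) (y j)) \<le> A"
    and z0: "cmod z0 \<le> 1"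
  shows "N (\<Sum>j\<le>m. smul (z0 ^ j) (y j)) \<le> A"
proof -
  interpret vector_space smul by (rule vs)
  obtain r where r: "0 < r" "r < 1" and tri: "\<And>x y. N (x + y) powr r \<le> N x powr r + N y powr r"
    using q unfolding quasinorm_def by blast
  have N0: "\<And>x. 0 \<le> N x" "N 0 = 0" and hom: "\<And>a x. N (smul a x) = cmod a * N x"
    using q unfolding quasinorm_def by blast+
  define G where "G = (\<lambda>v :: nat \<Rightarrow> complex. \<Sum>j\<le>m. smul (v j) (y j))"
  define n2 where "n2 = (\<lambda>s :: nat \<Rightarrow> complex. \<Sum>j\<le>m. (cmod (s j))\<^sup>2)"
  define L where "L = (\<Sum>j\<le>m. N (y j) powr r)"
  have L: "0 \<le> L" by (simp add: L_def sum_nonneg)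
  have n2: "0 \<le> n2 s" for s by (simp add: n2_def sum_nonneg)
  have coord: "cmod (s j) \<le> sqrt (n2 s)" if "j \<le> m" for s j
  proof (rule real_le_rsqrt)
    show "(cmod (s j))\<^sup>2 \<le> n2 s"
      unfolding n2_def using that by (intro member_le_sum) auto
  qed
  have G_bound: "N (G s) powr r \<le> L * \<rho> powr r" if "\<And>j. j \<le> m \<Longrightarrow> cmod (s j) \<le> \<rho>" for s \<rho>
  proof -
    have "N (G s) powr r \<le> (\<Sum>j\<le>m. N (smul (s j) (y j)) powr r)"
      unfolding G_def by (rule sum_powr_le[OF N0 tri]) simp
    also have "\<dots> \<le> (\<Sum>j\<le>m. N (y j) powr r * \<rho> powr r)"
    proof (rule sum_mono)
      fix j assume "j \<in> {..m}"
      then have "cmod (s j) powr r \<le> \<rho> powr r" using that r by (intro powr_mono2) auto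
      then show "N (smul (s j) (y j)) powr r \<le> N (y j) powr r * \<rho> powr r"
        using mult_left_mono[of "cmod (s j) powr r" "\<rho> powr r" "N (y j) powr r"]
        by (simp add: hom powr_mult N0 mult.commute)
    qed
    finally show ?thesis by (simp add: L_def sum_distrib_right)
  qed
  have G_add: "N (G (\<lambda>j. v j + s j)) \<le> (a powr r + L * \<rho> powr r) powr (1 / r)"
    if "N (G v) \<le> a" "\<And>j. j \<le> m \<Longrightarrow> cmod (s j) \<le> \<rho>" for v s a \<rho>
  proof -
    have "G (\<lambda>j. v j + s j) = G v + G s"
      by (simp add: G_def scale_left_distrib sum.distrib)
    then have "N (G (\<lambda>j. v j + s j)) powr r \<le> N (G v) powr r + N (G s) powr r"
      by (simp add: tri)
    also have "\<dots> \<le> a powr r + L * \<rho> powr r"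
      using that r N0 by (intro add_mono G_bound powr_mono2) auto
    finally have "(N (G (\<lambda>j. v j + s j)) powr r) powr (1 / r) \<le> (a powr r + L * \<rho> powr r) powr (1 / r)"
      using r by (intro powr_mono2) auto
    then show ?thesis using r N0 by (simp add: powr_powr)
  qed
  have A: "0 \<le> A" using bound[of 1] N0 by (meson norm_one order_trans)
  have main: "N (G (\<lambda>j. z0 ^ j)) \<le> A + 2 * \<epsilon>" if \<epsilon>: "0 < \<epsilon>" for \<epsilon>
  proof -
    obtain C where C: "0 < C"
      and pen: "\<And>\<rho>. 0 \<le> \<rho> \<Longrightarrow> (A powr r + L * \<rho> powr r) powr (1 / r) - C * \<rho>\<^sup>2 \<le> A + \<epsilon>"
      using penalty_absorbs_growth[OF r(1) A L \<epsilon>] by blast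
    define U where "U = (\<lambda>z s. N (G (\<lambda>j. z ^ j + s j)) - C * n2 s + \<epsilon> * (cmod z)\<^sup>2)"
    define E where "E = (2 * L) powr (1 / r)"
    define R where "R = max 1 ((E + \<epsilon>) / C)"
    have E: "0 \<le> E" by (simp add: E_def)
    \<comment> \<open>The penalty dominates outside a large box, so the maximum over all \<open>s\<close> exists.\<close>
    have U_neg: "U z s \<le> 0" if z: "cmod z \<le> 1" and s: "R \<le> sqrt (n2 s)" for z s
    proof -
      define \<rho> where "\<rho> = sqrt (n2 s)"
      have \<rho>: "1 \<le> \<rho>" "(E + \<epsilon>) / C \<le> \<rho>" using s by (auto simp: R_def \<rho>_def)
      have "N (G (\<lambda>j. z ^ j)) powr r \<le> L * 1 powr r"
        using z by (intro G_bound) (auto simp: norm_power intro: power_le_one)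
      then have "(N (G (\<lambda>j. z ^ j)) powr r) powr (1 / r) \<le> L powr (1 / r)"
        using r by (intro powr_mono2) auto
      then have "N (G (\<lambda>j. z ^ j)) \<le> L powr (1 / r)" using r N0 by (simp add: powr_powr)
      then have "N (G (\<lambda>j. z ^ j + s j)) \<le> ((L powr (1 / r)) powr r + L * \<rho> powr r) powr (1 / r)"
        using coord by (intro G_add) (auto simp: \<rho>_def)
      also have "\<dots> \<le> (2 * L * \<rho> powr r) powr (1 / r)"
      proof (rule powr_mono2)
        have "L * 1 \<le> L * \<rho> powr r" using \<rho> r L by (intro mult_left_mono ge_one_powr_ge_zero) auto
        then show "(L powr (1 / r)) powr r + L * \<rho> powr r \<le> 2 * L * \<rho> powr r"
          using r L by (simp add: powr_powr)
      qed (use r L in auto)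
      also have "\<dots> = E * \<rho>" using r L \<rho> by (simp add: powr_mult powr_powr E_def)
      finally have "N (G (\<lambda>j. z ^ j + s j)) \<le> E * \<rho>" .
      moreover have "E * \<rho> + \<epsilon> \<le> C * n2 s"
      proof -
        have "E * \<rho> + \<epsilon> * 1 \<le> E * \<rho> + \<epsilon> * \<rho>" using \<epsilon> \<rho> by (intro add_left_mono mult_left_mono) auto
        also have "\<dots> = (E + \<epsilon>) * \<rho>" by (simp add: distrib_right)
        also have "\<dots> \<le> (C * \<rho>) * \<rho>"
          using \<rho> C by (intro mult_right_mono) (auto simp: field_simps)
        also have "\<dots> = C * n2 s" using n2[of s] by (simp add: \<rho>_def mult.assoc)
        finally show ?thesis by simp
      qed
      moreover have "\<epsilon> * (cmod z)\<^sup>2 \<le> \<epsilon> * 1"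
        using z \<epsilon> by (intro mult_left_mono power_le_one) auto
      ultimately show ?thesis by (simp add: U_def)
    qed
    have U_zero: "0 \<le> U 0 (\<lambda>_. 0)" using N0 by (simp add: U_def n2_def)
    define Box where "Box = {s :: nat \<Rightarrow> complex. \<forall>j. s j \<in> (if j \<le> m then cball 0 R else {0})}"
    have R: "0 < R" by (simp add: R_def)
    have "\<exists>p\<in>cball 0 1 \<times> Box. \<forall>p'\<in>cball 0 1 \<times> Box. U (fst p') (snd p') \<le> U (fst p) (snd p)"
    proof (rule continuous_attains_sup)
      show "compact (cball (0::complex) 1 \<times> Box)"
        unfolding Box_def by (intro compact_Times compact_cball compact_finite_box)
      have "(0, \<lambda>_. 0) \<in> cball (0::complex) 1 \<times> Box" using R by (auto simp: Box_def)
      then show "cball (0::complex) 1 \<times> Box \<noteq> {}" by blast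
      have coordc: "continuous_on S (\<lambda>p :: complex \<times> (nat \<Rightarrow> complex). snd p j)" for S j
        by (rule continuous_on_product_then_coordinatewise) (intro continuous_intros)
      have "continuous_on (cball 0 1 \<times> Box) (\<lambda>p. N (\<Sum>j\<in>{..m}. smul (fst p ^ j + snd p j) (y j)))"
        by (intro quasinorm_sum_continuous[OF vs q] continuous_intros coordc) auto
      then show "continuous_on (cball 0 1 \<times> Box) (\<lambda>p. U (fst p) (snd p))"
        unfolding U_def G_def n2_def by (intro continuous_intros coordc)
    qed
    then obtain z1 s1 where z1: "cmod z1 \<le> 1" and s1: "s1 \<in> Box"
      and max_Box: "\<And>z s. cmod z \<le> 1 \<Longrightarrow> s \<in> Box \<Longrightarrow> U z s \<le> U z1 s1" by auto
    have max: "U z s \<le> U z1 s1" if z: "cmod z \<le> 1" for z s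
    proof (cases "\<forall>j\<le>m. cmod (s j) \<le> R")
      case True
      define s' where "s' = (\<lambda>j. if j \<le> m then s j else 0)"
      have "U z s = U z s'" by (simp add: U_def G_def n2_def s'_def)
      moreover have "s' \<in> Box" using True by (auto simp: Box_def s'_def)
      ultimately show ?thesis using max_Box z by auto
    next
      case False
      then obtain j where "j \<le> m" "R < cmod (s j)" by (auto simp: not_le)
      then have "R \<le> sqrt (n2 s)" using coord[of j s] by linarith
      then have "U z s \<le> 0" by (rule U_neg[OF z])
      also have "\<dots> \<le> U 0 (\<lambda>_. 0)" by (rule U_zero)
      also have "\<dots> \<le> U z1 s1" using R by (intro max_Box) (auto simp: Box_def)
      finally show ?thesis .
    qed
    have "cmod z1 = 1"
    proof (rule ccontr)
      assume "cmod z1 \<noteq> 1"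
      then have z1': "cmod z1 < 1" using z1 by simp
      define B where "B = C * ((real m + 1) * 4 ^ m)"
      have B: "0 < B" using C by (simp add: B_def)
      define h where "h = min (1 - cmod z1) (sqrt (\<epsilon> / (2 * B)))"
      have h: "0 < h" "h \<le> 1" "cmod z1 + h \<le> 1" "h \<le> sqrt (\<epsilon> / (2 * B))"
      proof -
        show "0 < h" using z1' B \<epsilon> by (simp add: h_def)
        have "h \<le> 1 - cmod z1" unfolding h_def by (rule min.cobounded1)
        then show "h \<le> 1" "cmod z1 + h \<le> 1" using norm_ge_zero[of z1] by linarith+
        show "h \<le> sqrt (\<epsilon> / (2 * B))" unfolding h_def by (rule min.cobounded2)
      qed
      have h2: "B * h\<^sup>2 < \<epsilon>"
      proof -
        have "h\<^sup>2 \<le> (sqrt (\<epsilon> / (2 * B)))\<^sup>2" using h by (intro power_mono) auto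
        also have "\<dots> = \<epsilon> / (2 * B)" using \<epsilon> B by simp
        finally have "B * h\<^sup>2 \<le> B * (\<epsilon> / (2 * B))" using B by (intro mult_left_mono) auto
        then show ?thesis using B \<epsilon> by simp
      qed
      define d where "d = (\<lambda>j \<theta>. \<Sum>i\<in>{2..j}. of_nat (j choose i) * z1 ^ (j - i) * of_real (h ^ i) * cis (real i * \<theta>))"
      have d_bound: "cmod (d j \<theta>) \<le> 2 ^ j * h\<^sup>2" for j \<theta>
        unfolding d_def using z1 h by (intro affine_remainder_bound) auto
      have d_int: "(d j has_integral 0) {0..2 * pi}" for j
      proof -
        have "(d j has_integral (\<Sum>i\<in>{2..j}. of_nat (j choose i) * z1 ^ (j - i) * of_real (h ^ i) * 0)) {0..2 * pi}"
          unfolding d_def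
          by (intro has_integral_sum has_integral_mult_right has_integral_cis_multiple) auto
        then show ?thesis by simp
      qed
      define X where "X = G (\<lambda>j. z1 ^ j + s1 j)"
      define Y where "Y = G (\<lambda>j. of_real h * (of_nat j * z1 ^ (j - 1)))"
      define s where "s = (\<lambda>\<theta> j. s1 j - d j \<theta>)"
      \<comment> \<open>The tangent disc, with the remainder \<open>d\<close> hidden in the perturbation \<open>s\<close>.\<close>
      have disc: "X + smul (cis \<theta>) Y = G (\<lambda>j. (z1 + h * cis \<theta>) ^ j + s \<theta> j)" for \<theta>
        unfolding X_def Y_def G_def s_def d_def affine_remainder scale_sum_right sum.distrib[symmetric]
        by (intro sum.cong refl) (simp add: algebra_simps)
      define P where "P = (\<lambda>\<theta>. (\<Sum>j\<le>m. of_real (- 2 * C) * cnj (s1 j) * d j \<theta>) - of_real (2 * \<epsilon> * h) * cnj z1 * cis (real 1 * \<theta>))"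
      define c0 where "c0 = U z1 s1 + C * n2 s1 + B * h ^ 4 - \<epsilon> * ((cmod z1)\<^sup>2 + h\<^sup>2)"
      have P_int: "((\<lambda>\<theta>. c0 + Re (P \<theta>)) has_integral 2 * pi * c0) {0..2 * pi}"
      proof -
        have "(P has_integral (\<Sum>j\<le>m. of_real (- 2 * C) * cnj (s1 j) * 0) - of_real (2 * \<epsilon> * h) * cnj z1 * 0) {0..2 * pi}"
          unfolding P_def
          by (intro has_integral_diff has_integral_sum has_integral_mult_right d_int has_integral_cis_multiple) auto
        then have "(P has_integral 0) {0..2 * pi}" by simp
        from has_integral_linear[OF this bounded_linear_Re]
        have "((\<lambda>\<theta>. Re (P \<theta>)) has_integral 0) {0..2 * pi}" by (simp add: o_def)
        moreover have "((\<lambda>\<theta>. c0) has_integral 2 * pi * c0) {0..2 * pi}"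
          using has_integral_const_real[of c0 0 "2 * pi"] by simp
        ultimately have "((\<lambda>\<theta>. c0 + Re (P \<theta>)) has_integral 2 * pi * c0 + 0) {0..2 * pi}"
          by (intro has_integral_add)
        then show ?thesis by simp
      qed
      have le: "N (X + smul (cis \<theta>) Y) \<le> c0 + Re (P \<theta>)" for \<theta>
      proof -
        define z where "z = z1 + h * cis \<theta>"
        have "cmod z \<le> 1" using norm_triangle_ineq[of z1 "h * cis \<theta>"] h by (simp add: z_def norm_mult)
        from max[OF this, of "s \<theta>"]
        have 1: "N (X + smul (cis \<theta>) Y) \<le> U z1 s1 + C * n2 (s \<theta>) - \<epsilon> * (cmod z)\<^sup>2"
          unfolding disc by (simp add: U_def z_def)
        have 2: "n2 (s \<theta>) \<le> n2 s1 + (\<Sum>j\<le>m. - 2 * Re (cnj (s1 j) * d j \<theta>)) + (real m + 1) * 4 ^ m * h ^ 4"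
        proof -
          have "(cmod (s \<theta> j))\<^sup>2 \<le> (cmod (s1 j))\<^sup>2 + - 2 * Re (cnj (s1 j) * d j \<theta>) + 4 ^ m * h ^ 4" if "j \<le> m" for j
          proof -
            have "(cmod (s \<theta> j))\<^sup>2 = (cmod (s1 j))\<^sup>2 + - 2 * Re (cnj (s1 j) * d j \<theta>) + (cmod (d j \<theta>))\<^sup>2"
              unfolding s_def cmod_power2 by (simp add: power2_eq_square algebra_simps)
            also have "(cmod (d j \<theta>))\<^sup>2 \<le> (2 ^ j * h\<^sup>2)\<^sup>2" by (intro power_mono d_bound) auto
            also have "(2 ^ j * h\<^sup>2)\<^sup>2 = 4 ^ j * h ^ 4"
              by (simp add: power_mult_distrib flip: power_mult) (simp add: mult.commute[of j] power_mult)
            also have "\<dots> \<le> 4 ^ m * h ^ 4"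
              using that h by (intro mult_right_mono power_increasing) auto
            finally show ?thesis by simp
          qed
          then have "n2 (s \<theta>) \<le> (\<Sum>j\<le>m. (cmod (s1 j))\<^sup>2 + - 2 * Re (cnj (s1 j) * d j \<theta>) + 4 ^ m * h ^ 4)"
            unfolding n2_def by (intro sum_mono) auto
          also have "\<dots> = n2 s1 + (\<Sum>j\<le>m. - 2 * Re (cnj (s1 j) * d j \<theta>)) + (real m + 1) * 4 ^ m * h ^ 4"
            unfolding n2_def sum.distrib by (simp add: add.commute)
          finally show ?thesis .
        qed
        have 3: "(cmod z)\<^sup>2 = (cmod z1)\<^sup>2 + h\<^sup>2 + 2 * h * Re (cnj z1 * cis \<theta>)"
        proof -
          have "h * (h * (cos \<theta> * cos \<theta>)) + h * (h * (sin \<theta> * sin \<theta>)) =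
              h * h * ((cos \<theta>)\<^sup>2 + (sin \<theta>)\<^sup>2)"
            unfolding power2_eq_square by (simp only: distrib_left mult.assoc)
          also have "\<dots> = h * h" by simp
          finally show ?thesis
            unfolding z_def cmod_power2 by (simp add: power2_eq_square algebra_simps)
        qed
        have 4: "U z1 s1 + C * (n2 s1 + (\<Sum>j\<le>m. - 2 * Re (cnj (s1 j) * d j \<theta>)) + (real m + 1) * 4 ^ m * h ^ 4) -
            \<epsilon> * ((cmod z1)\<^sup>2 + h\<^sup>2 + 2 * h * Re (cnj z1 * cis \<theta>)) = c0 + Re (P \<theta>)"
        proof -
          have "Re (P \<theta>) = C * (\<Sum>j\<le>m. - 2 * Re (cnj (s1 j) * d j \<theta>)) - \<epsilon> * (2 * h * Re (cnj z1 * cis \<theta>))"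
          proof -
            have "Re (\<Sum>j\<le>m. of_real (- 2 * C) * cnj (s1 j) * d j \<theta>) = C * (\<Sum>j\<le>m. - 2 * Re (cnj (s1 j) * d j \<theta>))"
              unfolding Re_sum sum_distrib_left by (intro sum.cong refl) (simp add: algebra_simps)
            moreover have "Re (of_real (2 * \<epsilon> * h) * cnj z1 * cis (real 1 * \<theta>)) = \<epsilon> * (2 * h * Re (cnj z1 * cis \<theta>))"
              by (simp add: algebra_simps)
            ultimately show ?thesis by (simp add: P_def)
          qed
          then show ?thesis by (simp add: c0_def B_def algebra_simps)
        qed
        show ?thesis using 1 mult_left_mono[OF 2 less_imp_le[OF C]] unfolding 3 4[symmetric] by linarith
      qed
      have int: "(\<lambda>\<theta>. N (X + smul (cis \<theta>) Y)) integrable_on {0..2 * pi}"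
      proof (rule integrable_continuous_real)
        have "continuous_on {0..2 * pi} (\<lambda>\<theta>. N (\<Sum>i\<in>{False, True}. smul (if i then cis \<theta> else 1) (if i then Y else X)))"
        proof (rule quasinorm_sum_continuous[OF vs q])
          fix i :: bool
          show "continuous_on {0..2 * pi} (\<lambda>\<theta>. if i then cis \<theta> else 1)"
            by (cases i) (auto intro!: continuous_intros)
        qed simp
        then show "continuous_on {0..2 * pi} (\<lambda>\<theta>. N (X + smul (cis \<theta>) Y))" by simp
      qed
      have "N X \<le> integral {0..2 * pi} (\<lambda>\<theta>. N (X + smul (cis \<theta>) Y)) / (2 * pi)"
        using psh unfolding plurisubharmonic_def by blast
      also have "\<dots> \<le> (2 * pi * c0) / (2 * pi)"
        using le integral_le[OF int has_integral_integrable[OF P_int]] integral_unique[OF P_int]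
        by (intro divide_right_mono) auto
      also have "\<dots> = c0" by simp
      also have "c0 = N X + B * h ^ 4 - \<epsilon> * h\<^sup>2"
        by (simp add: c0_def U_def X_def algebra_simps)
      finally have "\<epsilon> * h\<^sup>2 \<le> (B * h\<^sup>2) * h\<^sup>2" by (simp add: power_numeral_reduce)
      moreover have "(B * h\<^sup>2) * h\<^sup>2 < \<epsilon> * h\<^sup>2" using h2 h by (intro mult_strict_right_mono) auto
      ultimately show False by linarith
    qed
    have "N (G (\<lambda>j. z0 ^ j)) \<le> U z0 (\<lambda>_. 0)" using \<epsilon> by (simp add: U_def n2_def)
    also have "\<dots> \<le> U z1 s1" by (rule max[OF z0])
    also have "\<dots> = N (G (\<lambda>j. z1 ^ j + s1 j)) - C * (sqrt (n2 s1))\<^sup>2 + \<epsilon>"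
      using \<open>cmod z1 = 1\<close> n2[of s1] by (simp add: U_def)
    also have "\<dots> \<le> (A powr r + L * sqrt (n2 s1) powr r) powr (1 / r) - C * (sqrt (n2 s1))\<^sup>2 + \<epsilon>"
    proof -
      have "N (G (\<lambda>j. z1 ^ j + s1 j)) \<le> (A powr r + L * sqrt (n2 s1) powr r) powr (1 / r)"
      using bound[OF \<open>cmod z1 = 1\<close>] coord by (intro G_add) (auto simp: G_def)
      then show ?thesis by simp
    qed
    also have "\<dots> \<le> A + 2 * \<epsilon>"
      using pen[of "sqrt (n2 s1)"] n2[of s1] by simp
    finally show ?thesis by simp
  qed
  have "N (G (\<lambda>j. z0 ^ j)) \<le> A"
  proof (rule field_le_epsilon)
    fix e :: real assume "0 < e"
    then show "N (G (\<lambda>j. z0 ^ j)) \<le> A + e" using main[of "e / 2"] by simp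
  qed
  then show ?thesis by (simp add: G_def)
qed

section \<open>Plurisubharmonic functionals and multipliers\<close>

text \<open>
  The properties of \<open>m \<mapsto> N(\<Sum>\<^sub>l m\<^sub>l x\<^sub>l)\<^sup>r\<close> that are used. The last clause is the maximum principle
  along the curves \<open>Z \<mapsto> (V\<^sub>k + b\<^sub>k (Z\<^bsup>e k\<^esup> - \<rho>\<^bsup>e k\<^esup>))\<^sub>k\<close>, which pass through \<open>V\<close> at the interior point
  \<open>Z = \<rho>\<close>. Working with the \<open>r\<close>-th power turns the \<open>r\<close>-triangle inequality into subadditivity.
\<close>

definition psh_functional :: "real \<Rightarrow> nat set \<Rightarrow> ((nat \<Rightarrow> complex) \<Rightarrow> real) \<Rightarrow> bool" where
  "psh_functional r F \<Psi> \<longleftrightarrow>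
     0 < r \<and> r < 1 \<and> finite F \<and>
     (\<forall>m. 0 \<le> \<Psi> m) \<and>
     (\<forall>m m'. \<Psi> (\<lambda>k. m k + m' k) \<le> \<Psi> m + \<Psi> m') \<and>
     (\<forall>c m. \<Psi> (\<lambda>k. c * m k) = cmod c powr r * \<Psi> m) \<and>
     (\<forall>m m'. (\<forall>k\<in>F. m k = m' k) \<longrightarrow> \<Psi> m = \<Psi> m') \<and>
     (\<forall>V b e \<rho>. 0 \<le> \<rho> \<longrightarrow> \<rho> \<le> 1 \<longrightarrow>
        (\<exists>Z. cmod Z = 1 \<and> \<Psi> V \<le> \<Psi> (\<lambda>k. V k + b k * (Z ^ e k - complex_of_real \<rho> ^ e k))))"

lemma psh_functionalD:
  assumes "psh_functional r F \<Psi>"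
  shows psh_r: "0 < r" "r < 1" and psh_finite: "finite F" and psh_nonneg: "0 \<le> \<Psi> m"
    and psh_add: "\<Psi> (\<lambda>k. m k + m' k) \<le> \<Psi> m + \<Psi> m'"
    and psh_scale: "\<Psi> (\<lambda>k. c * m k) = cmod c powr r * \<Psi> m"
    and psh_cong: "(\<And>k. k \<in> F \<Longrightarrow> m k = m' k) \<Longrightarrow> \<Psi> m = \<Psi> m'"
    and psh_max: "0 \<le> \<rho> \<Longrightarrow> \<rho> \<le> 1 \<Longrightarrow>
        \<exists>Z. cmod Z = 1 \<and> \<Psi> V \<le> \<Psi> (\<lambda>k. V k + b k * (Z ^ e k - complex_of_real \<rho> ^ e k))"
  using assms unfolding psh_functional_def by (blast+)

text \<open>
  Stability under pointwise weights is what makes multipliers composable and lets the induction restrict to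
  a subset of the frequencies.
\<close>

lemma psh_weighted:
  assumes g: "psh_functional r F \<Psi>"
  shows "psh_functional r F (\<lambda>m. \<Psi> (\<lambda>k. v k * m k))"
  unfolding psh_functional_def
proof (intro conjI allI impI)
  show "0 < r" "r < 1" "finite F" using psh_functionalD[OF g] by blast+
  fix m m' show "0 \<le> \<Psi> (\<lambda>k. v k * m k)" by (rule psh_nonneg[OF g])
  show "\<Psi> (\<lambda>k. v k * (m k + m' k)) \<le> \<Psi> (\<lambda>k. v k * m k) + \<Psi> (\<lambda>k. v k * m' k)"
    using psh_add[OF g, of "\<lambda>k. v k * m k" "\<lambda>k. v k * m' k"] by (simp add: algebra_simps)
  fix c show "\<Psi> (\<lambda>k. v k * (c * m k)) = cmod c powr r * \<Psi> (\<lambda>k. v k * m k)"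
    using psh_scale[OF g, of c "\<lambda>k. v k * m k"] by (simp add: algebra_simps)
next
  fix m m' :: "nat \<Rightarrow> complex" assume "\<forall>k\<in>F. m k = m' k"
  then show "\<Psi> (\<lambda>k. v k * m k) = \<Psi> (\<lambda>k. v k * m' k)"
    by (intro psh_cong[OF g]) auto
next
  fix V b :: "nat \<Rightarrow> complex" and e and \<rho> :: real assume "0 \<le> \<rho>" "\<rho> \<le> 1"
  from psh_max[OF g this, of "\<lambda>k. v k * V k" "\<lambda>k. v k * b k" e]
  show "\<exists>Z. cmod Z = 1 \<and> \<Psi> (\<lambda>k. v k * V k) \<le> \<Psi> (\<lambda>k. v k * (V k + b k * (Z ^ e k - complex_of_real \<rho> ^ e k)))"
    by (simp add: algebra_simps)
qed

lemma psh_restrict: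
  assumes g: "psh_functional r F \<Psi>" and "S \<subseteq> F"
  shows "psh_functional r S (\<lambda>m. \<Psi> (\<lambda>k. of_bool (k \<in> S) * m k))"
proof -
  from psh_weighted[OF g, of "\<lambda>k. of_bool (k \<in> S)"]
  have g': "psh_functional r F (\<lambda>m. \<Psi> (\<lambda>k. of_bool (k \<in> S) * m k))" .
  show ?thesis
    unfolding psh_functional_def
  proof (intro conjI allI impI)
    show "finite S" using assms(2) psh_finite[OF g] finite_subset by blast
    fix m m' :: "nat \<Rightarrow> complex" assume "\<forall>k\<in>S. m k = m' k"
    then show "\<Psi> (\<lambda>k. of_bool (k \<in> S) * m k) = \<Psi> (\<lambda>k. of_bool (k \<in> S) * m' k)"
      by (intro psh_cong[OF g]) auto
  qed (use g' in \<open>auto simp: psh_functional_def\<close>)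
qed

lemma psh_zero: assumes g: "psh_functional r F \<Psi>" shows "\<Psi> (\<lambda>k. 0) = 0"
  using psh_scale[OF g, of 0 "\<lambda>k. 0"] by simp

lemma psh_sum:
  assumes g: "psh_functional r F \<Psi>" and "finite I"
  shows "\<Psi> (\<lambda>k. \<Sum>i\<in>I. m i k) \<le> (\<Sum>i\<in>I. \<Psi> (m i))"
  using \<open>finite I\<close>
proof (induction I rule: finite_induct)
  case empty
  then show ?case by (simp add: psh_zero[OF g])
next
  case (insert i I)
  then show ?case using psh_add[OF g, of "m i" "\<lambda>k. \<Sum>i\<in>I. m i k"] by simp
qed

lemma psh_bdd_above:
  assumes g: "psh_functional r F \<Psi>"
  shows "bdd_above (\<Psi> ` {m. \<forall>k\<in>F. cmod (m k) \<le> 1})"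
proof (rule bdd_aboveI2)
  fix m assume m: "m \<in> {m. \<forall>k\<in>F. cmod (m k) \<le> 1}"
  have "\<Psi> m = \<Psi> (\<lambda>k. \<Sum>i\<in>F. m i * of_bool (k = i))"
    by (rule psh_cong[OF g]) (simp add: psh_finite[OF g] if_distrib of_bool_def cong: if_cong)
  also have "\<dots> \<le> (\<Sum>i\<in>F. \<Psi> (\<lambda>k. m i * of_bool (k = i)))"
    by (rule psh_sum[OF g psh_finite[OF g]])
  also have "\<dots> = (\<Sum>i\<in>F. cmod (m i) powr r * \<Psi> (\<lambda>k. of_bool (k = i)))"
    by (simp add: psh_scale[OF g])
  also have "\<dots> \<le> (\<Sum>i\<in>F. 1 * \<Psi> (\<lambda>k. of_bool (k = i)))"
    using m psh_r[OF g] by (intro sum_mono mult_right_mono psh_nonneg[OF g]) (auto intro!: powr_le1)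
  finally show "\<Psi> m \<le> (\<Sum>i\<in>F. 1 * \<Psi> (\<lambda>k. of_bool (k = i)))" .
qed

definition psh_bound :: "nat set \<Rightarrow> ((nat \<Rightarrow> complex) \<Rightarrow> real) \<Rightarrow> real" where
  "psh_bound F \<Psi> = Sup (\<Psi> ` {m. \<forall>k\<in>F. cmod (m k) \<le> 1})"

lemma psh_le_bound:
  assumes g: "psh_functional r F \<Psi>" and s: "0 \<le> s" and m: "\<And>k. k \<in> F \<Longrightarrow> cmod (m k) \<le> s"
  shows "\<Psi> m \<le> s powr r * psh_bound F \<Psi>"
proof (cases "s = 0")
  case True
  then have "\<Psi> m = \<Psi> (\<lambda>k. 0)" using m by (intro psh_cong[OF g]) auto
  with True show ?thesis by (simp add: psh_zero[OF g])
next
  case False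
  then have s: "s > 0" using s by auto
  have "\<Psi> m = \<Psi> (\<lambda>k. of_real s * (m k / of_real s))" using s by simp
  also have "\<dots> = s powr r * \<Psi> (\<lambda>k. m k / of_real s)"
    unfolding psh_scale[OF g] using s by simp
  also have "\<dots> \<le> s powr r * psh_bound F \<Psi>"
    unfolding psh_bound_def
    by (intro mult_left_mono cSup_upper psh_bdd_above[OF g]) (use s m in \<open>auto simp: norm_divide\<close>)
  finally show ?thesis .
qed

lemma psh_bound_nonneg: assumes g: "psh_functional r F \<Psi>" shows "0 \<le> psh_bound F \<Psi>"
  using psh_le_bound[OF g, of 1 "\<lambda>_. 0"] psh_nonneg[OF g, of "\<lambda>_. 0"] by simp

lemma psh_bound_le:
  assumes "\<And>m. (\<forall>k\<in>F. cmod (m k) \<le> 1) \<Longrightarrow> \<Psi> m \<le> C"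
  shows "psh_bound F \<Psi> \<le> C"
  unfolding psh_bound_def
  by (rule cSup_least) (use assms in \<open>auto intro!: exI[of _ "\<lambda>_. 0"]\<close>)

section \<open>Multipliers\<close>

text \<open>
  The constant \<open>C\<close> is required to serve all functionals on \<open>F\<close> at once. Applied to weighted functionals, this
  uniformity makes products of multipliers multipliers again.
\<close>

definition multiplier :: "real \<Rightarrow> nat set \<Rightarrow> real \<Rightarrow> (nat \<Rightarrow> complex) \<Rightarrow> bool" where
  "multiplier r F C v \<longleftrightarrow> 0 \<le> C \<and>
     (\<forall>\<Psi> A. psh_functional r F \<Psi> \<longrightarrow> (\<forall>u. cmod u = 1 \<longrightarrow> \<Psi> (\<lambda>k. u ^ k) \<le> A) \<longrightarrow>
        (\<forall>u. cmod u = 1 \<longrightarrow> \<Psi> (\<lambda>k. v k * u ^ k) \<le> C * A))"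

lemma multiplierD:
  assumes "multiplier r F C v" "psh_functional r F \<Psi>" "\<And>u. cmod u = 1 \<Longrightarrow> \<Psi> (\<lambda>k. u ^ k) \<le> A" "cmod u = 1"
  shows "\<Psi> (\<lambda>k. v k * u ^ k) \<le> C * A"
  using assms unfolding multiplier_def by blast

lemma multiplier_character:
  assumes "cmod w = 1" shows "multiplier r F 1 (\<lambda>k. w ^ k)"
  unfolding multiplier_def
proof (intro conjI allI impI)
  fix \<Psi> :: "(nat \<Rightarrow> complex) \<Rightarrow> real" and A u
  assume "\<forall>u. cmod u = 1 \<longrightarrow> \<Psi> (\<lambda>k. u ^ k) \<le> A" "cmod u = 1"
  then show "\<Psi> (\<lambda>k. w ^ k * u ^ k) \<le> 1 * A"
    using assms by (auto simp: norm_mult simp flip: power_mult_distrib)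
qed auto

lemma multiplier_add:
  assumes "multiplier r F C v" "multiplier r F C' v'"
  shows "multiplier r F (C + C') (\<lambda>k. v k + v' k)"
  unfolding multiplier_def
proof (intro conjI allI impI)
  show "0 \<le> C + C'" using assms by (simp add: multiplier_def)
  fix \<Psi> A u assume *: "psh_functional r F \<Psi>" "\<forall>u. cmod u = 1 \<longrightarrow> \<Psi> (\<lambda>k. u ^ k) \<le> A" "cmod u = 1"
  have "\<Psi> (\<lambda>k. v k * u ^ k + v' k * u ^ k) \<le> \<Psi> (\<lambda>k. v k * u ^ k) + \<Psi> (\<lambda>k. v' k * u ^ k)"
    by (rule psh_add[OF *(1)])
  also have "\<dots> \<le> C * A + C' * A"
    using * by (intro add_mono multiplierD[OF assms(1)] multiplierD[OF assms(2)]) auto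
  finally show "\<Psi> (\<lambda>k. (v k + v' k) * u ^ k) \<le> (C + C') * A"
    by (simp add: algebra_simps)
qed

lemma multiplier_mult:
  assumes "multiplier r F C v" "multiplier r F C' v'"
  shows "multiplier r F (C * C') (\<lambda>k. v k * v' k)"
  unfolding multiplier_def
proof (intro conjI allI impI)
  show "0 \<le> C * C'" using assms by (simp add: multiplier_def)
  fix \<Psi> A u assume *: "psh_functional r F \<Psi>" "\<forall>u. cmod u = 1 \<longrightarrow> \<Psi> (\<lambda>k. u ^ k) \<le> A" "cmod u = 1"
  have "\<Psi> (\<lambda>k. v' k * (v k * u ^ k)) \<le> C * (C' * A)"
  proof (rule multiplierD[OF assms(1) psh_weighted[OF *(1)] _ *(3)])
    fix u :: complex assume "cmod u = 1"
    then show "\<Psi> (\<lambda>k. v' k * u ^ k) \<le> C' * A" using * by (intro multiplierD[OF assms(2)]) auto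
  qed
  then show "\<Psi> (\<lambda>k. v k * v' k * u ^ k) \<le> C * C' * A"
    by (simp add: mult_ac)
qed

lemma multiplier_scale:
  assumes "multiplier r F C v" "cmod c \<le> 1"
  shows "multiplier r F C (\<lambda>k. c * v k)"
  unfolding multiplier_def
proof (intro conjI allI impI)
  show "0 \<le> C" using assms by (simp add: multiplier_def)
  fix \<Psi> A u assume *: "psh_functional r F \<Psi>" "\<forall>u. cmod u = 1 \<longrightarrow> \<Psi> (\<lambda>k. u ^ k) \<le> A" "cmod u = 1"
  have "\<Psi> (\<lambda>k. c * (v k * u ^ k)) = cmod c powr r * \<Psi> (\<lambda>k. v k * u ^ k)"
    by (rule psh_scale[OF *(1)])
  also have "\<dots> \<le> 1 * \<Psi> (\<lambda>k. v k * u ^ k)"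
    using psh_r[OF *(1)] assms(2) by (intro mult_right_mono psh_nonneg[OF *(1)] powr_le1) auto
  also have "\<dots> \<le> C * A" using multiplierD[OF assms(1) *(1) _ *(3)] * by auto
  finally show "\<Psi> (\<lambda>k. c * v k * u ^ k) \<le> C * A" by (simp add: mult_ac)
qed

lemma multiplier_one: "multiplier r F 1 (\<lambda>k. 1)"
  using multiplier_character[of 1] by simp

lemma multiplier_power:
  assumes "multiplier r F C v" shows "multiplier r F (C ^ n) (\<lambda>k. v k ^ n)"
proof (induction n)
  case 0 then show ?case by (simp add: multiplier_one)
next
  case (Suc n) then show ?case using multiplier_mult[OF assms Suc] by simp
qed

lemma multiplier_prod:
  assumes "finite I" "\<And>i. i \<in> I \<Longrightarrow> multiplier r F C (v i)"
  shows "multiplier r F (C ^ card I) (\<lambda>k. \<Prod>i\<in>I. v i k)"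
  using assms
proof (induction I rule: finite_induct)
  case empty then show ?case by (simp add: multiplier_one)
next
  case (insert i I)
  then have "multiplier r F (C * C ^ card I) (\<lambda>k. v i k * (\<Prod>i\<in>I. v i k))"
    by (intro multiplier_mult) auto
  then show ?case using insert by simp
qed

lemma cmod_one_plus_sq:
  fixes X :: complex assumes "cmod X = 1"
  shows "complex_of_real ((cmod (1 + X))\<^sup>2 / 4) = 1/2 * 1 + 1/4 * X + 1/4 * cnj X"
    and "(cmod (1 + X))\<^sup>2 / 4 = 1 - (cmod (1 - X))\<^sup>2 / 4"
proof -
  have X: "(Re X)\<^sup>2 + (Im X)\<^sup>2 = 1" using assms by (simp add: cmod_def)
  have 1: "(cmod (1 + X))\<^sup>2 = 2 + 2 * Re X" "(cmod (1 - X))\<^sup>2 = 2 - 2 * Re X"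
    using X unfolding cmod_power2 by (simp_all add: power2_eq_square algebra_simps)
  show "(cmod (1 + X))\<^sup>2 / 4 = 1 - (cmod (1 - X))\<^sup>2 / 4" unfolding 1 by (simp add: field_simps)
  show "complex_of_real ((cmod (1 + X))\<^sup>2 / 4) = 1/2 * 1 + 1/4 * X + 1/4 * cnj X"
    unfolding 1(1) by (simp add: complex_eq_iff)
qed

text \<open>
  For unimodular \<open>X\<close> the number \<open>|1 + X|\<^sup>2 / 4\<close> is a combination of \<open>1\<close>, \<open>X\<close> and \<open>cnj X\<close>. This power is close
  to one near \<open>X = 1\<close> and small elsewhere; the next one vanishes at \<open>X = -1\<close> and is close to one elsewhere.
  Both have values in \<open>[0, 1]\<close>.
\<close>

lemma multiplier_cos:
  assumes "cmod u = 1"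
  shows "multiplier r F (3 ^ n) (\<lambda>k. complex_of_real (((cmod (1 + u ^ k))\<^sup>2 / 4) ^ n))"
proof -
  have "multiplier r F 1 (\<lambda>k. cnj (u ^ k))"
    using multiplier_character[of "cnj u" r F] assms by simp
  then have "multiplier r F (1 + 1 + 1) (\<lambda>k. 1/2 * 1 + 1/4 * u ^ k + 1/4 * cnj (u ^ k))"
    using assms
    by (intro multiplier_add multiplier_scale multiplier_one multiplier_character) (auto simp: norm_divide)
  moreover have "complex_of_real (((cmod (1 + u ^ k))\<^sup>2 / 4)) = 1/2 * 1 + 1/4 * u ^ k + 1/4 * cnj (u ^ k)" for k
    using assms by (intro cmod_one_plus_sq(1)) (simp add: norm_power)
  ultimately have "multiplier r F 3 (\<lambda>k. complex_of_real (((cmod (1 + u ^ k))\<^sup>2 / 4)))"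
    by (simp only:) simp
  from multiplier_power[OF this, of n] show ?thesis by simp
qed

lemma multiplier_one_minus_sin:
  assumes "cmod u = 1"
  shows "multiplier r F (1 + 4 ^ n) (\<lambda>k. complex_of_real (1 - ((cmod (1 - u ^ k))\<^sup>2 / 4) ^ n))"
proof -
  have "multiplier r F (1 + 3) (\<lambda>k. 1 + (-1) * complex_of_real (((cmod (1 + u ^ k))\<^sup>2 / 4) ^ 1))"
    using multiplier_cos[OF assms, of r F 1]
    by (intro multiplier_add multiplier_one multiplier_scale) auto
  moreover have "1 + (-1) * complex_of_real (((cmod (1 + u ^ k))\<^sup>2 / 4) ^ 1) =
      complex_of_real ((cmod (1 - u ^ k))\<^sup>2 / 4)" for k
  proof -
    have "(cmod (1 - u ^ k))\<^sup>2 / 4 = 1 - ((cmod (1 + u ^ k))\<^sup>2 / 4) ^ 1"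
      using cmod_one_plus_sq(2)[of "u ^ k"] assms by (simp add: norm_power field_simps)
    then show ?thesis by (simp only: of_real_diff of_real_1) simp
  qed
  ultimately have "multiplier r F 4 (\<lambda>k. complex_of_real ((cmod (1 - u ^ k))\<^sup>2 / 4))"
    by (simp only:) simp
  from multiplier_power[OF this, of n]
  have "multiplier r F (1 + 4 ^ n) (\<lambda>k. 1 + (-1) * complex_of_real ((cmod (1 - u ^ k))\<^sup>2 / 4) ^ n)"
    by (intro multiplier_add multiplier_one multiplier_scale) auto
  then show ?thesis by simp
qed

section \<open>Pinning the values of a character on a lacunary set\<close>

lemma cmod_cis_minus_one: "cmod (cis x - 1) = 2 * \<bar>sin (x / 2)\<bar>"
proof -
  have "(cmod (cis x - 1))\<^sup>2 = 2 - 2 * cos x"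
    using sin_cos_squared_add[of x] unfolding cmod_power2 by (simp add: power2_eq_square algebra_simps)
  also have "\<dots> = (2 * \<bar>sin (x / 2)\<bar>)\<^sup>2"
    using cos_double_sin[of "x/2"] by (simp add: power_mult_distrib)
  finally show ?thesis by (rule power2_eq_imp_eq) auto
qed

lemma cmod_cis_minus_one_le: "cmod (cis x - 1) \<le> \<bar>x\<bar>"
  using abs_sin_x_le_abs_x[of "x / 2"] by (simp add: cmod_cis_minus_one)

lemma unimodular_cis: "cmod z = 1 \<Longrightarrow> \<exists>t. z = cis t"
  by (metis cis_Arg norm_zero sgn_eq scaleR_one div_by_1 of_real_1 zero_neq_one)

lemma snap_to_root:
  assumes "cmod w = 1" "cmod a = 1" "0 < (\<mu>::nat)"
  obtains w' where "cmod w' = 1" "w' ^ \<mu> = a" "\<And>k. cmod (w' ^ k - w ^ k) \<le> 2 * pi * k / \<mu>"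
proof -
  obtain t where t: "w = cis t" using unimodular_cis assms(1) by blast
  obtain s where s: "a = cis s" using unimodular_cis assms(2) by blast
  define n where "n = \<lceil>(\<mu> * t - s) / (2 * pi)\<rceil>"
  define \<sigma> where "\<sigma> = (s + 2 * pi * n) / \<mu> - t"
  have n: "(\<mu> * t - s) / (2 * pi) \<le> n" "n \<le> (\<mu> * t - s) / (2 * pi) + 1"
    unfolding n_def by linarith+
  have "\<mu> * t - s \<le> 2 * pi * n" "2 * pi * n \<le> \<mu> * t - s + 2 * pi"
    using n pi_gt_zero by (simp_all add: field_simps)
  then have "\<mu> * t / \<mu> \<le> (s + 2 * pi * n) / \<mu>" "(s + 2 * pi * n) / \<mu> \<le> (\<mu> * t + 2 * pi) / \<mu>"
    by (intro divide_right_mono; simp)+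
  then have \<sigma>: "0 \<le> \<sigma>" "\<sigma> \<le> 2 * pi / \<mu>"
    using assms(3) by (simp_all add: \<sigma>_def add_divide_distrib)
  have 1: "cis (t + \<sigma>) ^ \<mu> = a"
  proof -
    have eq: "real \<mu> * (t + \<sigma>) = s + 2 * pi * n" using assms(3) by (simp add: \<sigma>_def)
    have "cis (t + \<sigma>) ^ \<mu> = cis (real \<mu> * (t + \<sigma>))" by (rule Complex.DeMoivre)
    also have "\<dots> = cis (s + 2 * pi * of_int n)" by (simp only: eq)
    also have "\<dots> = cis s * cis (2 * pi * of_int n)" by (simp only: cis_mult)
    also have "\<dots> = a" by (simp add: s cis_multiple_2pi)
    finally show ?thesis .
  qed
  have "cmod (cis (t + \<sigma>) ^ k - w ^ k) \<le> 2 * pi * k / \<mu>" for k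
  proof -
    have "cis (t + \<sigma>) ^ k - w ^ k = w ^ k * (cis (k * \<sigma>) - 1)"
      by (simp add: t Complex.DeMoivre algebra_simps cis_mult)
    then have "cmod (cis (t + \<sigma>) ^ k - w ^ k) = cmod (cis (k * \<sigma>) - 1)"
      using assms(1) by (simp add: norm_mult norm_power)
    also have "\<dots> \<le> k * \<sigma>" using cmod_cis_minus_one_le[of "k * \<sigma>"] \<sigma>(1) by simp
    also have "\<dots> \<le> k * (2 * pi / \<mu>)" by (intro mult_left_mono \<sigma>) auto
    finally show ?thesis by (simp add: field_simps)
  qed
  then show ?thesis using 1 that[of "cis (t + \<sigma>)"] by simp
qed

text \<open>
  The interior point \<open>\<rho> = exp (-\<kappa> / M)\<close> separates scales: powers up to the order of \<open>M\<close> are preserved,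
  those beyond \<open>M / \<kappa>\<^sup>2\<close> are annihilated.
\<close>

lemma exp_damping:
  assumes "0 < \<kappa>" "0 < (M::real)"
  shows "cmod (1 - complex_of_real (exp (- \<kappa> / M)) ^ k) \<le> \<kappa> * k / M"
    and "1 / \<kappa> \<le> \<kappa> * k / M \<Longrightarrow> cmod (complex_of_real (exp (- \<kappa> / M)) ^ k) \<le> \<kappa>"
proof -
  have e: "exp (- \<kappa> / M) ^ k = exp (- (\<kappa> * k / M))"
    by (simp flip: exp_of_nat_mult)
  have "cmod (1 - complex_of_real (exp (- \<kappa> / M)) ^ k) = \<bar>1 - exp (- (\<kappa> * k / M))\<bar>"
    by (metis e norm_of_real of_real_1 of_real_diff of_real_power)
  also have "\<dots> \<le> \<kappa> * k / M"
  proof -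
    have "exp (- (\<kappa> * k / M)) \<le> 1" using assms by simp
    moreover have "1 + - (\<kappa> * k / M) \<le> exp (- (\<kappa> * k / M))" by (rule exp_ge_add_one_self)
    ultimately show ?thesis by linarith
  qed
  finally show "cmod (1 - complex_of_real (exp (- \<kappa> / M)) ^ k) \<le> \<kappa> * k / M" .
  assume "1 / \<kappa> \<le> \<kappa> * k / M"
  then have "exp (- (\<kappa> * k / M)) \<le> exp (- (1 / \<kappa>))" by simp
  also have "\<dots> = 1 / exp (1 / \<kappa>)" by (simp add: exp_minus inverse_eq_divide)
  also have "\<dots> \<le> 1 / (1 / \<kappa>)"
  proof (intro divide_left_mono)
    show "1 / \<kappa> \<le> exp (1 / \<kappa>)" using exp_ge_add_one_self[of "1/\<kappa>"] by linarith
  qed (use assms in auto)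
  finally show "cmod (complex_of_real (exp (- \<kappa> / M)) ^ k) \<le> \<kappa>"
    using e by (simp add: norm_power)
qed

text \<open>
  Each frequency \<open>l\<close> in \<open>T\<close> is written as \<open>base l + D\<close>, where \<open>base l\<close> is the pin below it or \<open>0\<close> if it is
  far from all pins. The pins are processed in increasing order, \<open>P\<close> being those already processed and \<open>M\<close>
  the largest of them. The invariant says what the current vector \<open>V\<close> looks like. If \<open>D\<close> is above the
  scale of \<open>M\<close>, the entry is still \<open>0\<close>. Otherwise it is \<open>w\<^sup>D\<close> times the prescribed value \<open>a\<close> of
  the base, as long as the base is not yet pinned, and \<open>w\<^sup>l\<close> afterwards; the rotation that makes \<open>w\<^sup>\<mu>\<close>
  equal to \<open>a\<^sub>\<mu>\<close> turns the first form into the second. Thus \<open>V\<close> evolves from \<open>a\<close> on \<open>J\<close> and \<open>0\<close>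
  elsewhere into a genuine character, and \<open>\<Psi> V\<close> never decreases.

  A step from \<open>M\<close> to \<open>\<mu>\<close> adds an error of at most \<open>c k / M\<close> for an entry with exponent \<open>k\<close>. The bounds
  \<open>\<beta> - 2 c k / M\<close> leave room for it because \<open>\<mu> \<ge> 2 M\<close> turns \<open>2 c k / M\<close> into at most half of it.
  The exponent \<open>k\<close> jumps from \<open>D\<close> to \<open>l\<close> when the base is pinned; this happens once and is paid for by
  the difference \<open>\<beta>2 - \<beta>1\<close>. With no pin processed, \<open>1 / Q\<close> plays the role of \<open>M\<close>.
\<close>

lemma pinning:
  fixes J T F :: "nat set" and base :: "nat \<Rightarrow> nat" and a :: "nat \<Rightarrow> complex" and \<kappa> Q :: real
  assumes g: "psh_functional r F \<Psi>"
    and \<kappa>: "0 < \<kappa>" and Q: "2 \<le> Q" "1 \<le> \<kappa>\<^sup>2 * Q"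
    and J: "finite J" "0 \<notin> J"
    and ratio: "\<And>\<mu> \<nu>. \<mu> \<in> J \<Longrightarrow> \<nu> \<in> J \<Longrightarrow> \<nu> < \<mu> \<Longrightarrow> Q * real \<nu> \<le> real \<mu>"
    and a: "\<And>\<mu>. \<mu> \<in> J \<Longrightarrow> cmod (a \<mu>) = 1"
    and T: "T \<subseteq> F" "0 \<notin> T"
    and base: "\<And>l. l \<in> T \<Longrightarrow> base l \<in> insert 0 J" "\<And>l. l \<in> T \<Longrightarrow> base l \<le> l"
      "\<And>l. l \<in> T \<Longrightarrow> base l \<noteq> 0 \<Longrightarrow> real (l - base l) \<le> \<kappa>\<^sup>2 * base l"
      "\<And>l. l \<in> T \<Longrightarrow> base l \<noteq> 0 \<Longrightarrow> l \<le> 2 * base l"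
    and free: "\<And>l \<nu>. l \<in> T \<Longrightarrow> \<nu> \<in> J \<Longrightarrow> base l < l \<Longrightarrow>
        real (l - base l) \<le> \<kappa>\<^sup>2 * \<nu> \<or> real \<nu> \<le> \<kappa>\<^sup>2 * real (l - base l)"
  defines "c \<equiv> \<kappa> + 2 * pi / Q"
  defines "\<beta>1 \<equiv> \<kappa> + 2 * pi * \<kappa>\<^sup>2 + 2 * c * \<kappa>\<^sup>2"
  defines "\<beta>2 \<equiv> \<beta>1 + 4 * c"
  defines "act \<equiv> \<lambda>P l. base l = l \<or> (\<exists>\<nu>\<in>P. real (l - base l) \<le> \<kappa>\<^sup>2 * real \<nu>)"
  defines "cf \<equiv> \<lambda>l. if base l = 0 then 1 else a (base l)"
  assumes "P \<subseteq> J"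
  shows "\<exists>w V. cmod w = 1 \<and> \<Psi> (\<lambda>l. of_bool (l \<in> T \<and> base l = l) * a l) \<le> \<Psi> V \<and>
     (\<forall>l. l \<notin> T \<longrightarrow> V l = 0) \<and>
     (\<forall>l\<in>T. (\<not> act P l \<longrightarrow> V l = 0) \<and>
        (act P l \<and> base l \<notin> P \<longrightarrow> cmod (V l - cf l * w ^ (l - base l)) \<le>
            \<beta>1 - 2 * c * real (l - base l) / (if P = {} then 1 / Q else real (Max P))) \<and>
        (base l \<in> P \<longrightarrow> cmod (V l - w ^ l) \<le>
            \<beta>2 - 2 * c * real l / (if P = {} then 1 / Q else real (Max P))))"
proof -
  have fP: "finite P" using J(1) \<open>P \<subseteq> J\<close> finite_subset by blast
  have c: "0 < c" "\<kappa> \<le> c" "2 * pi / Q \<le> c" using \<kappa> Q pi_gt_zero by (auto simp: c_def add_pos_pos)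
  have \<beta>: "0 < \<beta>1" "\<beta>1 \<le> \<beta>2" using c \<kappa> pi_gt_zero by (auto simp: \<beta>1_def \<beta>2_def intro!: add_pos_nonneg)
  from fP \<open>P \<subseteq> J\<close> show ?thesis
  proof (induction P rule: finite_linorder_max_induct)
    case empty
    have eq: "l \<in> T \<Longrightarrow> 0 < l" for l using T(2) by (auto intro: gr0I)
    show ?case
      by (rule exI[of _ 1], rule exI[of _ "\<lambda>l. of_bool (l \<in> T \<and> base l = l) * a l"])
         (use eq \<beta> T(2) in \<open>auto simp: act_def cf_def\<close>)
  next
    case (insert \<mu> P)
    define M where "M = (if P = {} then 1 / Q else real (Max P))"
    from insert obtain w V where w: "cmod w = 1"
      and \<Psi>V: "\<Psi> (\<lambda>l. of_bool (l \<in> T \<and> base l = l) * a l) \<le> \<Psi> V"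
      and V0: "\<And>l. l \<notin> T \<Longrightarrow> V l = 0"
      and V1: "\<And>l. l \<in> T \<Longrightarrow> \<not> act P l \<Longrightarrow> V l = 0"
      and V2: "\<And>l. l \<in> T \<Longrightarrow> act P l \<Longrightarrow> base l \<notin> P \<Longrightarrow>
          cmod (V l - cf l * w ^ (l - base l)) \<le> \<beta>1 - 2 * c * real (l - base l) / M"
      and V3: "\<And>l. l \<in> T \<Longrightarrow> base l \<in> P \<Longrightarrow> cmod (V l - w ^ l) \<le> \<beta>2 - 2 * c * real l / M"
      unfolding M_def by auto
    have \<mu>: "\<mu> \<in> J" "0 < \<mu>" "\<mu> \<notin> P" using insert J by (auto intro: gr0I)
    have PJ: "P \<subseteq> J" "0 \<notin> P" using insert J by auto
    have M: "0 < M" "Q * M \<le> \<mu>"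
    proof -
      show "0 < M"
      proof (cases "P = {}")
        case False
        then have "Max P \<in> P" using insert by simp
        then show ?thesis using PJ False by (auto simp: M_def intro: gr0I)
      qed (use Q in \<open>auto simp: M_def\<close>)
      show "Q * M \<le> \<mu>"
      proof (cases "P = {}")
        case False
        then have "Max P \<in> P" using insert by simp
        then have "Max P \<in> J" "Max P < \<mu>" using PJ insert by auto
        then show ?thesis using ratio[of \<mu> "Max P"] False \<mu> by (simp add: M_def)
      qed (use Q \<mu> in \<open>auto simp: M_def\<close>)
    qed
    have Max\<mu>: "(if insert \<mu> P = {} then 1 / Q else real (Max (insert \<mu> P))) = \<mu>"
      using insert by (auto intro!: Max_eqI)
    \<comment> \<open>Coefficients and exponents of the analytic family in \<open>Z\<close>. A newly active entry enters with its full
       coefficient: at \<open>Z = \<rho>\<close> it is below \<open>\<kappa>\<close>, hence compatible with the present value \<open>0\<close>.\<close>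
    define b where "b = (\<lambda>l. if l \<notin> T then 0 else if base l \<in> P then w ^ l
      else if act (insert \<mu> P) l then cf l * w ^ (l - base l) else 0)"
    define e where "e = (\<lambda>l. if base l \<in> P then l else l - base l)"
    define \<rho> where "\<rho> = exp (- \<kappa> / M)"
    have \<rho>: "0 \<le> \<rho>" "\<rho> \<le> 1" using \<kappa> M by (auto simp: \<rho>_def)
    from psh_max[OF g \<rho>, of V b e] obtain Z where Z: "cmod Z = 1"
      and \<Psi>Z: "\<Psi> V \<le> \<Psi> (\<lambda>k. V k + b k * (Z ^ e k - complex_of_real \<rho> ^ e k))" by blast
    define V' where "V' = (\<lambda>k. V k + b k * (Z ^ e k - complex_of_real \<rho> ^ e k))"
    have "cmod (w * Z) = 1" using w Z by (simp add: norm_mult)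
    from snap_to_root[OF this a[OF \<mu>(1)] \<mu>(2)]
    obtain w' where w': "cmod w' = 1" "w' ^ \<mu> = a \<mu>"
      and snap: "\<And>k. cmod (w' ^ k - (w * Z) ^ k) \<le> 2 * pi * k / \<mu>" by blast
    have damp: "cmod (1 - complex_of_real \<rho> ^ k) \<le> \<kappa> * k / M" for k
      unfolding \<rho>_def by (rule exp_damping[OF \<kappa> M(1)])
    have pot: "- 2 * c * k / M + \<kappa> * k / M + 2 * pi * k / \<mu> \<le> - 2 * c * k / \<mu>" for k :: nat
    proof -
      have "2 * pi * k / \<mu> \<le> 2 * pi * k / (Q * M)"
        using M Q \<mu> by (intro divide_left_mono) auto
      also have "\<dots> = (2 * pi / Q) * k / M" by simp
      finally have "\<kappa> * k / M + 2 * pi * k / \<mu> \<le> c * k / M"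
        by (simp add: c_def algebra_simps add_divide_distrib)
      moreover have "2 * c * k / \<mu> \<le> 2 * c * k / (2 * M)"
      proof -
        have "2 * M \<le> Q * M" using Q M by (intro mult_right_mono) auto
        then have "2 * M \<le> \<mu>" using M by linarith
        then show ?thesis using M c \<mu> by (intro divide_left_mono) auto
      qed
      ultimately show ?thesis by simp
    qed
    have cf: "cmod (cf l) = 1" if "l \<in> T" for l
      using base(1)[OF that] a by (auto simp: cf_def)
    have tail: "2 * c * real l / \<mu> \<le> 4 * c" if "l \<le> 2 * \<mu>" for l
    proof -
      have "2 * c * real l / \<mu> \<le> 2 * c * (2 * \<mu>) / \<mu>"
        using that c \<mu> by (intro divide_right_mono mult_left_mono) auto
      then show ?thesis using \<mu> by simp
    qed
    have mono: "act (insert \<mu> P) l" if "act P l" for l using that by (auto simp: act_def)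
    have main: "(\<not> act (insert \<mu> P) l \<longrightarrow> V' l = 0) \<and>
        (act (insert \<mu> P) l \<and> base l \<notin> insert \<mu> P \<longrightarrow>
            cmod (V' l - cf l * w' ^ (l - base l)) \<le> \<beta>1 - 2 * c * real (l - base l) / \<mu>) \<and>
        (base l \<in> insert \<mu> P \<longrightarrow> cmod (V' l - w' ^ l) \<le> \<beta>2 - 2 * c * real l / \<mu>)"
      if l: "l \<in> T" for l
    proof (cases "base l \<in> P")
      case True
      with PJ(2) have "base l \<noteq> 0" by (metis (full_types))
      then have "act P l" using base(3)[OF l] True by (auto simp: act_def)
      then have "act (insert \<mu> P) l" by (rule mono)
      have "V' l - w' ^ l = (V l - w ^ l) + w ^ l * (1 - complex_of_real \<rho> ^ l) - (w' ^ l - (w * Z) ^ l)"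
        using l True by (simp add: V'_def b_def e_def algebra_simps)
      also have "cmod \<dots> \<le> cmod (V l - w ^ l) + cmod (w ^ l * (1 - complex_of_real \<rho> ^ l)) + cmod (w' ^ l - (w * Z) ^ l)"
        by (meson norm_triangle_ineq norm_triangle_ineq4 order_trans add_right_mono)
      also have "\<dots> \<le> (\<beta>2 - 2 * c * real l / M) + \<kappa> * l / M + 2 * pi * l / \<mu>"
        using damp[of l] w by (intro add_mono V3 l True snap) (simp add: norm_mult norm_power)
      also have "\<dots> \<le> \<beta>2 - 2 * c * real l / \<mu>" using pot[of l] by simp
      finally show ?thesis using True \<open>act (insert \<mu> P) l\<close> \<mu>(3) by auto
    next
      case nP: False
      define D where "D = l - base l"
      show ?thesis
      proof (cases "act (insert \<mu> P) l")
        case False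
        then have "\<not> act P l" using mono by blast
        moreover have "base l \<noteq> \<mu>"
          using False base(3)[OF l] \<mu> by (auto simp: act_def)
        ultimately show ?thesis using False V1[OF l] nP l by (simp add: V'_def b_def)
      next
        case actn: True
        have V': "V' l = V l + cf l * w ^ D * (Z ^ D - complex_of_real \<rho> ^ D)"
          using l nP actn by (simp add: V'_def b_def e_def D_def)
        have "cmod (V' l - cf l * w' ^ D) \<le> \<beta>1 - 2 * c * real D / \<mu>"
        proof (cases "act P l")
          case True
          have "V' l - cf l * w' ^ D = (V l - cf l * w ^ D) +
              cf l * w ^ D * (1 - complex_of_real \<rho> ^ D) - cf l * (w' ^ D - (w * Z) ^ D)"
            by (simp add: V' algebra_simps)
          also have "cmod \<dots> \<le> cmod (V l - cf l * w ^ D) + cmod (cf l * w ^ D * (1 - complex_of_real \<rho> ^ D))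
              + cmod (cf l * (w' ^ D - (w * Z) ^ D))"
            by (meson norm_triangle_ineq norm_triangle_ineq4 order_trans add_right_mono)
          also have "\<dots> \<le> (\<beta>1 - 2 * c * real D / M) + \<kappa> * D / M + 2 * pi * D / \<mu>"
            using damp[of D] snap[of D] w cf[OF l] V2[OF l True nP]
            by (intro add_mono) (simp_all add: norm_mult norm_power D_def)
          also have "\<dots> \<le> \<beta>1 - 2 * c * real D / \<mu>" using pot[of D] by simp
          finally show ?thesis .
        next
          case False
          then have bl: "base l < l" using base(2)[OF l] by (auto simp: act_def order_less_le)
          have D\<mu>: "real D \<le> \<kappa>\<^sup>2 * \<mu>" using actn False by (auto simp: act_def D_def)
          have "M \<le> \<kappa>\<^sup>2 * D"
          proof (cases "P = {}")
            case True
            have "1 / Q \<le> \<kappa>\<^sup>2" using Q by (simp add: field_simps)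
            also have "\<dots> \<le> \<kappa>\<^sup>2 * D" using bl \<kappa> by (simp add: D_def)
            finally show ?thesis using True by (simp add: M_def)
          next
            case ne: False
            then have "Max P \<in> P" using insert by simp
            then have "\<not> real D \<le> \<kappa>\<^sup>2 * real (Max P)" "Max P \<in> J"
              using False PJ by (auto simp: act_def D_def)
            then show ?thesis using free[OF l _ bl, of "Max P"] ne by (auto simp: M_def D_def)
          qed
          then have "1 / \<kappa> \<le> \<kappa> * D / M"
            using \<kappa> M by (simp add: field_simps power2_eq_square)
          then have kill: "cmod (complex_of_real \<rho> ^ D) \<le> \<kappa>"
            unfolding \<rho>_def by (rule exp_damping[OF \<kappa> M(1)])
          have "V' l - cf l * w' ^ D = - (cf l * w ^ D * complex_of_real \<rho> ^ D) - cf l * (w' ^ D - (w * Z) ^ D)"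
            using V1[OF l False] by (simp add: V' algebra_simps)
          also have "cmod \<dots> \<le> cmod (cf l * w ^ D * complex_of_real \<rho> ^ D) + cmod (cf l * (w' ^ D - (w * Z) ^ D))"
            by (metis norm_minus_cancel norm_triangle_ineq4)
          also have "\<dots> \<le> \<kappa> + 2 * pi * D / \<mu>"
            using kill snap[of D] w cf[OF l] by (intro add_mono) (simp_all add: norm_mult norm_power)
          also have "\<dots> \<le> \<beta>1 - 2 * c * real D / \<mu>"
          proof -
            have "(2 * pi + 2 * c) * (real D / \<mu>) \<le> (2 * pi + 2 * c) * \<kappa>\<^sup>2"
              using D\<mu> \<mu> c pi_gt_zero by (intro mult_left_mono) (auto simp: field_simps)
            then show ?thesis by (simp add: \<beta>1_def algebra_simps add_divide_distrib)
          qed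
          finally show ?thesis .
        qed
        then have est: "cmod (V' l - cf l * w' ^ D) \<le> \<beta>1 - 2 * c * real D / \<mu>" .
        show ?thesis
        proof (cases "base l = \<mu>")
          case True
          then have "cf l * w' ^ D = w' ^ l"
            using w'(2) base(2)[OF l] \<mu> power_add[of w' \<mu> "l - \<mu>"] by (simp add: cf_def D_def)
          moreover have "\<beta>1 - 2 * c * real D / \<mu> \<le> \<beta>2 - 2 * c * real l / \<mu>"
          proof -
            have "l \<le> 2 * \<mu>" using base(4)[OF l] True \<mu> by simp
            from tail[OF this] have "2 * c * real l / \<mu> \<le> 4 * c" .
            moreover have "0 \<le> 2 * c * real D / \<mu>" using c by simp
            ultimately show ?thesis by (simp add: \<beta>2_def)
          qed
          ultimately show ?thesis using est actn True by auto
        next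
          case False
          then show ?thesis using est actn nP by (simp add: D_def)
        qed
      qed
    qed
    show ?case
    proof (rule exI[of _ w'], rule exI[of _ V'], intro conjI)
      show "cmod w' = 1" by (rule w')
      show "\<Psi> (\<lambda>l. of_bool (l \<in> T \<and> base l = l) * a l) \<le> \<Psi> V'"
        using \<Psi>V \<Psi>Z by (simp add: V'_def)
      show "\<forall>l. l \<notin> T \<longrightarrow> V' l = 0" by (simp add: V'_def b_def V0)
    qed (use main in \<open>unfold Max\<mu>, blast\<close>)
  qed
qed

text \<open>
  The state reached when all pins are processed. By the covering hypothesis every frequency lies below the scale
  of some pin, so no entry is left inactive.
\<close>

lemma pinned_approximation:
  fixes J T F :: "nat set" and base :: "nat \<Rightarrow> nat" and a :: "nat \<Rightarrow> complex" and \<kappa> Q :: real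
  assumes g: "psh_functional r F \<Psi>"
    and \<kappa>: "0 < \<kappa>" "\<kappa> \<le> 1 / 2" and Q: "2 \<le> Q" "1 \<le> \<kappa>\<^sup>2 * Q" "2 * pi / Q \<le> \<kappa>"
    and J: "finite J" "0 \<notin> J"
    and ratio: "\<And>\<mu> \<nu>. \<mu> \<in> J \<Longrightarrow> \<nu> \<in> J \<Longrightarrow> \<nu> < \<mu> \<Longrightarrow> Q * real \<nu> \<le> real \<mu>"
    and a: "\<And>\<mu>. \<mu> \<in> J \<Longrightarrow> cmod (a \<mu>) = 1"
    and T: "T \<subseteq> F" "0 \<notin> T"
    and base: "\<And>l. l \<in> T \<Longrightarrow> base l \<in> insert 0 J" "\<And>l. l \<in> T \<Longrightarrow> base l \<le> l"
      "\<And>l. l \<in> T \<Longrightarrow> base l \<noteq> 0 \<Longrightarrow> real (l - base l) \<le> \<kappa>\<^sup>2 * base l"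
      "\<And>l. l \<in> T \<Longrightarrow> base l \<noteq> 0 \<Longrightarrow> l \<le> 2 * base l"
    and free: "\<And>l \<nu>. l \<in> T \<Longrightarrow> \<nu> \<in> J \<Longrightarrow> base l < l \<Longrightarrow>
        real (l - base l) \<le> \<kappa>\<^sup>2 * \<nu> \<or> real \<nu> \<le> \<kappa>\<^sup>2 * real (l - base l)"
    and cover: "\<And>l. l \<in> T \<Longrightarrow> \<exists>\<nu>\<in>J. real l \<le> \<kappa>\<^sup>2 * real \<nu>"
  obtains w V where "cmod w = 1" "\<Psi> (\<lambda>l. of_bool (l \<in> T \<and> base l = l) * a l) \<le> \<Psi> V"
    "\<And>l. l \<notin> T \<Longrightarrow> V l = 0" "\<And>l. l \<in> T \<Longrightarrow> cmod (V l - w ^ l) \<le> 20 * \<kappa>"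
proof -
  define c where "c = \<kappa> + 2 * pi / Q"
  define \<beta>1 where "\<beta>1 = \<kappa> + 2 * pi * \<kappa>\<^sup>2 + 2 * c * \<kappa>\<^sup>2"
  define \<beta>2 where "\<beta>2 = \<beta>1 + 4 * c"
  have \<kappa>sq: "\<kappa>\<^sup>2 \<le> \<kappa> / 2" using \<kappa> by (simp add: power2_eq_square)
  have c: "0 < c" "c \<le> 2 * \<kappa>"
    using \<kappa> Q pi_gt_zero by (auto simp: c_def intro: add_pos_pos)
  have \<beta>: "\<beta>1 \<le> \<beta>2" "\<beta>2 \<le> 20 * \<kappa>"
  proof -
    show "\<beta>1 \<le> \<beta>2" using c by (simp add: \<beta>2_def)
    have "2 * pi * \<kappa>\<^sup>2 \<le> 8 * (\<kappa> / 2)" using pi_less_4 \<kappa>sq by (intro mult_mono) auto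
    moreover have "2 * c * \<kappa>\<^sup>2 \<le> 2 * (2 * \<kappa>) * (1 / 4)"
      using c \<kappa> \<kappa>sq by (intro mult_mono) auto
    ultimately show "\<beta>2 \<le> 20 * \<kappa>" using c \<kappa> by (simp add: \<beta>2_def \<beta>1_def)
  qed
  define M where "M = (if J = {} then 1 / Q else real (Max J))"
  have M: "0 \<le> M" using Q by (simp add: M_def)
  have pin: "\<exists>w V. cmod w = 1 \<and> \<Psi> (\<lambda>l. of_bool (l \<in> T \<and> base l = l) * a l) \<le> \<Psi> V \<and>
     (\<forall>l. l \<notin> T \<longrightarrow> V l = 0) \<and>
     (\<forall>l\<in>T. (\<not> (base l = l \<or> (\<exists>\<nu>\<in>J. real (l - base l) \<le> \<kappa>\<^sup>2 * real \<nu>)) \<longrightarrow> V l = 0) \<and>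
        ((base l = l \<or> (\<exists>\<nu>\<in>J. real (l - base l) \<le> \<kappa>\<^sup>2 * real \<nu>)) \<and> base l \<notin> J \<longrightarrow>
           cmod (V l - (if base l = 0 then 1 else a (base l)) * w ^ (l - base l)) \<le>
            \<beta>1 - 2 * c * real (l - base l) / M) \<and>
        (base l \<in> J \<longrightarrow> cmod (V l - w ^ l) \<le> \<beta>2 - 2 * c * real l / M))"
    unfolding \<beta>2_def \<beta>1_def c_def M_def
    by (rule pinning[OF g \<kappa>(1) Q(1,2) J]) (fact ratio a T base free subset_refl)+
  from pin show ?thesis
  proof (elim exE conjE)
    fix w V
    assume w: "cmod w = 1" and \<Psi>V: "\<Psi> (\<lambda>l. of_bool (l \<in> T \<and> base l = l) * a l) \<le> \<Psi> V"
      and V0: "\<forall>l. l \<notin> T \<longrightarrow> V l = 0"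
      and V: "\<forall>l\<in>T. (\<not> (base l = l \<or> (\<exists>\<nu>\<in>J. real (l - base l) \<le> \<kappa>\<^sup>2 * real \<nu>)) \<longrightarrow> V l = 0) \<and>
        ((base l = l \<or> (\<exists>\<nu>\<in>J. real (l - base l) \<le> \<kappa>\<^sup>2 * real \<nu>)) \<and> base l \<notin> J \<longrightarrow>
           cmod (V l - (if base l = 0 then 1 else a (base l)) * w ^ (l - base l)) \<le>
            \<beta>1 - 2 * c * real (l - base l) / M) \<and>
        (base l \<in> J \<longrightarrow> cmod (V l - w ^ l) \<le> \<beta>2 - 2 * c * real l / M)"
    have pos: "0 \<le> 2 * c * real k / M" for k using c M by auto
    have est: "cmod (V l - w ^ l) \<le> 20 * \<kappa>" if l: "l \<in> T" for l
    proof (cases "base l = 0")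
      case True
      have "\<exists>\<nu>\<in>J. real (l - base l) \<le> \<kappa>\<^sup>2 * real \<nu>" using cover[OF l] True by simp
      moreover have "base l \<notin> J" using True J by simp
      ultimately have "cmod (V l - (if base l = 0 then 1 else a (base l)) * w ^ (l - base l)) \<le>
            \<beta>1 - 2 * c * real (l - base l) / M" using V l by blast
      then show ?thesis using True pos[of l] \<beta> by simp
    next
      case False
      then have "base l \<in> J" using base(1)[OF l] by auto
      then have "cmod (V l - w ^ l) \<le> \<beta>2 - 2 * c * real l / M" using V l by blast
      then show ?thesis using pos[of l] \<beta> by linarith
    qed
    show ?thesis by (rule that[OF w \<Psi>V _ est]) (use V0 in blast)+
  qed
qed

section \<open>Multipliers that remove frequencies comparable to a lacunary set\<close>

text \<open>
  Adjusting the phase \<open>P\<close> for a new, larger \<open>\<nu>\<close> moves it by at most \<open>R / \<nu>\<close>, and these moves add up to a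
  small fraction of \<open>R / \<mu>\<close> for every earlier \<open>\<mu>\<close>. So conditions that can be met at each \<open>\<mu>\<close> separately can
  be met approximately at all of them by one \<open>P\<close>.
\<close>

lemma lacunary_phases:
  fixes J :: "nat set" and Q R :: real and Good :: "nat \<Rightarrow> real \<Rightarrow> bool"
  assumes J: "finite J" "0 \<notin> J" and Q: "2 \<le> Q" and R: "0 \<le> R"
    and ratio: "\<And>\<mu> \<nu>. \<mu> \<in> J \<Longrightarrow> \<nu> \<in> J \<Longrightarrow> \<nu> < \<mu> \<Longrightarrow> Q * real \<nu> \<le> real \<mu>"
    and step: "\<And>\<mu> P. \<mu> \<in> J \<Longrightarrow> \<exists>P'. \<bar>P' - P\<bar> \<le> R / \<mu> \<and> Good \<mu> P'"
  shows "\<exists>P::real. \<forall>\<mu>\<in>J. \<exists>P'. real \<mu> * \<bar>P - P'\<bar> \<le> 2 * R / Q \<and> Good \<mu> P'"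
proof -
  have "\<exists>P. \<forall>\<mu>\<in>A. \<exists>P'. \<bar>P - P'\<bar> \<le> 2 * R / Q * (1 / \<mu> - 1 / Max A) \<and> Good \<mu> P'" if "A \<subseteq> J" for A
  proof -
    have "finite A" using J(1) that finite_subset by metis
    from this that show ?thesis
    proof (induction A rule: finite_linorder_max_induct)
      case (insert \<nu> A)
      from insert.IH insert.prems obtain P where P: "\<And>\<mu>. \<mu> \<in> A \<Longrightarrow> \<exists>P'. \<bar>P - P'\<bar> \<le> 2 * R / Q * (1 / \<mu> - 1 / Max A) \<and> Good \<mu> P'"
        by blast
      obtain P1 where P1: "\<bar>P1 - P\<bar> \<le> R / \<nu>" "Good \<nu> P1" using step[of \<nu> P] insert.prems by blast
      have Max\<nu>: "Max (insert \<nu> A) = \<nu>" using insert.hyps by (intro Max_eqI) auto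
      have \<nu>: "0 < \<nu>" using insert.prems J by (auto intro: gr0I)
      show ?case
      proof (rule exI[of _ P1], rule ballI)
        fix \<mu> assume \<mu>: "\<mu> \<in> insert \<nu> A"
        show "\<exists>P'. \<bar>P1 - P'\<bar> \<le> 2 * R / Q * (1 / \<mu> - 1 / Max (insert \<nu> A)) \<and> Good \<mu> P'"
        proof (cases "\<mu> = \<nu>")
          case True
          then show ?thesis unfolding Max\<nu> using P1 by (intro exI[of _ P1]) simp
        next
          case False
          then have \<mu>A: "\<mu> \<in> A" using \<mu> by auto
          then obtain P' where P': "\<bar>P - P'\<bar> \<le> 2 * R / Q * (1 / \<mu> - 1 / Max A)" "Good \<mu> P'" using P by blast
          have "Max A \<in> A" using \<mu>A insert.hyps by (intro Max_in) auto
          then have "Max A \<in> J" "Max A < \<nu>" using insert.prems insert.hyps by blast+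
          then have M: "Q * Max A \<le> \<nu>" "0 < Max A"
            using insert.prems ratio[of \<nu> "Max A"] J by (auto intro!: gr0I simp del: Max_less_iff)
          have "R / \<nu> + 2 * R / Q * (1 / \<nu>) \<le> 2 * R / Q * (1 / Max A)"
          proof -
            have "2 * R / Q * (1 / \<nu>) \<le> 2 * R / 2 * (1 / \<nu>)"
              using Q R \<nu> by (intro mult_right_mono divide_left_mono) auto
            then have "R / \<nu> + 2 * R / Q * (1 / \<nu>) \<le> 2 * R / \<nu>" by simp
            also have "\<dots> \<le> 2 * R / (Q * Max A)"
              using M Q R \<nu> by (intro divide_left_mono) auto
            finally show ?thesis by simp
          qed
          then have "R / \<nu> + 2 * R / Q * (1 / \<mu> - 1 / Max A) \<le> 2 * R / Q * (1 / \<mu> - 1 / \<nu>)"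
            by (simp add: algebra_simps)
          then have "\<bar>P1 - P'\<bar> \<le> 2 * R / Q * (1 / \<mu> - 1 / \<nu>)"
            using P1(1) P'(1) by linarith
          then show ?thesis unfolding Max\<nu> using P'(2) by blast
        qed
      qed
    qed auto
  qed
  from this[OF subset_refl] obtain P where
    P: "\<And>\<mu>. \<mu> \<in> J \<Longrightarrow> \<exists>P'. \<bar>P - P'\<bar> \<le> 2 * R / Q * (1 / \<mu> - 1 / Max J) \<and> Good \<mu> P'"
    by blast
  show ?thesis
  proof (rule exI[of _ P], rule ballI)
    fix \<mu> assume \<mu>: "\<mu> \<in> J"
    then obtain P' where P': "\<bar>P - P'\<bar> \<le> 2 * R / Q * (1 / \<mu> - 1 / Max J)" "Good \<mu> P'" using P by blast
    have "2 * R / Q * (1 / \<mu> - 1 / Max J) \<le> 2 * R / Q * (1 / \<mu>)"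
      using Q R by (intro mult_left_mono) auto
    with P'(1) have "\<bar>P - P'\<bar> \<le> 2 * R / Q / \<mu>" by simp
    then have "\<mu> * \<bar>P - P'\<bar> \<le> \<mu> * (2 * R / Q / \<mu>)" by (rule mult_left_mono) simp
    also have "\<dots> \<le> 2 * R / Q" using \<mu> J R Q by auto
    finally show "\<exists>P'. real \<mu> * \<bar>P - P'\<bar> \<le> 2 * R / Q \<and> Good \<mu> P'" using P'(2) by blast
  qed
qed

lemma cmod_cis_diff_le: "cmod (cis x - cis y) \<le> \<bar>x - y\<bar>"
proof -
  have "cis x - cis y = cis y * (cis (x - y) - 1)" by (simp add: algebra_simps cis_mult)
  then show ?thesis using cmod_cis_minus_one_le[of "x - y"] by (simp add: norm_mult)
qed

lemma half_le_sin:
  assumes "0 \<le> x" "x \<le> pi / 3" shows "x / 2 \<le> sin x"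
proof -
  have "sin 0 - 0 / 2 \<le> sin x - x / 2"
  proof (rule DERIV_nonneg_imp_nondecreasing[OF assms(1)])
    fix y assume y: "0 \<le> y" "y \<le> x"
    have "cos (pi / 3) \<le> cos y" using y assms by (intro cos_monotone_0_pi_le) auto
    then show "\<exists>d. ((\<lambda>x. sin x - x / 2) has_real_derivative d) (at y) \<and> 0 \<le> d"
      by (intro exI[of _ "cos y - 1/2"]) (auto intro!: derivative_eq_intros simp: cos_60)
  qed
  then show ?thesis by simp
qed

lemma cis_separated:
  assumes "0 < \<eta>" "\<eta> \<le> 1 / 3" "\<eta> \<le> t" "t \<le> 1 - \<eta>"
  shows "3 * \<eta> \<le> cmod (cis (2 * pi * t) - 1)"
proof -
  have "sin (pi * \<eta>) \<le> sin (pi * t)"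
  proof (cases "t \<le> 1 / 2")
    case True
    then have "pi * \<eta> \<le> pi * t" "pi * t \<le> pi / 2" "- (pi / 2) \<le> pi * \<eta>"
      using assms pi_gt_zero by (auto simp: field_simps intro: order_trans[of _ 0])
    then show ?thesis by (intro sin_monotone_2pi_le)
  next
    case False
    have "sin (pi * t) = sin (pi * (1 - t))"
      by (simp add: right_diff_distrib sin_diff)
    moreover have "pi * \<eta> \<le> pi * (1 - t)" "pi * (1 - t) \<le> pi * (1 / 2)"
      using assms False by (intro mult_left_mono; simp)+
    moreover have "- (pi / 2) \<le> pi * \<eta>" using assms by (auto intro: order_trans[of _ 0])
    ultimately show ?thesis using sin_monotone_2pi_le[of "pi * \<eta>" "pi * (1 - t)"] by simp
  qed
  moreover have "pi * \<eta> / 2 \<le> sin (pi * \<eta>)" using assms pi_gt_zero by (intro half_le_sin) auto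
  moreover have "3 * \<eta> \<le> pi * \<eta>" using assms pi_gt3 by (intro mult_right_mono) auto
  ultimately have "3 * \<eta> \<le> 2 * sin (pi * t)" by linarith
  then show ?thesis using cmod_cis_minus_one[of "2 * pi * t"] by simp
qed

lemma round_phase_up:
  assumes "0 < (\<mu>::nat)"
  obtains P0 :: real and n :: int where "\<mu> * P0 = 2 * pi * n" "P \<le> P0" "P0 \<le> P + 2 * pi / \<mu>"
proof -
  define n where "n = \<lceil>\<mu> * P / (2 * pi)\<rceil>"
  have n: "\<mu> * P / (2 * pi) \<le> n" "n \<le> \<mu> * P / (2 * pi) + 1" unfolding n_def by linarith+
  have "\<mu> * P \<le> 2 * pi * n" "2 * pi * n \<le> \<mu> * P + 2 * pi"
    using n pi_gt_zero by (simp_all add: field_simps)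
  then have "\<mu> * P / \<mu> \<le> 2 * pi * n / \<mu>" "2 * pi * n / \<mu> \<le> (\<mu> * P + 2 * pi) / \<mu>"
    by (intro divide_right_mono; simp)+
  then show ?thesis using assms by (intro that[of "2 * pi * n / \<mu>" n]) (simp_all add: add_divide_distrib)
qed

lemma abs_scaled_diff: "\<bar>real n * x - real n * y\<bar> = real n * \<bar>x - y\<bar>"
  by (metis abs_mult abs_of_nat right_diff_distrib)

text \<open>
  With \<open>w\<^sup>\<mu>\<close> pinned at \<open>1\<close>, there is still the choice between two neighbouring phases. They differ by
  \<open>2 \<pi> l / \<mu>\<close> in the phase of \<open>w\<^sup>l\<close>, which is bounded away from the multiples of \<open>2 \<pi>\<close> for \<open>l < \<mu>\<close>, so one
  of the two choices moves \<open>w\<^sup>l\<close> away from \<open>1\<close>. The value \<open>sel \<mu> = 0\<close> means that nothing is selected at \<open>\<mu>\<close>.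
\<close>

lemma below_comparable_phase:
  fixes J :: "nat set" and Q \<eta> :: real and sel :: "nat \<Rightarrow> nat"
  assumes J: "finite J" "0 \<notin> J" and Q: "2 \<le> Q" and \<eta>: "0 < \<eta>" "\<eta> \<le> 1 / 3" "8 * pi / Q \<le> \<eta> / 4"
    and ratio: "\<And>\<mu> \<nu>. \<mu> \<in> J \<Longrightarrow> \<nu> \<in> J \<Longrightarrow> \<nu> < \<mu> \<Longrightarrow> Q * real \<nu> \<le> real \<mu>"
    and sel: "\<And>\<mu>. \<mu> \<in> J \<Longrightarrow> sel \<mu> \<noteq> 0 \<Longrightarrow> \<eta> * \<mu> \<le> sel \<mu> \<and> sel \<mu> \<le> (1 - \<eta>) * \<mu>"
  shows "\<exists>w. cmod w = 1 \<and> (\<forall>\<mu>\<in>J. cmod (1 - w ^ \<mu>) \<le> 8 * pi / Q \<and>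
            (sel \<mu> \<noteq> 0 \<longrightarrow> \<eta> \<le> cmod (1 - w ^ sel \<mu>)))"
proof -
  define Good where "Good = (\<lambda>(\<mu>::nat) (P::real). (\<exists>n::int. real \<mu> * P = 2 * pi * n) \<and>
      (sel \<mu> \<noteq> 0 \<longrightarrow> 3 / 2 * \<eta> \<le> cmod (cis (sel \<mu> * P) - 1)))"
  have ex: "\<exists>P::real. \<forall>\<mu>\<in>J. \<exists>P'. real \<mu> * \<bar>P - P'\<bar> \<le> 2 * (4 * pi) / Q \<and> Good \<mu> P'"
  proof (rule lacunary_phases[where R = "4 * pi" and Good = Good and J = J and Q = Q, OF J Q])
    fix \<mu> and P :: real assume \<mu>J: "\<mu> \<in> J"
    then have \<mu>: "0 < \<mu>" using J by (auto intro: gr0I)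
    obtain P0 :: real and n :: int
      where P0: "real \<mu> * P0 = 2 * pi * n" "P \<le> P0" "P0 \<le> P + 2 * pi / \<mu>"
      by (rule round_phase_up[OF \<mu>, of P])
    define P1 where "P1 = P0 + 2 * pi / \<mu>"
    have P1: "\<mu> * P1 = 2 * pi * (n + 1)" "P \<le> P1" "P1 \<le> P + 4 * pi / \<mu>"
    proof -
      have "\<mu> * P1 = \<mu> * P0 + 2 * pi" using \<mu> by (simp add: P1_def distrib_left)
      then show "\<mu> * P1 = 2 * pi * (n + 1)" using P0(1) by (simp add: distrib_left)
      have "0 \<le> 2 * pi / \<mu>" by simp
      then show "P \<le> P1" using P0(2) unfolding P1_def by linarith
      have "4 * pi / \<mu> = 2 * pi / \<mu> + 2 * pi / \<mu>" by simp
      then show "P1 \<le> P + 4 * pi / \<mu>" using P0(3) unfolding P1_def by linarith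
    qed
    have close: "\<bar>P0 - P\<bar> \<le> 4 * pi / \<mu>" "\<bar>P1 - P\<bar> \<le> 4 * pi / \<mu>"
    proof -
      have "2 * pi / \<mu> \<le> 4 * pi / \<mu>" by (intro divide_right_mono) auto
      then show "\<bar>P0 - P\<bar> \<le> 4 * pi / \<mu>" using P0 by linarith
      show "\<bar>P1 - P\<bar> \<le> 4 * pi / \<mu>" using P1 by linarith
    qed
    have "Good \<mu> P0 \<or> Good \<mu> P1"
    proof (cases "sel \<mu> = 0")
      case True
      then show ?thesis using P0 by (auto simp: Good_def)
    next
      case False
      define t where "t = sel \<mu> / \<mu>"
      have t: "\<eta> \<le> t" "t \<le> 1 - \<eta>" using sel[OF \<mu>J False] \<mu> by (auto simp: t_def field_simps)
      have "real (sel \<mu>) * P1 = sel \<mu> * P0 + 2 * pi * t"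
        using \<mu> by (simp add: P1_def t_def field_simps)
      then have "cis (sel \<mu> * P1) = cis (sel \<mu> * P0) * cis (2 * pi * t)"
        by (simp only: cis_mult)
      then have "cis (2 * pi * t) - 1 = cnj (cis (sel \<mu> * P0)) * ((cis (sel \<mu> * P1) - 1) - (cis (sel \<mu> * P0) - 1))"
        by (simp add: right_diff_distrib cis_cnj cis_mult)
      then have "cmod (cis (2 * pi * t) - 1) = cmod ((cis (sel \<mu> * P1) - 1) - (cis (sel \<mu> * P0) - 1))"
        by (simp only: norm_mult complex_mod_cnj norm_cis mult_1)
      also have "\<dots> \<le> cmod (cis (sel \<mu> * P1) - 1) + cmod (cis (sel \<mu> * P0) - 1)"
        by (rule norm_triangle_ineq4)
      finally have "3 * \<eta> \<le> cmod (cis (sel \<mu> * P1) - 1) + cmod (cis (sel \<mu> * P0) - 1)"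
        using cis_separated[OF \<eta>(1,2) t] by linarith
      then have "3 / 2 * \<eta> \<le> cmod (cis (sel \<mu> * P1) - 1) \<or> 3 / 2 * \<eta> \<le> cmod (cis (sel \<mu> * P0) - 1)"
        by linarith
      then show ?thesis using P0(1) P1(1) unfolding Good_def by blast
    qed
    then show "\<exists>P'. \<bar>P' - P\<bar> \<le> 4 * pi / \<mu> \<and> Good \<mu> P'" using close by blast
  next
    show "0 \<le> 4 * pi" by simp
  next
    fix \<mu> \<nu> assume "\<mu> \<in> J" "\<nu> \<in> J" "\<nu> < \<mu>"
    then show "Q * real \<nu> \<le> real \<mu>" by (rule ratio)
  qed
  have "2 * (4 * pi) / Q = 8 * pi / Q" by simp
  from ex[unfolded this] obtain P where
    P: "\<forall>\<mu>\<in>J. \<exists>P'. real \<mu> * \<bar>P - P'\<bar> \<le> 8 * pi / Q \<and> Good \<mu> P'"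
    by (rule exE)
  show ?thesis
  proof (rule exI[of _ "cis P"], intro conjI ballI impI)
    fix \<mu> assume \<mu>J: "\<mu> \<in> J"
    then have \<mu>: "0 < \<mu>" using J by (auto intro: gr0I)
    obtain P' where P': "\<mu> * \<bar>P - P'\<bar> \<le> 8 * pi / Q" "Good \<mu> P'" using bspec[OF P \<mu>J] by blast
    then obtain n :: int where n: "real \<mu> * P' = 2 * pi * n" by (auto simp: Good_def)
    have "cis (\<mu> * P') = cis (2 * pi * n)" by (rule arg_cong[OF n])
    then have "cis (\<mu> * P') = 1" by simp
    then have "cmod (1 - cis P ^ \<mu>) = cmod (cis (\<mu> * P) - cis (\<mu> * P'))"
      by (simp add: Complex.DeMoivre norm_minus_commute)
    also have "\<dots> \<le> \<bar>\<mu> * P - \<mu> * P'\<bar>" by (rule cmod_cis_diff_le)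
    also have "\<dots> = \<mu> * \<bar>P - P'\<bar>" by (simp add: abs_scaled_diff)
    finally show "cmod (1 - cis P ^ \<mu>) \<le> 8 * pi / Q" using P'(1) by linarith
    assume s: "sel \<mu> \<noteq> 0"
    have "cmod (cis (sel \<mu> * P') - cis (sel \<mu> * P)) \<le> \<bar>sel \<mu> * P' - sel \<mu> * P\<bar>"
      by (rule cmod_cis_diff_le)
    also have "\<dots> = sel \<mu> * \<bar>P - P'\<bar>" by (simp add: abs_scaled_diff abs_minus_commute[of P P'])
    also have "\<dots> \<le> \<mu> * \<bar>P - P'\<bar>"
    proof (rule mult_right_mono)
      have "(1 - \<eta>) * real \<mu> \<le> 1 * real \<mu>" using \<eta> by (intro mult_right_mono) auto
      then show "real (sel \<mu>) \<le> \<mu>" using sel[OF \<mu>J s] by linarith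
    qed auto
    finally have "cmod (cis (sel \<mu> * P') - cis (sel \<mu> * P)) \<le> \<eta> / 4" using P'(1) \<eta>(3) by linarith
    moreover have "3 / 2 * \<eta> \<le> cmod (cis (sel \<mu> * P') - 1)" using P'(2) s by (auto simp: Good_def)
    moreover have "cmod (cis (sel \<mu> * P') - 1) \<le> cmod (cis (sel \<mu> * P') - cis (sel \<mu> * P)) + cmod (cis (sel \<mu> * P) - 1)"
      by (metis norm_triangle_sub diff_add_cancel norm_triangle_ineq add_diff_eq)
    ultimately have "\<eta> \<le> cmod (cis (sel \<mu> * P) - 1)" using \<eta> by linarith
    then show "\<eta> \<le> cmod (1 - cis P ^ sel \<mu>)" by (simp add: Complex.DeMoivre norm_minus_commute)
  qed simp
qed

text \<open>
  For \<open>l > \<mu>\<close> the previous choice is useless, as \<open>l\<close> may be a multiple of \<open>\<mu>\<close>. Instead \<open>w\<^sup>l\<close> is pinned at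
  \<open>-1\<close>. The phases achieving this are spaced by \<open>2 \<pi> / l\<close>, so one of them is within \<open>\<pi> / l\<close> of a phase with
  \<open>w\<^sup>\<mu> = 1\<close>. It leaves the phase of \<open>w\<^sup>\<mu>\<close> within \<open>\<pi> \<mu> / l < \<pi>\<close> of zero, hence \<open>w\<^sup>\<mu>\<close> away from \<open>-1\<close>.
\<close>

lemma above_comparable_phase:
  fixes J :: "nat set" and Q \<eta> :: real and sel :: "nat \<Rightarrow> nat"
  assumes J: "finite J" "0 \<notin> J" and Q: "2 \<le> Q" and \<eta>: "0 < \<eta>" "\<eta> \<le> 1 / 3" "8 * pi / Q \<le> \<eta> / 4"
    and ratio: "\<And>\<mu> \<nu>. \<mu> \<in> J \<Longrightarrow> \<nu> \<in> J \<Longrightarrow> \<nu> < \<mu> \<Longrightarrow> Q * real \<nu> \<le> real \<mu>"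
    and sel: "\<And>\<mu>. \<mu> \<in> J \<Longrightarrow> sel \<mu> \<noteq> 0 \<Longrightarrow> (1 + \<eta>) * \<mu> \<le> sel \<mu> \<and> \<eta> * sel \<mu> \<le> \<mu>"
  shows "\<exists>w. cmod w = 1 \<and> (\<forall>\<mu>\<in>J. \<eta> / 2 \<le> cmod (1 + w ^ \<mu>) \<and>
            (sel \<mu> \<noteq> 0 \<longrightarrow> cmod (1 + w ^ sel \<mu>) \<le> 8 * pi / (Q * \<eta>)))"
proof -
  define Good where "Good = (\<lambda>(\<mu>::nat) (P::real). (\<exists>n::int. \<bar>real \<mu> * P - 2 * pi * n\<bar> \<le> pi / (1 + \<eta>)) \<and>
      (sel \<mu> \<noteq> 0 \<longrightarrow> cis (sel \<mu> * P) = -1))"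
  have ex: "\<exists>P::real. \<forall>\<mu>\<in>J. \<exists>P'. real \<mu> * \<bar>P - P'\<bar> \<le> 2 * (4 * pi) / Q \<and> Good \<mu> P'"
  proof (rule lacunary_phases[where R = "4 * pi" and Good = Good and J = J and Q = Q, OF J Q])
    fix \<mu> and P :: real assume \<mu>J: "\<mu> \<in> J"
    then have \<mu>: "0 < \<mu>" using J by (auto intro: gr0I)
    obtain P0 :: real and n :: int
      where P0: "real \<mu> * P0 = 2 * pi * n" "P \<le> P0" "P0 \<le> P + 2 * pi / \<mu>"
      by (rule round_phase_up[OF \<mu>, of P])
    show "\<exists>P'. \<bar>P' - P\<bar> \<le> 4 * pi / \<mu> \<and> Good \<mu> P'"
    proof (cases "sel \<mu> = 0")
      case True
      have "2 * pi / \<mu> \<le> 4 * pi / \<mu>" by (intro divide_right_mono) auto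
      then have "\<bar>P0 - P\<bar> \<le> 4 * pi / \<mu>" using P0 by linarith
      moreover have "Good \<mu> P0" using P0(1) True \<eta> by (auto simp: Good_def intro!: exI[of _ n])
      ultimately show ?thesis by blast
    next
      case False
      define l where "l = sel \<mu>"
      have l: "(1 + \<eta>) * \<mu> \<le> l" using sel[OF \<mu>J False] by (simp add: l_def)
      moreover have "1 * real \<mu> \<le> (1 + \<eta>) * \<mu>" using \<eta> by (intro mult_right_mono) auto
      ultimately have l\<mu>: "\<mu> \<le> l" by linarith
      then have l0: "0 < l" using \<mu> by linarith
      define k where "k = round ((l * P0 - pi) / (2 * pi))"
      define P' where "P' = (2 * pi * k + pi) / l"
      have "\<bar>k - (l * P0 - pi) / (2 * pi)\<bar> \<le> 1 / 2"
        unfolding k_def by (rule of_int_round_abs_le)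
      then have "(2 * pi) * \<bar>k - (l * P0 - pi) / (2 * pi)\<bar> \<le> (2 * pi) * (1 / 2)"
        by (intro mult_left_mono) auto
      then have "\<bar>(2 * pi) * (k - (l * P0 - pi) / (2 * pi))\<bar> \<le> pi"
        by (simp add: abs_mult)
      moreover have "(2 * pi) * (k - (l * P0 - pi) / (2 * pi)) = l * P' - l * P0"
        using l0 by (simp add: P'_def field_simps)
      ultimately have "\<bar>l * P' - l * P0\<bar> \<le> pi" by (simp only:)
      then have "l * \<bar>P' - P0\<bar> \<le> pi" by (simp add: abs_scaled_diff)
      then have d: "\<bar>P' - P0\<bar> \<le> pi / l" using l0 by (simp add: field_simps)
      also have "\<dots> \<le> pi / \<mu>" using l\<mu> \<mu> by (intro divide_left_mono) auto
      finally have "\<bar>P' - P\<bar> \<le> pi / \<mu> + 2 * pi / \<mu>" using P0 by linarith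
      also have "\<dots> \<le> 4 * pi / \<mu>" by (simp flip: add_divide_distrib) (intro divide_right_mono, auto)
      finally have 1: "\<bar>P' - P\<bar> \<le> 4 * pi / \<mu>" .
      have "l * P' = pi + 2 * pi * k" using l0 by (simp add: P'_def)
      then have 2: "cis (l * P') = -1"
        by (simp add: cis_multiple_2pi flip: cis_mult)
      have "\<bar>\<mu> * P' - 2 * pi * n\<bar> = \<mu> * \<bar>P' - P0\<bar>"
        unfolding P0(1)[symmetric] by (simp add: abs_scaled_diff)
      also have "\<dots> \<le> \<mu> * (pi / l)" by (intro mult_left_mono d) auto
      also have "\<dots> \<le> pi / (1 + \<eta>)"
      proof -
        have "pi * ((1 + \<eta>) * \<mu>) \<le> pi * l" by (intro mult_left_mono l) auto
        then show ?thesis using \<eta> l0 by (simp add: field_simps)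
      qed
      finally have 3: "\<bar>\<mu> * P' - 2 * pi * n\<bar> \<le> pi / (1 + \<eta>)" .
      show ?thesis using 1 2 3 by (auto simp: Good_def l_def intro!: exI[of _ P'])
    qed
  next
    show "0 \<le> 4 * pi" by simp
  next
    fix \<mu> \<nu> assume "\<mu> \<in> J" "\<nu> \<in> J" "\<nu> < \<mu>"
    then show "Q * real \<nu> \<le> real \<mu>" by (rule ratio)
  qed
  have "2 * (4 * pi) / Q = 8 * pi / Q" by simp
  from ex[unfolded this] obtain P where
    P: "\<forall>\<mu>\<in>J. \<exists>P'. real \<mu> * \<bar>P - P'\<bar> \<le> 8 * pi / Q \<and> Good \<mu> P'"
    by (rule exE)
  show ?thesis
  proof (rule exI[of _ "cis P"], intro conjI ballI impI)
    fix \<mu> assume \<mu>J: "\<mu> \<in> J"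
    then have \<mu>: "0 < \<mu>" using J by (auto intro: gr0I)
    obtain P' where P': "\<mu> * \<bar>P - P'\<bar> \<le> 8 * pi / Q" "Good \<mu> P'" using bspec[OF P \<mu>J] by blast
    then obtain n :: int where n: "\<bar>real \<mu> * P' - 2 * pi * n\<bar> \<le> pi / (1 + \<eta>)" by (auto simp: Good_def)
    define \<phi> where "\<phi> = real \<mu> * P' - 2 * pi * n"
    have "real \<mu> * P' = \<phi> + 2 * pi * n" by (simp add: \<phi>_def)
    then have c1: "cis (\<mu> * P') = cis \<phi>" by (simp flip: cis_mult)
    have "3 / 4 * \<eta> \<le> cmod (1 + cis \<phi>)"
    proof -
      have "cmod (1 + cis \<phi>) = cmod (cis (\<phi> + pi) - 1)"
        by (metis cis_mult cis_pi mult_minus_right mult_1_right norm_minus_cancel minus_diff_eq diff_minus_eq_add)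
      also have "\<dots> = 2 * \<bar>cos (\<phi> / 2)\<bar>"
        unfolding cmod_cis_minus_one by (simp add: add_divide_distrib sin_add)
      finally have e: "cmod (1 + cis \<phi>) = 2 * \<bar>cos (\<phi> / 2)\<bar>" .
      define x where "x = pi * \<eta> / (2 * (1 + \<eta>))"
      have "pi / 2 - x = pi / (2 * (1 + \<eta>))" using \<eta> by (simp add: x_def field_simps)
      moreover have "\<bar>\<phi>\<bar> / 2 \<le> (pi / (1 + \<eta>)) / 2"
        using n unfolding \<phi>_def by (intro divide_right_mono) auto
      moreover have "(pi / (1 + \<eta>)) / 2 = pi / (2 * (1 + \<eta>))" by simp
      moreover have "\<bar>\<phi> / 2\<bar> = \<bar>\<phi>\<bar> / 2" by simp
      ultimately have a: "\<bar>\<phi> / 2\<bar> \<le> pi / 2 - x" by (simp only:)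
      have x: "0 \<le> x" "x \<le> pi / 3"
      proof -
        show "0 \<le> x" using \<eta> by (simp add: x_def)
        have "pi * \<eta> / (2 * (1 + \<eta>)) \<le> pi * (1 / 3) / (2 * 1)"
          using \<eta> pi_gt_zero by (intro frac_le mult_left_mono) auto
        then show "x \<le> pi / 3" using pi_gt_zero unfolding x_def by linarith
      qed
      have "sin x = cos (pi / 2 - x)" by (simp add: cos_diff)
      also have "\<dots> \<le> cos \<bar>\<phi> / 2\<bar>" using a x by (intro cos_monotone_0_pi_le) auto
      finally have "sin x \<le> cos (\<phi> / 2)" by (simp only: cos_abs_real)
      then have "x \<le> cmod (1 + cis \<phi>)" using half_le_sin[OF x] x unfolding e by linarith
      moreover have "3 / 4 * \<eta> \<le> x"
      proof -
        have "3 * \<eta> / (2 * 2) \<le> pi * \<eta> / (2 * (1 + \<eta>))"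
          using \<eta> pi_gt3 by (intro frac_le mult_right_mono) auto
        then show ?thesis by (simp add: x_def)
      qed
      ultimately show ?thesis by linarith
    qed
    moreover have "cmod (1 + cis \<phi>) \<le> cmod (1 + cis (\<mu> * P)) + cmod (cis \<phi> - cis (\<mu> * P))"
      using norm_triangle_ineq[of "1 + cis (\<mu> * P)" "cis \<phi> - cis (\<mu> * P)"] by simp
    moreover have "cmod (cis \<phi> - cis (\<mu> * P)) \<le> \<eta> / 4"
    proof -
      have "cmod (cis \<phi> - cis (\<mu> * P)) \<le> \<bar>\<mu> * P' - \<mu> * P\<bar>"
        unfolding c1[symmetric] by (rule cmod_cis_diff_le)
      also have "\<dots> = \<mu> * \<bar>P - P'\<bar>" by (simp add: abs_scaled_diff abs_minus_commute[of P P'])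
      finally show ?thesis using P'(1) \<eta>(3) by linarith
    qed
    ultimately have "\<eta> / 2 \<le> cmod (1 + cis (\<mu> * P))" by linarith
    then show "\<eta> / 2 \<le> cmod (1 + cis P ^ \<mu>)" by (simp add: Complex.DeMoivre)
    assume s: "sel \<mu> \<noteq> 0"
    then have "cis (sel \<mu> * P') = -1" using P'(2) by (auto simp: Good_def)
    then have "cmod (1 + cis P ^ sel \<mu>) = cmod (cis (sel \<mu> * P) - cis (sel \<mu> * P'))"
      by (simp add: Complex.DeMoivre add.commute)
    also have "\<dots> \<le> \<bar>sel \<mu> * P - sel \<mu> * P'\<bar>" by (rule cmod_cis_diff_le)
    also have "\<dots> = sel \<mu> * \<bar>P - P'\<bar>" by (simp add: abs_scaled_diff)
    also have "\<dots> \<le> \<mu> / \<eta> * \<bar>P - P'\<bar>"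
      using sel[OF \<mu>J s] \<eta> by (intro mult_right_mono) (auto simp: field_simps)
    also have "\<dots> = (\<mu> * \<bar>P - P'\<bar>) / \<eta>" by simp
    also have "\<dots> \<le> (8 * pi / Q) / \<eta>" using P'(1) \<eta> by (intro divide_right_mono) auto
    finally show "cmod (1 + cis P ^ sel \<mu>) \<le> 8 * pi / (Q * \<eta>)" by simp
  qed simp
qed

lemma power_ge_one_minus:
  fixes a c :: real assumes "0 \<le> a" "1 - c \<le> a" "0 \<le> c"
  shows "1 - real n * c \<le> a ^ n"
proof (cases "c \<le> 1")
  case True
  have "1 + real n * (- c) \<le> (1 + (- c)) ^ n" using True by (intro Bernoulli_inequality) auto
  also have "\<dots> \<le> a ^ n" using True assms by (intro power_mono) auto
  finally show ?thesis by simp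
next
  case False
  show ?thesis
  proof (cases n)
    case (Suc m)
    have "c * 1 \<le> c * real n" using False Suc by (intro mult_left_mono) auto
    then have "1 - real n * c \<le> 0" using False by (simp only: mult_1_right mult.commute[of c])
    also have "\<dots> \<le> a ^ n" using assms by simp
    finally show ?thesis .
  qed simp
qed

lemma power_le_exp:
  fixes a c :: real assumes "0 \<le> a" "a \<le> 1 - c"
  shows "a ^ n \<le> exp (- (real n * c))"
proof -
  have "a \<le> exp (- c)" using assms(2) exp_ge_add_one_self[of "- c"] by linarith
  then have "a ^ n \<le> exp (- c) ^ n" using assms(1) by (intro power_mono)
  then show ?thesis by (simp flip: exp_of_nat_mult)
qed

text \<open>
  The elements of each \<open>S \<mu>\<close> are numbered, and one pair of characters deals with the \<open>i\<close>-th elements of all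
  \<open>S \<mu>\<close> simultaneously. High powers make the factors close to one on \<open>J\<close> without enlarging them anywhere, so
  the lower bound on \<open>J\<close> does not deteriorate when the requested smallness \<open>\<delta>\<close> on the sets \<open>S \<mu>\<close> is sharpened.
\<close>

lemma comparable_multiplier:
  fixes J :: "nat set" and S :: "nat \<Rightarrow> nat set" and Q \<eta> \<delta> :: real and N K :: nat
  assumes J: "finite J" "0 \<notin> J" and Q: "2 \<le> Q" and \<eta>: "0 < \<eta>" "\<eta> \<le> 1 / 3" "8 * pi / Q \<le> \<eta> / 4"
    and ratio: "\<And>\<mu> \<nu>. \<mu> \<in> J \<Longrightarrow> \<nu> \<in> J \<Longrightarrow> \<nu> < \<mu> \<Longrightarrow> Q * real \<nu> \<le> real \<mu>"
    and S: "\<And>\<mu>. \<mu> \<in> J \<Longrightarrow> finite (S \<mu>)" "\<And>\<mu>. \<mu> \<in> J \<Longrightarrow> card (S \<mu>) \<le> K"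
    and comp: "\<And>\<mu> l. \<mu> \<in> J \<Longrightarrow> l \<in> S \<mu> \<Longrightarrow>
        \<eta> * \<mu> \<le> l \<and> \<eta> * l \<le> \<mu> \<and> (real l \<le> (1 - \<eta>) * \<mu> \<or> (1 + \<eta>) * \<mu> \<le> l)"
    and \<delta>: "exp (- (N * (\<eta>\<^sup>2 / 16))) \<le> \<delta>" "N * (4 * pi / (Q * \<eta>))\<^sup>2 \<le> \<delta>" "4 * K * \<delta> \<le> 1"
  shows "\<exists>v :: nat \<Rightarrow> real. (\<forall>k. 0 \<le> v k \<and> v k \<le> 1) \<and>
     multiplier r F (((1 + 4 ^ N) * 3 ^ N) ^ K) (\<lambda>k. complex_of_real (v k)) \<and>
     (\<forall>\<mu>\<in>J. 1 / 2 \<le> v \<mu> \<and> (\<forall>l\<in>S \<mu>. v l \<le> \<delta>))"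
proof -
  have "\<forall>\<mu>\<in>J. \<exists>h. bij_betw h {0..<card (S \<mu>)} (S \<mu>)"
    using S(1) ex_bij_betw_nat_finite by blast
  then obtain h where h: "\<And>\<mu>. \<mu> \<in> J \<Longrightarrow> bij_betw (h \<mu>) {0..<card (S \<mu>)} (S \<mu>)"
    using bchoice by metis
  have hS: "h \<mu> i \<in> S \<mu>" if "\<mu> \<in> J" "i < card (S \<mu>)" for \<mu> i
    using bij_betwE[OF h[OF that(1)]] that(2) by auto
  define above where "above = (\<lambda>i \<mu>. if i < card (S \<mu>) \<and> (1 + \<eta>) * \<mu> \<le> h \<mu> i then h \<mu> i else 0)"
  define below where "below = (\<lambda>i \<mu>. if i < card (S \<mu>) \<and> real (h \<mu> i) \<le> (1 - \<eta>) * \<mu> then h \<mu> i else 0)"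
  have "\<forall>i. \<exists>w. cmod w = 1 \<and> (\<forall>\<mu>\<in>J. \<eta> / 2 \<le> cmod (1 + w ^ \<mu>) \<and>
            (above i \<mu> \<noteq> 0 \<longrightarrow> cmod (1 + w ^ above i \<mu>) \<le> 8 * pi / (Q * \<eta>)))"
  proof
    fix i show "\<exists>w. cmod w = 1 \<and> (\<forall>\<mu>\<in>J. \<eta> / 2 \<le> cmod (1 + w ^ \<mu>) \<and>
            (above i \<mu> \<noteq> 0 \<longrightarrow> cmod (1 + w ^ above i \<mu>) \<le> 8 * pi / (Q * \<eta>)))"
      by (rule above_comparable_phase[OF J Q \<eta> ratio]; (assumption)?)
         (auto simp: above_def split: if_splits dest: hS comp)
  qed
  then obtain wA where wA: "\<And>i. cmod (wA i) = 1" "\<And>i \<mu>. \<mu> \<in> J \<Longrightarrow> \<eta> / 2 \<le> cmod (1 + wA i ^ \<mu>)"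
    "\<And>i \<mu>. \<mu> \<in> J \<Longrightarrow> above i \<mu> \<noteq> 0 \<Longrightarrow> cmod (1 + wA i ^ above i \<mu>) \<le> 8 * pi / (Q * \<eta>)"
    by metis
  have "\<forall>i. \<exists>w. cmod w = 1 \<and> (\<forall>\<mu>\<in>J. cmod (1 - w ^ \<mu>) \<le> 8 * pi / Q \<and>
            (below i \<mu> \<noteq> 0 \<longrightarrow> \<eta> \<le> cmod (1 - w ^ below i \<mu>)))"
  proof
    fix i show "\<exists>w. cmod w = 1 \<and> (\<forall>\<mu>\<in>J. cmod (1 - w ^ \<mu>) \<le> 8 * pi / Q \<and>
            (below i \<mu> \<noteq> 0 \<longrightarrow> \<eta> \<le> cmod (1 - w ^ below i \<mu>)))"
      by (rule below_comparable_phase[OF J Q \<eta> ratio]; (assumption)?)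
         (auto simp: below_def split: if_splits dest: hS comp)
  qed
  then obtain wB where wB: "\<And>i. cmod (wB i) = 1" "\<And>i \<mu>. \<mu> \<in> J \<Longrightarrow> cmod (1 - wB i ^ \<mu>) \<le> 8 * pi / Q"
    "\<And>i \<mu>. \<mu> \<in> J \<Longrightarrow> below i \<mu> \<noteq> 0 \<Longrightarrow> \<eta> \<le> cmod (1 - wB i ^ below i \<mu>)"
    by metis
  define A where "A = (\<lambda>i k. (cmod (1 - wA i ^ k))\<^sup>2 / 4)"
  define B where "B = (\<lambda>i k. (cmod (1 + wB i ^ k))\<^sup>2 / 4)"
  define f where "f = (\<lambda>i k. (1 - A i k ^ N) * B i k ^ N)"
  define v where "v = (\<lambda>k. \<Prod>i<K. f i k)"
  have A_eq: "A i k = 1 - (cmod (1 + wA i ^ k))\<^sup>2 / 4" for i k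
    using cmod_one_plus_sq(2)[of "wA i ^ k"] wA(1) by (simp add: A_def norm_power field_simps)
  have B_eq: "B i k = 1 - (cmod (1 - wB i ^ k))\<^sup>2 / 4" for i k
    using cmod_one_plus_sq(2)[of "wB i ^ k"] wB(1) by (simp add: B_def norm_power)
  have A01: "0 \<le> A i k" "A i k \<le> 1" for i k
    by (simp add: A_def) (simp add: A_eq)
  have B01: "0 \<le> B i k" "B i k \<le> 1" for i k
    by (simp add: B_def) (simp add: B_eq)
  have AN: "0 \<le> A i k ^ N" "A i k ^ N \<le> 1" "0 \<le> B i k ^ N" "B i k ^ N \<le> 1" for i k
    using A01 B01 by (auto intro: power_le_one)
  have f01: "0 \<le> f i k" "f i k \<le> 1" for i k
    using AN[of i k] by (auto simp: f_def intro: mult_le_one)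
  have \<delta>0: "0 \<le> \<delta>" using \<delta>(1) by (meson exp_ge_zero order_trans)
  have "\<forall>k. 0 \<le> v k \<and> v k \<le> 1"
    using f01 by (auto simp: v_def intro!: prod_nonneg prod_le_1)
  moreover have "multiplier r F (((1 + 4 ^ N) * 3 ^ N) ^ K) (\<lambda>k. complex_of_real (v k))"
  proof -
    have "multiplier r F (((1 + 4 ^ N) * 3 ^ N) ^ card {..<K})
        (\<lambda>k. \<Prod>i<K. complex_of_real (1 - A i k ^ N) * complex_of_real (B i k ^ N))"
      unfolding A_def B_def
      by (intro multiplier_prod multiplier_mult multiplier_cos multiplier_one_minus_sin wA wB) auto
    then show ?thesis by (simp add: v_def f_def)
  qed
  moreover have "1 / 2 \<le> v \<mu>" if \<mu>: "\<mu> \<in> J" for \<mu>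
  proof -
    have "1 - 2 * \<delta> \<le> f i \<mu>" for i
    proof -
      have "(\<eta> / 2)\<^sup>2 \<le> (cmod (1 + wA i ^ \<mu>))\<^sup>2"
        using wA(2)[OF \<mu>, of i] \<eta> by (intro power_mono) auto
      then have "A i \<mu> \<le> 1 - \<eta>\<^sup>2 / 16" by (simp add: A_eq power_divide)
      from power_le_exp[OF A01(1) this, of N] have 1: "A i \<mu> ^ N \<le> \<delta>" using \<delta>(1) by linarith
      have "(cmod (1 - wB i ^ \<mu>))\<^sup>2 \<le> (8 * pi / Q)\<^sup>2"
        using wB(2)[OF \<mu>, of i] by (intro power_mono) auto
      also have "\<dots> \<le> (8 * pi / (Q * \<eta>))\<^sup>2"
      proof (intro power_mono divide_left_mono)
        have "Q * \<eta> \<le> Q * 1" using Q \<eta> by (intro mult_left_mono) auto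
        then show "Q * \<eta> \<le> Q" by simp
      qed (use Q \<eta> in auto)
      also have "(8 * pi / (Q * \<eta>))\<^sup>2 = 4 * (4 * pi / (Q * \<eta>))\<^sup>2"
        by (simp add: power2_eq_square)
      finally have "1 - (4 * pi / (Q * \<eta>))\<^sup>2 \<le> B i \<mu>" by (simp add: B_eq)
      from power_ge_one_minus[OF B01(1) this, of N] have 2: "1 - \<delta> \<le> B i \<mu> ^ N"
        using \<delta>(2) by simp
      have "(A i \<mu> ^ N) * (B i \<mu> ^ N) \<le> \<delta> * 1"
        using 1 AN \<delta>0 by (intro mult_mono) auto
      then show ?thesis using 2 by (simp add: f_def algebra_simps)
    qed
    then have "(\<Prod>i<K. 1 - 2 * \<delta>) \<le> v \<mu>" if "2 * \<delta> \<le> 1"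
      unfolding v_def using that by (intro prod_mono) auto
    then have "(1 - 2 * \<delta>) ^ K \<le> v \<mu>" if "2 * \<delta> \<le> 1" using that by simp
    moreover have "1 - real K * (2 * \<delta>) \<le> (1 - 2 * \<delta>) ^ K" if "2 * \<delta> \<le> 1"
      using that \<delta>0 by (intro power_ge_one_minus) auto
    moreover have "2 * \<delta> \<le> 1 \<or> K = 0"
    proof (cases "K = 0")
      case False
      then have "1 * \<delta> \<le> K * \<delta>" using \<delta>0 by (intro mult_right_mono) auto
      then show ?thesis using \<delta>(3) by linarith
    qed simp
    ultimately show ?thesis using \<delta>(3) by (auto simp: v_def)
  qed
  moreover have "v l \<le> \<delta>" if \<mu>: "\<mu> \<in> J" and l: "l \<in> S \<mu>" for \<mu> l
  proof -
    obtain i where i: "i < card (S \<mu>)" "l = h \<mu> i"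
      using bij_betw_imp_surj_on[OF h[OF \<mu>]] l by (metis atLeastLessThan_iff imageE)
    have \<mu>0: "0 < \<mu>" using \<mu> J by (auto intro: gr0I)
    have c: "\<eta> * \<mu> \<le> l" "real l \<le> (1 - \<eta>) * \<mu> \<or> (1 + \<eta>) * \<mu> \<le> l"
      using comp[OF \<mu> l] by auto
    have "0 < \<eta> * \<mu>" using \<eta> \<mu>0 by simp
    with c(1) have l0: "l \<noteq> 0" by (intro notI) simp
    have "f i l \<le> \<delta>"
      using c(2)
    proof
      assume "real l \<le> (1 - \<eta>) * \<mu>"
      then have "below i \<mu> = l" using i by (simp add: below_def)
      then have "\<eta>\<^sup>2 \<le> (cmod (1 - wB i ^ l))\<^sup>2"
        using wB(3)[OF \<mu>, of i] \<eta> l0 by (intro power_mono) auto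
      then have "B i l \<le> 1 - \<eta>\<^sup>2 / 16" using zero_le_power2[of \<eta>] unfolding B_eq by linarith
      from power_le_exp[OF B01(1) this, of N] have "B i l ^ N \<le> \<delta>" using \<delta>(1) by linarith
      then have "f i l \<le> 1 * \<delta>" unfolding f_def using AN[of i l] by (intro mult_mono) auto
      then show ?thesis by simp
    next
      assume "(1 + \<eta>) * \<mu> \<le> l"
      then have "above i \<mu> = l" using i by (simp add: above_def)
      then have "(cmod (1 + wA i ^ l))\<^sup>2 \<le> (8 * pi / (Q * \<eta>))\<^sup>2"
        using wA(3)[OF \<mu>, of i] l0 by (intro power_mono) auto
      also have "(8 * pi / (Q * \<eta>))\<^sup>2 = 4 * (4 * pi / (Q * \<eta>))\<^sup>2"
        by (simp add: power2_eq_square)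
      finally have "1 - (4 * pi / (Q * \<eta>))\<^sup>2 \<le> A i l" by (simp add: A_eq)
      from power_ge_one_minus[OF A01(1) this, of N] have "1 - A i l ^ N \<le> \<delta>" using \<delta>(2) by simp
      then have "f i l \<le> \<delta> * 1" unfolding f_def using AN[of i l] by (intro mult_mono) auto
      then show ?thesis by simp
    qed
    moreover have "v l \<le> f i l"
    proof -
      have "i < K" using i S(2)[OF \<mu>] by simp
      then have "v l = f i l * (\<Prod>j\<in>{..<K} - {i}. f j l)"
        unfolding v_def by (intro prod.remove) auto
      also have "\<dots> \<le> f i l * 1" using f01 by (intro mult_left_mono prod_le_1) auto
      finally show ?thesis by simp
    qed
    ultimately show ?thesis by linarith
  qed
  ultimately show ?thesis by blast
qed

section \<open>Bounds on a single lacunary class\<close>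

lemma sum_of_two_unimodular:
  assumes "cmod c \<le> 2"
  obtains a a' where "cmod a = 1" "cmod a' = 1" "c = a + a'"
proof -
  define \<beta> where "\<beta> = arccos (cmod c / 2)"
  have \<beta>: "cos \<beta> = cmod c / 2" unfolding \<beta>_def using assms by (intro cos_arccos) (auto intro: order_trans[of _ 0])
  have "c = cmod c * cis (Arg c)" by (simp flip: rcis_def add: rcis_cmod_Arg)
  also have "\<dots> = cis (Arg c) * (cis \<beta> + cis (- \<beta>))"
    using \<beta> by (simp add: complex_eq_iff)
  also have "\<dots> = cis (Arg c + \<beta>) + cis (Arg c - \<beta>)"
    by (simp add: distrib_left cis_mult)
  finally show ?thesis by (rule that[rotated 2]) auto
qed

text \<open>
  Frequencies comparable to a pin but outside its cluster are first made small by \<open>comparable_multiplier\<close>;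
  the others are handled by \<open>pinned_approximation\<close> applied to the weighted functional. This gives the
  bound for coefficients \<open>v\<^sub>\<mu> a\<^sub>\<mu>\<close> with \<open>|a\<^sub>\<mu>| = 1\<close>, where \<open>v \<ge> 1/2\<close> on \<open>J\<close>. Since \<open>b\<^sub>\<mu> / v\<^sub>\<mu>\<close> lies in the disc
  of radius \<open>2\<close>, it is a sum of two unimodular numbers.
\<close>

lemma lacunary_class_bound:
  fixes F J :: "nat set" and \<kappa> Q A r :: real and N K :: nat
  assumes g: "psh_functional r F \<Psi>" and A: "\<And>u. cmod u = 1 \<Longrightarrow> \<Psi> (\<lambda>k. u ^ k) \<le> A"
    and F: "0 \<notin> F" "J \<subseteq> F"
    and \<kappa>: "0 < \<kappa>" "\<kappa> \<le> 1 / 2" and Q: "2 \<le> Q" "1 \<le> \<kappa>\<^sup>2 * Q" "8 * pi / Q \<le> \<kappa>\<^sup>2 / 4"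
    and ratio: "\<And>\<mu> \<nu>. \<mu> \<in> J \<Longrightarrow> \<nu> \<in> J \<Longrightarrow> \<nu> < \<mu> \<Longrightarrow> Q * real \<nu> \<le> real \<mu>"
    and bottom: "\<And>\<mu> l. \<mu> \<in> J \<Longrightarrow> l \<in> F \<Longrightarrow> l < \<mu> \<Longrightarrow> real l \<le> (1 - \<kappa>\<^sup>2) * \<mu>"
    and free: "\<And>\<mu> l \<nu>. \<mu> \<in> J \<Longrightarrow> l \<in> F \<Longrightarrow> \<mu> < l \<Longrightarrow> real l \<le> (1 + \<kappa>\<^sup>2) * \<mu> \<Longrightarrow> \<nu> \<in> J \<Longrightarrow>
        real (l - \<mu>) \<le> \<kappa>\<^sup>2 * \<nu> \<or> real \<nu> \<le> \<kappa>\<^sup>2 * real (l - \<mu>)"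
    and card: "\<And>\<mu>. \<mu> \<in> J \<Longrightarrow> card {l\<in>F. \<kappa>\<^sup>2 * \<mu> < l \<and> \<kappa>\<^sup>2 * l < \<mu>} \<le> K"
    and N: "exp (- (N * ((\<kappa>\<^sup>2)\<^sup>2 / 16))) \<le> \<kappa>" "N * (4 * pi / (Q * \<kappa>\<^sup>2))\<^sup>2 \<le> \<kappa>" "4 * K * \<kappa> \<le> 1"
    and b: "\<And>l. l \<in> J \<Longrightarrow> cmod (b l) \<le> 1"
  shows "\<Psi> (\<lambda>l. of_bool (l \<in> J) * b l) \<le>
      2 * (((1 + 4 ^ N) * 3 ^ N) ^ K * A + (20 * \<kappa>) powr r * psh_bound F \<Psi>)"
proof -
  define C0 :: real where "C0 = ((1 + 4 ^ N) * 3 ^ N) ^ K"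
  have fF: "finite F" by (rule psh_finite[OF g])
  have J: "finite J" "0 \<notin> J" using F fF finite_subset by auto
  have \<kappa>2: "0 < \<kappa>\<^sup>2" "\<kappa>\<^sup>2 \<le> 1 / 4"
    using \<kappa> power_mono[of \<kappa> "1/2" 2] by (auto simp: power2_eq_square)
  define near where "near = (\<lambda>\<mu> l. \<mu> \<le> l \<and> real l \<le> (1 + \<kappa>\<^sup>2) * real \<mu>)"
  define S where "S = (\<lambda>\<mu>. {l\<in>F. \<kappa>\<^sup>2 * \<mu> < l \<and> \<kappa>\<^sup>2 * l < \<mu> \<and> \<not> near \<mu> l})"
  have S_comp: "\<kappa>\<^sup>2 * \<mu> \<le> l \<and> \<kappa>\<^sup>2 * l \<le> \<mu> \<and> (real l \<le> (1 - \<kappa>\<^sup>2) * \<mu> \<or> (1 + \<kappa>\<^sup>2) * \<mu> \<le> l)"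
    if "\<mu> \<in> J" "l \<in> S \<mu>" for \<mu> l
    using that bottom[of \<mu> l] by (cases "l < \<mu>") (auto simp: S_def near_def)
  have S_card: "card (S \<mu>) \<le> K" if "\<mu> \<in> J" for \<mu>
  proof -
    have "card (S \<mu>) \<le> card {l\<in>F. \<kappa>\<^sup>2 * \<mu> < l \<and> \<kappa>\<^sup>2 * l < \<mu>}"
      using fF by (intro card_mono) (auto simp: S_def)
    then show ?thesis using card[OF that] by linarith
  qed
  have "\<exists>v :: nat \<Rightarrow> real. (\<forall>k. 0 \<le> v k \<and> v k \<le> 1) \<and>
     multiplier r F C0 (\<lambda>k. complex_of_real (v k)) \<and>
     (\<forall>\<mu>\<in>J. 1 / 2 \<le> v \<mu> \<and> (\<forall>l\<in>S \<mu>. v l \<le> \<kappa>))"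
    unfolding C0_def
    by (rule comparable_multiplier[where \<eta> = "\<kappa>\<^sup>2" and Q = Q])
       (use J Q \<kappa>2 ratio S_comp S_card N fF in \<open>auto simp: S_def\<close>)
  then obtain v :: "nat \<Rightarrow> real" where v: "\<And>k. 0 \<le> v k" "\<And>k. v k \<le> 1"
    and vm: "multiplier r F C0 (\<lambda>k. complex_of_real (v k))"
    and vJ: "\<And>\<mu>. \<mu> \<in> J \<Longrightarrow> 1 / 2 \<le> v \<mu>" and vS: "\<And>\<mu> l. \<mu> \<in> J \<Longrightarrow> l \<in> S \<mu> \<Longrightarrow> v l \<le> \<kappa>"
    by blast
  define base where "base = (\<lambda>l. if l \<in> J then l else if \<exists>\<mu>\<in>J. near \<mu> l then SOME \<mu>. \<mu> \<in> J \<and> near \<mu> l else 0)"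
  have base_J: "base l \<in> J \<and> near (base l) l" if "base l \<noteq> 0" for l
  proof (cases "l \<in> J")
    case True
    have "real l \<le> (1 + \<kappa>\<^sup>2) * l" using \<kappa>2 by (simp add: distrib_right)
    then show ?thesis using True by (simp add: base_def near_def)
  next
    case False
    then have ex: "\<exists>\<mu>. \<mu> \<in> J \<and> near \<mu> l" using that by (auto simp: base_def split: if_splits)
    then have "base l = (SOME \<mu>. \<mu> \<in> J \<and> near \<mu> l)" using False by (auto simp: base_def)
    then show ?thesis using someI_ex[OF ex] by simp
  qed
  have base_0: "\<not> near \<mu> l" if "base l = 0" "\<mu> \<in> J" "l \<in> F" for \<mu> l
    using that F J someI_ex[of "\<lambda>\<mu>. \<mu> \<in> J \<and> near \<mu> l"] by (auto simp: base_def split: if_splits)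
  define T where "T = {l\<in>F. base l \<noteq> 0 \<or> (\<forall>\<mu>\<in>J. l \<notin> S \<mu>)}"
  \<comment> \<open>An additional pin above all frequencies: it ensures that every entry becomes active at the end.\<close>
  obtain top :: nat where top: "(Q + 1 / \<kappa>\<^sup>2) * (real (Max (insert 0 F)) + 1) < real top"
    using reals_Archimedean2 by blast
  have top_F: "Q * real l \<le> real top \<and> real l \<le> \<kappa>\<^sup>2 * top \<and> l < top" if "l \<in> F" for l
  proof -
    have "l \<le> Max (insert 0 F)" using that fF by auto
    then have l: "real l \<le> real (Max (insert 0 F)) + 1" by simp
    have "Q * real l \<le> (Q + 1 / \<kappa>\<^sup>2) * (real (Max (insert 0 F)) + 1)"
      using l Q \<kappa>2 by (intro mult_mono) auto
    then have 1: "Q * real l \<le> real top" using top by linarith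
    have "(1 / \<kappa>\<^sup>2) * real l \<le> (Q + 1 / \<kappa>\<^sup>2) * (real (Max (insert 0 F)) + 1)"
      using l Q \<kappa>2 by (intro mult_mono) auto
    then have "(1 / \<kappa>\<^sup>2) * real l \<le> top" using top by linarith
    then have 2: "real l \<le> \<kappa>\<^sup>2 * top" using \<kappa>2 by (simp add: field_simps)
    have "0 < l" using that F by (auto intro: gr0I)
    then have "1 * real l < Q * real l" using Q by (intro mult_strict_right_mono) auto
    then show ?thesis using 1 2 by auto
  qed
  define J' where "J' = insert top J"
  have J': "finite J'" "0 \<notin> J'"
  proof -
    have "0 < (Q + 1 / \<kappa>\<^sup>2) * (real (Max (insert 0 F)) + 1)"
      using Q \<kappa>2 by (intro mult_pos_pos add_pos_pos[of Q] add_nonneg_pos) auto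
    then have "0 < top" using top by linarith
    then show "finite J'" "0 \<notin> J'" using J by (auto simp: J'_def)
  qed
  have top_notin: "top \<notin> F" using top_F by auto
  have g': "psh_functional r F (\<lambda>m. \<Psi> (\<lambda>k. complex_of_real (v k) * m k))"
    by (rule psh_weighted[OF g])
  have B0: "0 \<le> psh_bound F \<Psi>" by (rule psh_bound_nonneg[OF g])
  have unimodular: "\<Psi> (\<lambda>l. complex_of_real (v l) * (of_bool (l \<in> J) * a l)) \<le>
      C0 * A + (20 * \<kappa>) powr r * psh_bound F \<Psi>"
    if a: "\<And>l. l \<in> J \<Longrightarrow> cmod (a l) = 1" for a
  proof -
    have "8 * pi / Q = 4 * (2 * pi / Q)" by simp
    moreover have "\<kappa>\<^sup>2 \<le> \<kappa> / 2" using \<kappa> by (simp add: power2_eq_square)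
    ultimately have Q3: "2 * pi / Q \<le> \<kappa>" using Q(3) \<kappa> by linarith
    obtain w V where w: "cmod w = 1"
      and \<Psi>V: "\<Psi> (\<lambda>k. complex_of_real (v k) * (of_bool (k \<in> T \<and> base k = k) * (a(top := 1)) k)) \<le>
         \<Psi> (\<lambda>k. complex_of_real (v k) * V k)"
      and V0: "\<And>l. l \<notin> T \<Longrightarrow> V l = 0"
      and V: "\<And>l. l \<in> T \<Longrightarrow> cmod (V l - w ^ l) \<le> 20 * \<kappa>"
    proof (rule pinned_approximation[OF g' \<kappa> Q(1,2) Q3 J', where a = "a(top := 1)" and T = T and base = base])
      fix \<mu> \<nu> assume "\<mu> \<in> J'" "\<nu> \<in> J'" "\<nu> < \<mu>"
      then show "Q * real \<nu> \<le> real \<mu>"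
        using ratio[of \<mu> \<nu>] top_F[of \<nu>] top_F[of \<mu>] F by (auto simp: J'_def)
    next
      fix \<mu> assume "\<mu> \<in> J'"
      then show "cmod ((a(top := 1)) \<mu>) = 1" using a by (auto simp: J'_def)
    next
      show "T \<subseteq> F" "0 \<notin> T" using F by (auto simp: T_def)
      fix l assume l: "l \<in> T"
      show "base l \<in> insert 0 J'" "base l \<le> l"
        using base_J[of l] by (cases "base l = 0"; auto simp: J'_def near_def)+
      {
        assume n: "base l \<noteq> 0"
        then have "real l \<le> (1 + \<kappa>\<^sup>2) * base l" "base l \<le> l" using base_J[of l] by (auto simp: near_def)
        then show "real (l - base l) \<le> \<kappa>\<^sup>2 * base l"
          by (simp add: algebra_simps of_nat_diff)
        have "(1 + \<kappa>\<^sup>2) * base l \<le> 2 * real (base l)" using \<kappa>2 by (intro mult_right_mono) auto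
        then show "l \<le> 2 * base l" using \<open>real l \<le> (1 + \<kappa>\<^sup>2) * base l\<close> by linarith
      }
      fix \<nu> assume \<nu>: "\<nu> \<in> J'" and bl: "base l < l"
      show "real (l - base l) \<le> \<kappa>\<^sup>2 * \<nu> \<or> real \<nu> \<le> \<kappa>\<^sup>2 * real (l - base l)"
      proof (cases "\<nu> \<in> J")
        case False
        then have \<nu>top: "\<nu> = top" using \<nu> by (auto simp: J'_def)
        have "real (l - base l) \<le> real l" by simp
        moreover have "real l \<le> \<kappa>\<^sup>2 * top" using top_F[of l] l by (auto simp: T_def)
        ultimately have "real (l - base l) \<le> \<kappa>\<^sup>2 * top" by linarith
        then show ?thesis using \<nu>top by simp
      next
        case True
        show ?thesis
        proof (cases "base l = 0")
          case b0: True
          then have "l \<notin> S \<nu>" "l \<in> F" using l True by (auto simp: T_def)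
          then have "\<not> (\<kappa>\<^sup>2 * \<nu> < l \<and> \<kappa>\<^sup>2 * l < \<nu>)"
            using base_0[OF b0 True] by (auto simp: S_def)
          then show ?thesis using b0 by auto
        next
          case False
          then show ?thesis using base_J[OF False] free[of "base l" l \<nu>] True bl l
            by (auto simp: near_def T_def)
        qed
      qed
    next
      fix l assume "l \<in> T"
      then show "\<exists>\<nu>\<in>J'. real l \<le> \<kappa>\<^sup>2 * real \<nu>"
        using top_F[of l] by (auto simp: T_def J'_def)
    qed (rule that)
    have "\<Psi> (\<lambda>l. complex_of_real (v l) * (of_bool (l \<in> J) * a l)) =
        \<Psi> (\<lambda>k. complex_of_real (v k) * (of_bool (k \<in> T \<and> base k = k) * (a(top := 1)) k))"
    proof (rule psh_cong[OF g])
      fix k assume k: "k \<in> F"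
      then have "k \<noteq> top" using top_notin by auto
      moreover have "k \<in> J \<longleftrightarrow> k \<in> T \<and> base k = k"
      proof -
        have "k \<noteq> 0" using k F by metis
        moreover have "base k = k" if "k \<in> J" using that by (simp add: base_def)
        moreover have "k \<in> J" if "base k = k" using that base_J[of k] \<open>k \<noteq> 0\<close> by simp
        ultimately show ?thesis using k by (auto simp: T_def)
      qed
      ultimately show "complex_of_real (v k) * (of_bool (k \<in> J) * a k) =
          complex_of_real (v k) * (of_bool (k \<in> T \<and> base k = k) * (a(top := 1)) k)" by simp
    qed
    also have "\<dots> \<le> \<Psi> (\<lambda>k. complex_of_real (v k) * V k)" by (rule \<Psi>V)
    also have "\<dots> = \<Psi> (\<lambda>k. complex_of_real (v k) * w ^ k + complex_of_real (v k) * (V k - w ^ k))"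
      by (simp add: algebra_simps)
    also have "\<dots> \<le> \<Psi> (\<lambda>k. complex_of_real (v k) * w ^ k) + \<Psi> (\<lambda>k. complex_of_real (v k) * (V k - w ^ k))"
      by (rule psh_add[OF g])
    also have "\<dots> \<le> C0 * A + (20 * \<kappa>) powr r * psh_bound F \<Psi>"
    proof (rule add_mono)
      show "\<Psi> (\<lambda>k. complex_of_real (v k) * w ^ k) \<le> C0 * A"
        by (rule multiplierD[OF vm g A w])
      show "\<Psi> (\<lambda>k. complex_of_real (v k) * (V k - w ^ k)) \<le> (20 * \<kappa>) powr r * psh_bound F \<Psi>"
      proof (rule psh_le_bound[OF g])
        fix k assume k: "k \<in> F"
        show "cmod (complex_of_real (v k) * (V k - w ^ k)) \<le> 20 * \<kappa>"
        proof (cases "k \<in> T")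
          case True
          have "v k * cmod (V k - w ^ k) \<le> 1 * (20 * \<kappa>)"
            using v V[OF True] by (intro mult_mono) auto
          then show ?thesis using v by (simp add: norm_mult)
        next
          case False
          then obtain \<mu> where "\<mu> \<in> J" "k \<in> S \<mu>" using k by (auto simp: T_def)
          then have "v k \<le> \<kappa>" by (rule vS)
          then show ?thesis using V0[OF False] v(1)[of k] w \<kappa> by (simp add: norm_mult norm_power)
        qed
      qed (use \<kappa> in auto)
    qed
    finally show ?thesis .
  qed
  have "\<exists>a a'. cmod a = 1 \<and> cmod a' = 1 \<and> (l \<in> J \<longrightarrow> b l = complex_of_real (v l) * (a + a'))" for l
  proof (cases "l \<in> J")
    case True
    have "cmod (b l / v l) \<le> 1 / (1 / 2)"
      unfolding norm_divide using b[OF True] vJ[OF True] v by (intro frac_le) auto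
    then obtain a a' where "cmod a = 1" "cmod a' = 1" "b l / v l = a + a'"
      using sum_of_two_unimodular[of "b l / v l"] by auto
    moreover have "v l \<noteq> 0" using vJ[OF True] by auto
    ultimately show ?thesis by (intro exI[of _ a] exI[of _ a']) (simp add: field_simps)
  qed (auto intro!: exI[of _ 1])
  then obtain a a' where a: "\<And>l. cmod (a l) = 1" "\<And>l. cmod (a' l) = 1"
    "\<And>l. l \<in> J \<Longrightarrow> b l = complex_of_real (v l) * (a l + a' l)" by metis
  have "\<Psi> (\<lambda>l. of_bool (l \<in> J) * b l) =
      \<Psi> (\<lambda>l. complex_of_real (v l) * (of_bool (l \<in> J) * a l) + complex_of_real (v l) * (of_bool (l \<in> J) * a' l))"
    using a(3) by (intro psh_cong[OF g]) (auto simp: algebra_simps)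
  also have "\<dots> \<le> \<Psi> (\<lambda>l. complex_of_real (v l) * (of_bool (l \<in> J) * a l)) +
      \<Psi> (\<lambda>l. complex_of_real (v l) * (of_bool (l \<in> J) * a' l))"
    by (rule psh_add[OF g])
  also have "\<dots> \<le> (C0 * A + (20 * \<kappa>) powr r * psh_bound F \<Psi>) + (C0 * A + (20 * \<kappa>) powr r * psh_bound F \<Psi>)"
    by (intro add_mono unimodular a)
  finally show ?thesis unfolding C0_def mult_2 .
qed

section \<open>Induction on the density of the spectrum\<close>

lemma greedy_coloring:
  fixes S :: "nat set" and conf :: "nat \<Rightarrow> nat \<Rightarrow> bool"
  assumes "finite S" and "\<And>m. m \<in> S \<Longrightarrow> card {n\<in>S. n < m \<and> conf n m} \<le> G"
  shows "\<exists>col :: nat \<Rightarrow> nat. (\<forall>m\<in>S. col m \<le> G) \<and> (\<forall>m\<in>S. \<forall>n\<in>S. n < m \<longrightarrow> conf n m \<longrightarrow> col n \<noteq> col m)"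
  using assms
proof (induction S rule: finite_linorder_max_induct)
  case empty
  then show ?case by auto
next
  case (insert b A)
  have "card {n\<in>A. n < m \<and> conf n m} \<le> G" if "m \<in> A" for m
  proof -
    have "card {n\<in>A. n < m \<and> conf n m} \<le> card {n\<in>insert b A. n < m \<and> conf n m}"
      using insert.hyps by (intro card_mono) auto
    also have "\<dots> \<le> G" using insert.prems that by auto
    finally show ?thesis .
  qed
  from insert.IH[OF this] obtain col :: "nat \<Rightarrow> nat" where col: "\<And>m. m \<in> A \<Longrightarrow> col m \<le> G"
    "\<And>m n. m \<in> A \<Longrightarrow> n \<in> A \<Longrightarrow> n < m \<Longrightarrow> conf n m \<Longrightarrow> col n \<noteq> col m" by blast
  define U where "U = col ` {n\<in>insert b A. n < b \<and> conf n b}"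
  have "card U \<le> card {n\<in>insert b A. n < b \<and> conf n b}"
    unfolding U_def using insert.hyps by (intro card_image_le) auto
  also have "\<dots> \<le> G" using insert.prems by auto
  finally have "card U < card {..G}" by simp
  moreover have "finite U" unfolding U_def using insert.hyps by auto
  ultimately have "\<not> {..G} \<subseteq> U" using card_mono by (metis linorder_not_less)
  then obtain c where c: "c \<le> G" "c \<notin> U" by auto
  have bA: "b \<notin> A" using insert.hyps by auto
  show ?case
  proof (rule exI[of _ "col(b := c)"], intro conjI ballI impI)
    fix m assume "m \<in> insert b A" then show "(col(b := c)) m \<le> G" using c col by auto
  next
    fix m n assume mn: "m \<in> insert b A" "n \<in> insert b A" "n < m" "conf n m"
    show "(col(b := c)) n \<noteq> (col(b := c)) m"
    proof (cases "m = b")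
      case True
      then have "n \<in> A" "n \<noteq> b" using mn by auto
      then have "col n \<in> U" using mn True unfolding U_def by auto
      then show ?thesis using True c \<open>n \<noteq> b\<close> by auto
    next
      case False
      then have "m \<in> A" using mn by auto
      then have "n \<noteq> b" using mn insert.hyps by auto
      then show ?thesis using False mn col(2)[of m n] by auto
    qed
  qed
qed

definition window_bounded :: "nat \<Rightarrow> real \<Rightarrow> nat set \<Rightarrow> bool" where
  "window_bounded k t F \<longleftrightarrow> (\<forall>x>0. card {l\<in>F. x \<le> real l \<and> real l \<le> exp t * x} \<le> k)"

lemma window_bounded_multiple:
  assumes "window_bounded k t F" "finite F" "0 < x" "0 < t"
  shows "card {l\<in>F. x \<le> real l \<and> real l \<le> exp (real m * t) * x} \<le> k * max 1 m"
proof (induction m)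
  case 0
  have "card {l\<in>F. x \<le> real l \<and> real l \<le> exp (real 0 * t) * x} \<le> card {l\<in>F. x \<le> real l \<and> real l \<le> exp t * x}"
  proof (intro card_mono)
    have "1 * x \<le> exp t * x" using assms by (intro mult_right_mono) auto
    then show "{l \<in> F. x \<le> real l \<and> real l \<le> exp (real 0 * t) * x} \<subseteq> {l \<in> F. x \<le> real l \<and> real l \<le> exp t * x}"
      by auto
  qed (use assms in auto)
  also have "\<dots> \<le> k" using assms by (auto simp: window_bounded_def)
  finally show ?case by simp
next
  case (Suc m)
  show ?case
  proof (cases "m = 0")
    case True
    then show ?thesis using assms by (auto simp: window_bounded_def)
  next
    case False
    define y where "y = exp (real m * t) * x"
    have y: "0 < y" using assms by (simp add: y_def)
    have e: "exp (real (Suc m) * t) * x = exp t * y"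
      by (simp add: y_def distrib_right exp_add)
    have "{l\<in>F. x \<le> real l \<and> real l \<le> exp t * y} \<subseteq>
      {l\<in>F. x \<le> real l \<and> real l \<le> y} \<union> {l\<in>F. y \<le> real l \<and> real l \<le> exp t * y}" by auto
    then have "card {l\<in>F. x \<le> real l \<and> real l \<le> exp t * y} \<le>
      card ({l\<in>F. x \<le> real l \<and> real l \<le> y} \<union> {l\<in>F. y \<le> real l \<and> real l \<le> exp t * y})"
      using assms by (intro card_mono) auto
    also have "\<dots> \<le> card {l\<in>F. x \<le> real l \<and> real l \<le> y} + card {l\<in>F. y \<le> real l \<and> real l \<le> exp t * y}"
      by (rule card_Un_le)
    also have "\<dots> \<le> k * max 1 m + k"
      using Suc y assms(1) unfolding y_def[symmetric] window_bounded_def by (intro add_mono) auto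
    also have "\<dots> = k * max 1 (Suc m)" using False by (simp add: max_def)
    finally show ?thesis unfolding e .
  qed
qed

text \<open>
  The precision is \<open>\<kappa> = exp (-j t)\<close> for a large \<open>j\<close>, and the other parameters are powers of it: clusters and
  comparability are measured by \<open>\<kappa>\<^sup>2\<close>, the exponent in \<open>comparable_multiplier\<close> is about \<open>\<kappa>\<^bsup>-5\<^esup>\<close>, the
  lacunarity ratio is \<open>\<kappa>\<^bsup>-8\<^esup>\<close>. Counting in windows of logarithmic length \<open>t\<close> then gives numbers of
  colours and of comparable frequencies that are linear in \<open>j\<close>, and the last condition says that \<open>\<kappa>\<^sup>r\<close> beats
  the number of colours.
\<close>

lemma window_parameters:
  fixes t r C :: real and k :: nat
  assumes t: "0 < t" and r: "0 < r"
  obtains j :: nat where "1 \<le> j"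
    and "exp (- (real j * t)) \<le> 1 / 2"
    and "8 * pi / exp (8 * (real j * t)) \<le> (exp (- (real j * t)))\<^sup>2 / 4"
    and "exp (- (exp (real j * t) / 16)) \<le> exp (- (real j * t))"
    and "(exp (5 * (real j * t)) + 1) * (4 * pi / (exp (8 * (real j * t)) * (exp (- (real j * t)))\<^sup>2))\<^sup>2 \<le> exp (- (real j * t))"
    and "4 * (real k * (4 * real j)) * exp (- (real j * t)) \<le> 1"
    and "exp (- t / 2) \<le> 1 - (exp (- (real j * t)))\<^sup>2"
    and "1 + (exp (- (real j * t)))\<^sup>2 \<le> exp t"
    and "C * (real k * (8 * real j) + real k * (real k * (4 * real j)) + 1) * (20 * exp (- (real j * t))) powr r \<le> 1 / 2"
proof -
  have lim: "filterlim (\<lambda>j. real j * t) at_top at_top"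
    using t by real_asymp
  have E: "eventually (\<lambda>j. P (real j * t)) at_top" if "eventually P at_top" for P :: "real \<Rightarrow> bool"
    using eventually_compose_filterlim[OF that lim] .
  have "eventually (\<lambda>y::real. exp (- y) \<le> 1 / 2) at_top" by real_asymp
  note e1 = E[OF this]
  have "eventually (\<lambda>y::real. 8 * pi / exp (8 * y) \<le> (exp (- y))\<^sup>2 / 4) at_top" by real_asymp
  note e2 = E[OF this]
  have "eventually (\<lambda>y::real. exp (- (exp y / 16)) \<le> exp (- y)) at_top" by real_asymp
  note e3 = E[OF this]
  have "eventually (\<lambda>y::real. (exp (5 * y) + 1) * (4 * pi / (exp (8 * y) * (exp (- y))\<^sup>2))\<^sup>2 \<le> exp (- y)) at_top"
    by real_asymp
  note e4 = E[OF this]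
  have ev: "eventually (\<lambda>y. f y < a) at_top" if "(f \<longlongrightarrow> 0) at_top" "a > 0" for f :: "real \<Rightarrow> real" and a
    using order_tendstoD(2)[OF that] .
  have "((\<lambda>y::real. y * exp (- y)) \<longlongrightarrow> 0) at_top" by real_asymp
  from tendsto_mult_right_zero[OF this, of "16 * real k / t"]
  have "eventually (\<lambda>y. 16 * real k / t * (y * exp (- y)) < 1) at_top" by (rule ev) simp
  note e5 = E[OF this]
  have "((\<lambda>y::real. (exp (- y))\<^sup>2) \<longlongrightarrow> 0) at_top" by real_asymp
  then have "eventually (\<lambda>y::real. (exp (- y))\<^sup>2 < min (1 - exp (- t / 2)) (exp t - 1)) at_top"
    using t by (intro ev) auto
  note e6 = E[OF this]
  have "((\<lambda>y::real. (y + 1) * (20 * exp (- y)) powr r) \<longlongrightarrow> 0) at_top" using r by real_asymp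
  from tendsto_mult_right_zero[OF this, of "\<bar>C\<bar> * (8 * real k / t + 4 * real k * real k / t + 1)"]
  have "eventually (\<lambda>y::real. \<bar>C\<bar> * (8 * real k / t + 4 * real k * real k / t + 1) * ((y + 1) * (20 * exp (- y)) powr r) < 1 / 2) at_top"
    by (rule ev) simp
  note e7 = E[OF this]
  have "eventually (\<lambda>j::nat. 1 \<le> j) at_top" by (rule eventually_ge_at_top)
  with e1 e2 e3 e4 e5 e6 e7
  have "eventually (\<lambda>j::nat. 1 \<le> j \<and> exp (- (real j * t)) \<le> 1 / 2
     \<and> 8 * pi / exp (8 * (real j * t)) \<le> (exp (- (real j * t)))\<^sup>2 / 4
     \<and> exp (- (exp (real j * t) / 16)) \<le> exp (- (real j * t))
     \<and> (exp (5 * (real j * t)) + 1) * (4 * pi / (exp (8 * (real j * t)) * (exp (- (real j * t)))\<^sup>2))\<^sup>2 \<le> exp (- (real j * t))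
     \<and> 16 * real k / t * (real j * t * exp (- (real j * t))) < 1
     \<and> (exp (- (real j * t)))\<^sup>2 < min (1 - exp (- t / 2)) (exp t - 1)
     \<and> \<bar>C\<bar> * (8 * real k / t + 4 * real k * real k / t + 1) * ((real j * t + 1) * (20 * exp (- (real j * t))) powr r) < 1 / 2) at_top"
    by eventually_elim blast
  then obtain j :: nat where j: "1 \<le> j" "exp (- (real j * t)) \<le> 1 / 2"
     "8 * pi / exp (8 * (real j * t)) \<le> (exp (- (real j * t)))\<^sup>2 / 4"
     "exp (- (exp (real j * t) / 16)) \<le> exp (- (real j * t))"
     "(exp (5 * (real j * t)) + 1) * (4 * pi / (exp (8 * (real j * t)) * (exp (- (real j * t)))\<^sup>2))\<^sup>2 \<le> exp (- (real j * t))"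
     "16 * real k / t * (real j * t * exp (- (real j * t))) < 1"
     "(exp (- (real j * t)))\<^sup>2 < min (1 - exp (- t / 2)) (exp t - 1)"
     "\<bar>C\<bar> * (8 * real k / t + 4 * real k * real k / t + 1) * ((real j * t + 1) * (20 * exp (- (real j * t))) powr r) < 1 / 2"
    unfolding eventually_at_top_linorder by blast
  have a: "16 * real k / t * (real j * t * exp (- (real j * t))) = 4 * (real k * (4 * real j)) * exp (- (real j * t))"
    using t by (simp add: field_simps)
  have "C * (real k * (8 * real j) + real k * (real k * (4 * real j)) + 1) * (20 * exp (- (real j * t))) powr r \<le>
      \<bar>C\<bar> * ((8 * real k / t + 4 * real k * real k / t + 1) * (real j * t + 1)) * (20 * exp (- (real j * t))) powr r"
  proof (intro mult_right_mono mult_mono)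
    have "(8 * real k / t + 4 * real k * real k / t + 1) * (real j * t + 1) =
      (real k * (8 * real j) + real k * (real k * (4 * real j)) + 1) + (8 * real k / t + 4 * real k * real k / t + j * t)"
      using t by (simp add: field_simps)
    then show "real k * (8 * real j) + real k * (real k * (4 * real j)) + 1 \<le> (8 * real k / t + 4 * real k * real k / t + 1) * (real j * t + 1)"
      using t by simp
  qed auto
  then have b: "C * (real k * (8 * real j) + real k * (real k * (4 * real j)) + 1) * (20 * exp (- (real j * t))) powr r \<le> 1 / 2"
    using j(8) unfolding mult.assoc by linarith
  show ?thesis
    by (rule that[OF j(1-5)]) (use j(6,7) a b in \<open>auto simp: mult_ac\<close>)
qed

text \<open>
  A bottom is an element of \<open>F\<close> with no other element of \<open>F\<close> just below it, in the ratio \<open>1 - \<kappa>\<^sup>2\<close>. If a window of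
  half the logarithmic length contained \<open>k + 1\<close> elements that are not bottoms, the element just below the
  first of them would be element number \<open>k + 2\<close> of a window of full length. So the induction
  hypothesis covers the rest of \<open>F\<close> once the bottoms are controlled. The bottoms are coloured
  such that \<open>lacunary_class_bound\<close> applies to each colour. A bottom \<open>\<mu>\<close> conflicts with a smaller \<open>\<nu>\<close> if their
  ratio is too small or if \<open>\<nu>\<close> is comparable to one of the boundedly many differences \<open>l - \<mu>\<close> with \<open>l\<close> in
  the cluster of \<open>\<mu>\<close>, so there are boundedly many conflicts. The constant of the induction hypothesis is fixed
  before \<open>\<kappa>\<close>, which is then chosen small enough to absorb the errors.
\<close>

lemma psh_bound_windows:
  assumes r: "0 < r" "r < 1" and t: "0 < t"
  shows "\<exists>C\<ge>0. \<forall>F \<Psi> A. psh_functional r F \<Psi> \<longrightarrow> 0 \<notin> F \<longrightarrow> window_bounded k t F \<longrightarrow>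
     (\<forall>u. cmod u = 1 \<longrightarrow> \<Psi> (\<lambda>k. u ^ k) \<le> A) \<longrightarrow> psh_bound F \<Psi> \<le> C * A"
  using t
proof (induction k arbitrary: t)
  case 0
  show ?case
  proof (rule exI[of _ 0], intro conjI allI impI)
    fix F \<Psi> and A :: real
    assume g: "psh_functional r F \<Psi>" and F: "0 \<notin> F" "window_bounded 0 t F"
    have "F = {}"
    proof (rule ccontr)
      assume "F \<noteq> {}"
      then obtain l where l: "l \<in> F" by auto
      then have l0: "0 < real l" using F by (auto intro: gr0I)
      have "card {m\<in>F. real l \<le> real m \<and> real m \<le> exp t * real l} \<le> 0"
        using F(2) l0 unfolding window_bounded_def by blast
      moreover have "l \<in> {m\<in>F. real l \<le> real m \<and> real m \<le> exp t * real l}"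
        using l l0 0 mult_right_mono[of 1 "exp t" "real l"] by auto
      moreover have "finite {m\<in>F. real l \<le> real m \<and> real m \<le> exp t * real l}"
        using psh_finite[OF g] by auto
      ultimately show False by auto
    qed
    have "psh_bound F \<Psi> \<le> 0"
    proof (rule psh_bound_le)
      fix m have "\<Psi> m = \<Psi> (\<lambda>k. 0)" using \<open>F = {}\<close> by (intro psh_cong[OF g]) auto
      then show "\<Psi> m \<le> 0" by (simp add: psh_zero[OF g])
    qed
    then show "psh_bound F \<Psi> \<le> 0 * A" by simp
  qed simp
next
  case (Suc k)
  have "0 < t / 2" using Suc.prems by simp
  from Suc.IH[OF this] obtain C1 where C1: "0 \<le> C1"
    and IH: "\<And>F \<Psi> A. psh_functional r F \<Psi> \<Longrightarrow> 0 \<notin> F \<Longrightarrow> window_bounded k (t / 2) F \<Longrightarrow>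
     (\<And>u. cmod u = 1 \<Longrightarrow> \<Psi> (\<lambda>k. u ^ k) \<le> A) \<Longrightarrow> psh_bound F \<Psi> \<le> C1 * A" by blast
  define n where "n = Suc k"
  obtain j :: nat where j: "1 \<le> j" "exp (- (real j * t)) \<le> 1 / 2"
     "8 * pi / exp (8 * (real j * t)) \<le> (exp (- (real j * t)))\<^sup>2 / 4"
     "exp (- (exp (real j * t) / 16)) \<le> exp (- (real j * t))"
     "(exp (5 * (real j * t)) + 1) * (4 * pi / (exp (8 * (real j * t)) * (exp (- (real j * t)))\<^sup>2))\<^sup>2 \<le> exp (- (real j * t))"
     "4 * (real n * (4 * real j)) * exp (- (real j * t)) \<le> 1"
     "exp (- t / 2) \<le> 1 - (exp (- (real j * t)))\<^sup>2"
     "1 + (exp (- (real j * t)))\<^sup>2 \<le> exp t"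
     "(2 * (1 + C1)) * (real n * (8 * real j) + real n * (real n * (4 * real j)) + 1) * (20 * exp (- (real j * t))) powr r \<le> 1 / 2"
    by (rule window_parameters[OF Suc.prems r(1)])
  define \<kappa> where "\<kappa> = exp (- (real j * t))"
  define Q where "Q = exp (8 * (real j * t))"
  define K where "K = n * (4 * j)"
  define G where "G = n * (8 * j) + n * (n * (4 * j))"
  define N where "N = nat \<lceil>exp (5 * (real j * t))\<rceil>"
  define C0 :: real where "C0 = ((1 + 4 ^ N) * 3 ^ N) ^ K"
  have jt: "0 < real j * t" using j(1) Suc.prems by simp
  have \<kappa>: "0 < \<kappa>" "\<kappa> \<le> 1 / 2" using j(2) by (simp_all add: \<kappa>_def)
  have \<kappa>2: "0 < \<kappa>\<^sup>2" "\<kappa>\<^sup>2 = exp (- (2 * (real j * t)))"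
    by (simp_all add: \<kappa>_def flip: exp_of_nat_mult)
  have Q: "2 \<le> Q" "1 \<le> \<kappa>\<^sup>2 * Q" "8 * pi / Q \<le> \<kappa>\<^sup>2 / 4"
  proof -
    show "1 \<le> \<kappa>\<^sup>2 * Q" unfolding \<kappa>2(2) Q_def exp_add[symmetric] one_le_exp_iff using jt by linarith
    have "1 \<le> \<kappa> * exp (real j * t)" by (simp add: \<kappa>_def flip: exp_add)
    also have "\<dots> \<le> 1 / 2 * exp (real j * t)" using \<kappa> by (intro mult_right_mono) auto
    finally have "2 \<le> exp (real j * t)" by simp
    also have "\<dots> \<le> Q" unfolding Q_def exp_le_cancel_iff using jt by linarith
    finally show "2 \<le> Q" .
    show "8 * pi / Q \<le> \<kappa>\<^sup>2 / 4" using j(3) by (simp add: \<kappa>_def Q_def)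
  qed
  have N0: "exp (5 * (real j * t)) \<le> N" "N \<le> exp (5 * (real j * t)) + 1"
    unfolding N_def by (auto simp: le_nat_iff)
  have N: "exp (- (N * ((\<kappa>\<^sup>2)\<^sup>2 / 16))) \<le> \<kappa>" "N * (4 * pi / (Q * \<kappa>\<^sup>2))\<^sup>2 \<le> \<kappa>" "4 * K * \<kappa> \<le> 1"
  proof -
    have e: "(\<kappa>\<^sup>2)\<^sup>2 = exp (- (4 * (real j * t)))"
      by (simp add: \<kappa>2 flip: exp_of_nat_mult)
    have "exp (real j * t) / 16 = exp (5 * (real j * t)) * ((\<kappa>\<^sup>2)\<^sup>2 / 16)"
      unfolding e by (simp flip: exp_add)
    also have "\<dots> \<le> N * ((\<kappa>\<^sup>2)\<^sup>2 / 16)" using N0 by (intro mult_right_mono) auto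
    finally have "exp (- (N * ((\<kappa>\<^sup>2)\<^sup>2 / 16))) \<le> exp (- (exp (real j * t) / 16))" by simp
    then show "exp (- (N * ((\<kappa>\<^sup>2)\<^sup>2 / 16))) \<le> \<kappa>" using j(4) by (simp add: \<kappa>_def)
    have "N * (4 * pi / (Q * \<kappa>\<^sup>2))\<^sup>2 \<le> (exp (5 * (real j * t)) + 1) * (4 * pi / (Q * \<kappa>\<^sup>2))\<^sup>2"
      using N0 by (intro mult_right_mono) auto
    then show "N * (4 * pi / (Q * \<kappa>\<^sup>2))\<^sup>2 \<le> \<kappa>" using j(5) unfolding \<kappa>_def Q_def by linarith
    show "4 * K * \<kappa> \<le> 1" using j(6) by (simp add: K_def \<kappa>_def)
  qed
  have \<kappa>t: "exp (- t / 2) \<le> 1 - \<kappa>\<^sup>2" "1 + \<kappa>\<^sup>2 \<le> exp t" using j(7,8) by (simp_all add: \<kappa>_def)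
  have absorb: "2 * (1 + C1) * (G + 1) * (20 * \<kappa>) powr r \<le> 1 / 2"
    using j(9) by (simp add: G_def \<kappa>_def add_ac)
  define C where "C = 2 * (C1 + 2 * (1 + C1) * (G + 1) * C0)"
  have C0: "0 \<le> C0" by (simp add: C0_def)
  show ?case
  proof (rule exI[of _ C], intro conjI allI impI)
    show "0 \<le> C" using C0 C1 by (simp add: C_def)
    fix F \<Psi> and A :: real
    assume g: "psh_functional r F \<Psi>" and F0: "0 \<notin> F" and win: "window_bounded (Suc k) t F"
      and A: "\<forall>u. cmod u = 1 \<longrightarrow> \<Psi> (\<lambda>k. u ^ k) \<le> A"
    have fF: "finite F" by (rule psh_finite[OF g])
    have Fpos: "0 < l" if "l \<in> F" for l using F0 that by (auto intro: gr0I)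
    have win': "card {l\<in>F. x \<le> real l \<and> real l \<le> exp (real m * t) * x} \<le> n * m" if "0 < x" "1 \<le> m" for x m
      using window_bounded_multiple[OF win fF that(1) Suc.prems, of m] that(2) by (simp add: n_def max_def)
    define B0 where "B0 = {\<mu>\<in>F. \<forall>l\<in>F. l < \<mu> \<longrightarrow> real l \<le> (1 - \<kappa>\<^sup>2) * \<mu>}"
    define F1 where "F1 = F - B0"
    have F1: "window_bounded k (t / 2) F1"
      unfolding window_bounded_def
    proof (intro allI impI)
      fix x :: real assume x: "0 < x"
      define W where "W = {l\<in>F1. x \<le> real l \<and> real l \<le> exp (t / 2) * x}"
      have fW: "finite W" using fF by (simp add: W_def F1_def)
      have "card W \<le> k"
      proof (cases "W = {}")
        case False
        define \<mu> where "\<mu> = Min W"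
        have "\<mu> \<in> W" using fW False by (simp add: \<mu>_def)
        then have \<mu>: "\<mu> \<in> F" "\<mu> \<notin> B0" "x \<le> real \<mu>" by (auto simp: W_def F1_def)
        then obtain l where l: "l \<in> F" "l < \<mu>" "(1 - \<kappa>\<^sup>2) * \<mu> < real l"
          by (auto simp: B0_def not_le)
        have "l \<notin> W" using l(2) Min_le[OF fW, of l] by (auto simp: \<mu>_def)
        have half: "exp (t / 2) * exp (- t / 2) = 1" "exp t = exp (t / 2) * exp (t / 2)"
          by (simp_all flip: exp_add)
        have "exp (- t / 2) * x \<le> (1 - \<kappa>\<^sup>2) * real \<mu>"
          using \<kappa>t \<mu> x order_trans[OF exp_ge_zero \<kappa>t(1)] by (intro mult_mono) auto
        then have lx: "exp (- t / 2) * x \<le> real l" using l by linarith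
        have ex: "exp t * (exp (- t / 2) * x) = exp (t / 2) * x"
          by (simp flip: exp_add mult.assoc)
        have "insert l W \<subseteq> {l\<in>F. exp (- t / 2) * x \<le> real l \<and> real l \<le> exp t * (exp (- t / 2) * x)}"
        proof -
          have "exp (- t / 2) * x \<le> 1 * x" using x Suc.prems by (intro mult_right_mono) auto
          moreover have "real l \<le> exp (t / 2) * x"
            using \<open>\<mu> \<in> W\<close> l(2) by (auto simp: W_def)
          ultimately show ?thesis using lx l(1) unfolding ex by (auto simp: W_def F1_def)
        qed
        then have "card (insert l W) \<le> card {l\<in>F. exp (- t / 2) * x \<le> real l \<and> real l \<le> exp t * (exp (- t / 2) * x)}"
          using fF by (intro card_mono) auto
        also have "\<dots> \<le> Suc k" using win x by (auto simp: window_bounded_def)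
        finally show ?thesis using \<open>l \<notin> W\<close> fW by simp
      qed simp
      then show "card {l\<in>F1. x \<le> real l \<and> real l \<le> exp (t / 2) * x} \<le> k" by (simp add: W_def)
    qed
    define conf where "conf = (\<lambda>\<nu> \<mu>. real \<mu> < Q * real \<nu> \<or>
       (\<exists>l\<in>F. \<mu> < l \<and> real l \<le> (1 + \<kappa>\<^sup>2) * \<mu> \<and> \<kappa>\<^sup>2 * \<nu> < real (l - \<mu>) \<and> \<kappa>\<^sup>2 * real (l - \<mu>) < \<nu>))"
    have comp: "card {\<nu>\<in>F. \<kappa>\<^sup>2 * \<nu> < d \<and> \<kappa>\<^sup>2 * d < \<nu>} \<le> n * (4 * j)" if "0 < d" for d :: real
    proof -
      have "{\<nu>\<in>F. \<kappa>\<^sup>2 * \<nu> < d \<and> \<kappa>\<^sup>2 * d < \<nu>} \<subseteq>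
          {\<nu>\<in>F. \<kappa>\<^sup>2 * d \<le> real \<nu> \<and> real \<nu> \<le> exp (real (4 * j) * t) * (\<kappa>\<^sup>2 * d)}"
      proof safe
        fix \<nu> assume \<nu>: "\<kappa>\<^sup>2 * real \<nu> < d"
        have e: "exp (2 * (real j * t)) * \<kappa>\<^sup>2 = 1" by (simp add: \<kappa>2 flip: exp_add)
        have e': "exp (real (4 * j) * t) * \<kappa>\<^sup>2 = exp (2 * (real j * t))"
          by (simp add: \<kappa>2 flip: exp_add)
        have "real \<nu> = exp (2 * (real j * t)) * (\<kappa>\<^sup>2 * real \<nu>)" using e by (metis mult.assoc mult_1)
        also have "\<dots> \<le> exp (2 * (real j * t)) * d" using \<nu> by (intro mult_left_mono) auto
        also have "\<dots> = exp (real (4 * j) * t) * (\<kappa>\<^sup>2 * d)" using e' by (metis mult.assoc)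
        finally show "real \<nu> \<le> exp (real (4 * j) * t) * (\<kappa>\<^sup>2 * d)" .
      qed auto
      then have "card {\<nu>\<in>F. \<kappa>\<^sup>2 * \<nu> < d \<and> \<kappa>\<^sup>2 * d < \<nu>} \<le>
          card {\<nu>\<in>F. \<kappa>\<^sup>2 * d \<le> real \<nu> \<and> real \<nu> \<le> exp (real (4 * j) * t) * (\<kappa>\<^sup>2 * d)}"
        using fF by (intro card_mono) auto
      also have "\<dots> \<le> n * (4 * j)" using that \<kappa>2 j(1) by (intro win') auto
      finally show ?thesis .
    qed
    have "card {\<nu>\<in>F. \<nu> < \<mu> \<and> conf \<nu> \<mu>} \<le> G" if \<mu>: "\<mu> \<in> F" for \<mu>
    proof -
      define L where "L = {l\<in>F. \<mu> < l \<and> real l \<le> (1 + \<kappa>\<^sup>2) * \<mu>}"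
      have \<mu>0: "0 < real \<mu>" using Fpos[OF \<mu>] by simp
      have cL: "card L \<le> n"
      proof -
        have "(1 + \<kappa>\<^sup>2) * \<mu> \<le> exp t * \<mu>" using \<kappa>t by (intro mult_right_mono) auto
        then have "card L \<le> card {l\<in>F. real \<mu> \<le> real l \<and> real l \<le> exp t * \<mu>}"
          using fF by (intro card_mono) (auto simp: L_def)
        also have "\<dots> \<le> n" using win \<mu>0 unfolding window_bounded_def n_def by blast
        finally show ?thesis .
      qed
      have "{\<nu>\<in>F. \<nu> < \<mu> \<and> conf \<nu> \<mu>} \<subseteq>
          {\<nu>\<in>F. \<mu> / Q \<le> real \<nu> \<and> real \<nu> \<le> exp (real (8 * j) * t) * (\<mu> / Q)} \<union>
          (\<Union>l\<in>L. {\<nu>\<in>F. \<kappa>\<^sup>2 * \<nu> < real (l - \<mu>) \<and> \<kappa>\<^sup>2 * real (l - \<mu>) < \<nu>})"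
        using Q by (auto simp: conf_def L_def Q_def field_simps)
      then have "card {\<nu>\<in>F. \<nu> < \<mu> \<and> conf \<nu> \<mu>} \<le>
          card ({\<nu>\<in>F. \<mu> / Q \<le> real \<nu> \<and> real \<nu> \<le> exp (real (8 * j) * t) * (\<mu> / Q)} \<union>
          (\<Union>l\<in>L. {\<nu>\<in>F. \<kappa>\<^sup>2 * \<nu> < real (l - \<mu>) \<and> \<kappa>\<^sup>2 * real (l - \<mu>) < \<nu>}))"
        using fF by (intro card_mono) (auto simp: L_def)
      also have "\<dots> \<le> card {\<nu>\<in>F. \<mu> / Q \<le> real \<nu> \<and> real \<nu> \<le> exp (real (8 * j) * t) * (\<mu> / Q)} +
          card (\<Union>l\<in>L. {\<nu>\<in>F. \<kappa>\<^sup>2 * \<nu> < real (l - \<mu>) \<and> \<kappa>\<^sup>2 * real (l - \<mu>) < \<nu>})"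
        by (rule card_Un_le)
      also have "card (\<Union>l\<in>L. {\<nu>\<in>F. \<kappa>\<^sup>2 * \<nu> < real (l - \<mu>) \<and> \<kappa>\<^sup>2 * real (l - \<mu>) < \<nu>}) \<le>
          (\<Sum>l\<in>L. card {\<nu>\<in>F. \<kappa>\<^sup>2 * \<nu> < real (l - \<mu>) \<and> \<kappa>\<^sup>2 * real (l - \<mu>) < \<nu>})"
        using fF by (intro card_UN_le) (auto simp: L_def)
      also have "\<dots> \<le> (\<Sum>l\<in>L. n * (4 * j))"
        by (intro sum_mono comp) (auto simp: L_def)
      also have "\<dots> \<le> n * (n * (4 * j))" using cL by simp
      also have "card {\<nu>\<in>F. \<mu> / Q \<le> real \<nu> \<and> real \<nu> \<le> exp (real (8 * j) * t) * (\<mu> / Q)} \<le> n * (8 * j)"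
        using \<mu>0 Q j(1) by (intro win') auto
      finally show ?thesis by (simp add: G_def)
    qed
    from greedy_coloring[OF fF this] obtain col :: "nat \<Rightarrow> nat" where col: "\<And>m. m \<in> F \<Longrightarrow> col m \<le> G"
      "\<And>m n. m \<in> F \<Longrightarrow> n \<in> F \<Longrightarrow> n < m \<Longrightarrow> conf n m \<Longrightarrow> col n \<noteq> col m" by blast
    define B where "B = psh_bound F \<Psi>"
    have B: "0 \<le> B" unfolding B_def by (rule psh_bound_nonneg[OF g])
    have A0: "0 \<le> A" using A psh_nonneg[OF g] by (meson norm_one order_trans)
    define Z where "Z = 2 * (G + 1) * (C0 * A + (20 * \<kappa>) powr r * B)"
    have cls: "\<Psi> (\<lambda>l. of_bool (l \<in> {\<mu>\<in>B0. col \<mu> = i}) * b l) \<le> 2 * (C0 * A + (20 * \<kappa>) powr r * B)"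
      if b: "\<And>l. l \<in> F \<Longrightarrow> cmod (b l) \<le> 1" for b i
      unfolding C0_def B_def
    proof (rule lacunary_class_bound[OF g _ F0 _ \<kappa> Q])
      show "\<And>u. cmod u = 1 \<Longrightarrow> \<Psi> (\<lambda>k. u ^ k) \<le> A" using A by blast
      show "{\<mu>\<in>B0. col \<mu> = i} \<subseteq> F" by (auto simp: B0_def)
      fix \<mu> assume \<mu>: "\<mu> \<in> {\<mu>\<in>B0. col \<mu> = i}"
      then have \<mu>F: "\<mu> \<in> F" "col \<mu> = i" by (auto simp: B0_def)
      show "cmod (b \<mu>) \<le> 1" using b \<mu>F by blast
      show "real l \<le> (1 - \<kappa>\<^sup>2) * \<mu>" if "l \<in> F" "l < \<mu>" for l using that \<mu> by (auto simp: B0_def)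
      show "card {l\<in>F. \<kappa>\<^sup>2 * \<mu> < l \<and> \<kappa>\<^sup>2 * l < \<mu>} \<le> K"
        using comp[of "real \<mu>"] Fpos[OF \<mu>F(1)] by (simp add: K_def conj_commute)
      fix \<nu> assume \<nu>: "\<nu> \<in> {\<mu>\<in>B0. col \<mu> = i}"
      then have \<nu>F: "\<nu> \<in> F" "col \<nu> = i" by (auto simp: B0_def)
      have nc: "\<not> conf \<nu> \<mu>" if "\<nu> < \<mu>"
        using col(2)[OF \<mu>F(1) \<nu>F(1) that] \<mu>F(2) \<nu>F(2) by metis
      show "Q * real \<nu> \<le> real \<mu>" if "\<nu> < \<mu>"
        using nc[OF that] unfolding conf_def de_Morgan_disj by linarith
      show "real (l - \<mu>) \<le> \<kappa>\<^sup>2 * \<nu> \<or> real \<nu> \<le> \<kappa>\<^sup>2 * real (l - \<mu>)"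
        if l: "l \<in> F" "\<mu> < l" "real l \<le> (1 + \<kappa>\<^sup>2) * \<mu>" for l
      proof (cases "\<nu> < \<mu>")
        case True
        have "\<not> (\<kappa>\<^sup>2 * \<nu> < real (l - \<mu>) \<and> \<kappa>\<^sup>2 * real (l - \<mu>) < \<nu>)"
          using nc[OF True] l unfolding conf_def by blast
        then show ?thesis by linarith
      next
        case False
        have "real (l - \<mu>) \<le> \<kappa>\<^sup>2 * \<mu>" using l by (simp add: algebra_simps of_nat_diff)
        also have "\<dots> \<le> \<kappa>\<^sup>2 * \<nu>" using False by (intro mult_left_mono) auto
        finally show ?thesis by simp
      qed
    qed (use N in auto)
    have bot: "\<Psi> (\<lambda>l. of_bool (l \<in> B0) * b l) \<le> Z" if b: "\<And>l. l \<in> F \<Longrightarrow> cmod (b l) \<le> 1" for b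
    proof -
      have "\<Psi> (\<lambda>l. of_bool (l \<in> B0) * b l) = \<Psi> (\<lambda>l. \<Sum>i\<le>G. of_bool (l \<in> {\<mu>\<in>B0. col \<mu> = i}) * b l)"
      proof (rule psh_cong[OF g])
        fix l assume "l \<in> F"
        then have "(\<Sum>i\<le>G. of_bool (l \<in> {\<mu>\<in>B0. col \<mu> = i}) :: complex) = of_bool (l \<in> B0)"
          using col(1)[of l] by (auto simp: of_bool_def sum.delta)
        then show "of_bool (l \<in> B0) * b l = (\<Sum>i\<le>G. of_bool (l \<in> {\<mu>\<in>B0. col \<mu> = i}) * b l)"
          by (simp only: sum_distrib_right[symmetric])
      qed
      also have "\<dots> \<le> (\<Sum>i\<le>G. \<Psi> (\<lambda>l. of_bool (l \<in> {\<mu>\<in>B0. col \<mu> = i}) * b l))"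
        by (rule psh_sum[OF g]) simp
      also have "\<dots> \<le> (\<Sum>i\<le>G. 2 * (C0 * A + (20 * \<kappa>) powr r * B))"
        by (intro sum_mono cls b)
      also have "\<dots> = Z" by (simp add: Z_def algebra_simps)
      finally show ?thesis .
    qed
    have split: "\<Psi> m \<le> \<Psi> (\<lambda>l. of_bool (l \<in> B0) * m l) + \<Psi> (\<lambda>l. of_bool (l \<in> F1) * m l)" for m
    proof -
      have "\<Psi> m = \<Psi> (\<lambda>l. of_bool (l \<in> B0) * m l + of_bool (l \<in> F1) * m l)"
        by (rule psh_cong[OF g]) (auto simp: F1_def)
      then show ?thesis using psh_add[OF g] by simp
    qed
    have g1: "psh_functional r F1 (\<lambda>m. \<Psi> (\<lambda>l. of_bool (l \<in> F1) * m l))"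
      by (rule psh_restrict[OF g]) (auto simp: F1_def)
    have "psh_bound F1 (\<lambda>m. \<Psi> (\<lambda>l. of_bool (l \<in> F1) * m l)) \<le> C1 * (A + Z)"
    proof (rule IH[OF g1 _ F1])
      show "0 \<notin> F1" using F0 by (simp add: F1_def)
      fix u :: complex assume u: "cmod u = 1"
      have "\<Psi> (\<lambda>l. of_bool (l \<in> F1) * u ^ l) = \<Psi> (\<lambda>l. u ^ l + of_bool (l \<in> B0) * (- (u ^ l)))"
        by (rule psh_cong[OF g]) (auto simp: F1_def)
      also have "\<dots> \<le> \<Psi> (\<lambda>l. u ^ l) + \<Psi> (\<lambda>l. of_bool (l \<in> B0) * (- (u ^ l)))"
        by (rule psh_add[OF g])
      also have "\<dots> \<le> A + Z" using A u by (intro add_mono bot) (auto simp: norm_power)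
      finally show "\<Psi> (\<lambda>l. of_bool (l \<in> F1) * u ^ l) \<le> A + Z" .
    qed
    note rest = this
    have "B \<le> Z + C1 * (A + Z)"
      unfolding B_def
    proof (rule psh_bound_le)
      fix m :: "nat \<Rightarrow> complex" assume m: "\<forall>k\<in>F. cmod (m k) \<le> 1"
      have "\<Psi> (\<lambda>l. of_bool (l \<in> F1) * m l) \<le> 1 powr r * psh_bound F1 (\<lambda>m. \<Psi> (\<lambda>l. of_bool (l \<in> F1) * m l))"
        by (rule psh_le_bound[OF g1]) (use m in \<open>auto simp: F1_def\<close>)
      then have "\<Psi> (\<lambda>l. of_bool (l \<in> F1) * m l) \<le> C1 * (A + Z)" using rest by simp
      then show "\<Psi> m \<le> Z + C1 * (A + Z)" using split[of m] bot[of m] m by fastforce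
    qed
    also have "\<dots> = C1 * A + 2 * (1 + C1) * (G + 1) * C0 * A + (2 * (1 + C1) * (G + 1) * (20 * \<kappa>) powr r) * B"
      by (simp add: Z_def algebra_simps)
    also have "\<dots> \<le> C1 * A + 2 * (1 + C1) * (G + 1) * C0 * A + 1 / 2 * B"
      using absorb B by (intro add_left_mono mult_right_mono) auto
    finally have "B \<le> 2 * (C1 * A + 2 * (1 + C1) * (G + 1) * C0 * A)" by simp
    then show "psh_bound F \<Psi> \<le> C * A" by (simp add: B_def C_def algebra_simps)
  qed
qed

section \<open>Quasinorms, the circle and the Cantor group\<close>

lemma polynomial_regroup:
  fixes smul :: "complex \<Rightarrow> 'a::ab_group_add \<Rightarrow> 'a"
  assumes vs: "vector_space smul" and F: "finite F"
  obtains m y where "\<And>Z. (\<Sum>k\<in>F. smul (c k + b k * Z ^ e k) (x k)) = (\<Sum>j\<le>m. smul (Z ^ j) (y j))"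
proof -
  interpret vector_space smul by (rule vs)
  define m where "m = (\<Sum>k\<in>F. e k)"
  have em: "e k \<le> m" if "k \<in> F" for k
    unfolding m_def using that F by (intro member_le_sum) auto
  define y where "y = (\<lambda>j. (if j = 0 then \<Sum>k\<in>F. smul (c k) (x k) else 0) +
      (\<Sum>k\<in>F. if e k = j then smul (b k) (x k) else 0))"
  have "(\<Sum>k\<in>F. smul (c k + b k * Z ^ e k) (x k)) = (\<Sum>j\<le>m. smul (Z ^ j) (y j))" for Z
  proof -
    have "(\<Sum>j\<le>m. smul (Z ^ j) (y j)) =
        (\<Sum>j\<le>m. if j = 0 then \<Sum>k\<in>F. smul (c k) (x k) else 0) +
        (\<Sum>j\<le>m. \<Sum>k\<in>F. if e k = j then smul (b k * Z ^ e k) (x k) else 0)"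
      unfolding y_def sum.distrib[symmetric]
      by (intro sum.cong refl) (auto simp: scale_right_distrib scale_sum_right mult.commute if_distrib cong: if_cong intro!: sum.cong)
    also have "(\<Sum>j\<le>m. \<Sum>k\<in>F. if e k = j then smul (b k * Z ^ e k) (x k) else 0) =
        (\<Sum>k\<in>F. \<Sum>j\<le>m. if e k = j then smul (b k * Z ^ e k) (x k) else 0)"
      by (rule sum.swap)
    also have "\<dots> = (\<Sum>k\<in>F. smul (b k * Z ^ e k) (x k))"
      using em by (intro sum.cong refl) (simp add: sum.delta)
    also have "(\<Sum>j\<le>m. if j = 0 then \<Sum>k\<in>F. smul (c k) (x k) else 0) = (\<Sum>k\<in>F. smul (c k) (x k))"
      by (simp add: sum.delta)
    finally show ?thesis by (simp add: scale_left_distrib sum.distrib)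
  qed
  then show ?thesis by (rule that)
qed

lemma psh_functional_quasinorm:
  fixes smul :: "complex \<Rightarrow> 'a::ab_group_add \<Rightarrow> 'a"
  assumes vs: "vector_space smul" and q: "quasinorm smul N" and psh: "plurisubharmonic smul N"
    and r: "0 < r" "r < 1" and tri: "\<And>x y. N (x + y) powr r \<le> N x powr r + N y powr r"
    and F: "finite F"
  shows "psh_functional r F (\<lambda>m. N (\<Sum>k\<in>F. smul (m k) (x k)) powr r)"
  unfolding psh_functional_def
proof (intro conjI allI impI)
  interpret vector_space smul by (rule vs)
  have N0: "\<And>x. 0 \<le> N x" and hom: "\<And>a x. N (smul a x) = cmod a * N x"
    using q unfolding quasinorm_def by blast+
  show "0 < r" "r < 1" "finite F" by fact+
  fix m m' :: "nat \<Rightarrow> complex"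
  show "0 \<le> N (\<Sum>k\<in>F. smul (m k) (x k)) powr r" by simp
  show "N (\<Sum>k\<in>F. smul (m k + m' k) (x k)) powr r \<le>
      N (\<Sum>k\<in>F. smul (m k) (x k)) powr r + N (\<Sum>k\<in>F. smul (m' k) (x k)) powr r"
    unfolding scale_left_distrib sum.distrib by (rule tri)
  fix c
  have "(\<Sum>k\<in>F. smul (c * m k) (x k)) = smul c (\<Sum>k\<in>F. smul (m k) (x k))"
    by (simp add: scale_sum_right)
  then show "N (\<Sum>k\<in>F. smul (c * m k) (x k)) powr r = cmod c powr r * N (\<Sum>k\<in>F. smul (m k) (x k)) powr r"
    by (simp add: hom powr_mult N0)
next
  fix m m' :: "nat \<Rightarrow> complex" assume "\<forall>k\<in>F. m k = m' k"
  then show "N (\<Sum>k\<in>F. smul (m k) (x k)) powr r = N (\<Sum>k\<in>F. smul (m' k) (x k)) powr r"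
    by (auto cong: sum.cong)
next
  fix V b :: "nat \<Rightarrow> complex" and e and \<rho> :: real assume \<rho>: "0 \<le> \<rho>" "\<rho> \<le> 1"
  have N0: "\<And>x. 0 \<le> N x" using q unfolding quasinorm_def by blast
  define f where "f = (\<lambda>Z. \<Sum>k\<in>F. smul (V k + b k * (Z ^ e k - complex_of_real \<rho> ^ e k)) (x k))"
  obtain m y where y: "\<And>Z. (\<Sum>k\<in>F. smul ((V k - b k * complex_of_real \<rho> ^ e k) + b k * Z ^ e k) (x k)) =
      (\<Sum>j\<le>m. smul (Z ^ j) (y j))"
    using polynomial_regroup[OF vs F, of "\<lambda>k. V k - b k * complex_of_real \<rho> ^ e k" b e x] by metis
  have f_y: "f Z = (\<Sum>j\<le>m. smul (Z ^ j) (y j))" for Z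
    unfolding f_def y[symmetric] by (simp add: algebra_simps)
  have "continuous_on (sphere 0 1) (\<lambda>Z. N (f Z))"
    unfolding f_y by (intro quasinorm_sum_continuous[OF vs q] continuous_intros) auto
  moreover have "compact (sphere (0::complex) 1)" "sphere (0::complex) 1 \<noteq> {}" by auto
  ultimately obtain Z where Z: "Z \<in> sphere 0 1" "\<And>Z'. Z' \<in> sphere 0 1 \<Longrightarrow> N (f Z') \<le> N (f Z)"
    using continuous_attains_sup by metis
  have "N (f \<rho>) \<le> N (f Z)"
    unfolding f_y[of "complex_of_real \<rho>"]
    by (rule psh_maximum_principle[OF vs q psh]) (use Z \<rho> in \<open>auto simp flip: f_y\<close>)
  moreover have "f \<rho> = (\<Sum>k\<in>F. smul (V k) (x k))" by (simp add: f_def)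
  ultimately have "N (\<Sum>k\<in>F. smul (V k) (x k)) powr r \<le> N (f Z) powr r"
    using N0 r by (intro powr_mono2) auto
  then show "\<exists>Z. cmod Z = 1 \<and> N (\<Sum>k\<in>F. smul (V k) (x k)) powr r \<le>
      N (\<Sum>k\<in>F. smul (V k + b k * (Z ^ e k - complex_of_real \<rho> ^ e k)) (x k)) powr r"
    using Z(1) by (auto simp: f_def)
qed

text \<open>
  For real coefficients \<open>t\<^sub>k \<in> [-1, 1]\<close> write \<open>t = (e + t') / 2\<close> with signs \<open>e\<^sub>k\<close> and \<open>t'\<^sub>k \<in> [-1, 1]\<close>. The
  supremum \<open>B\<close> of the \<open>r\<close>-th powers therefore satisfies \<open>B \<le> 2\<^bsup>-r\<^esup> (s\<^sup>r + B)\<close>, and \<open>B\<close> can be absorbed because it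
  is finite. This is the step \<open>t \<mapsto> t'\<close> of the binary expansion. Real and imaginary parts give the complex case.
\<close>

lemma unimodular_le_signs:
  fixes smul :: "complex \<Rightarrow> 'a::ab_group_add \<Rightarrow> 'a"
  assumes vs: "vector_space smul" and q: "quasinorm smul N"
  shows "\<exists>K>0. \<forall>(n::nat) x s a.
    (\<forall>\<epsilon>. (\<forall>k. \<epsilon> k \<in> {-1, 1}) \<longrightarrow> N (\<Sum>k<n. smul (\<epsilon> k) (x k)) \<le> s) \<longrightarrow>
    (\<forall>k<n. cmod (a k) \<le> 1) \<longrightarrow> N (\<Sum>k<n. smul (a k) (x k)) \<le> K * s"
proof -
  interpret vector_space smul by (rule vs)
  obtain r where r: "0 < r" "r < 1" and tri: "\<And>x y. N (x + y) powr r \<le> N x powr r + N y powr r"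
    using q unfolding quasinorm_def by blast
  have N0: "\<And>x. 0 \<le> N x" "N 0 = 0" and hom: "\<And>a x. N (smul a x) = cmod a * N x"
    using q unfolding quasinorm_def by blast+
  have r2: "1 < (2::real) powr r" using r by (simp add: gr_one_powr)
  define K where "K = (2 / (2 powr r - 1)) powr (1 / r)"
  have K: "0 < K" using r2 r by (simp add: K_def)
  show ?thesis
  proof (rule exI[of _ K], intro conjI K allI impI)
    fix n :: nat and x s and a :: "nat \<Rightarrow> complex"
    assume s': "\<forall>\<epsilon>. (\<forall>k. \<epsilon> k \<in> {-1, 1}) \<longrightarrow> N (\<Sum>k<n. smul (\<epsilon> k) (x k)) \<le> s"
      and a': "\<forall>k<n. cmod (a k) \<le> 1"
    note s = s'[rule_format] and a = a'[rule_format]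
    have s0: "0 \<le> s" using s[of "\<lambda>_. 1"] N0 by (auto intro: order_trans)
    define T where "T = {t :: nat \<Rightarrow> real. \<forall>k<n. \<bar>t k\<bar> \<le> 1}"
    define g where "g = (\<lambda>t :: nat \<Rightarrow> real. N (\<Sum>k<n. smul (of_real (t k)) (x k)) powr r)"
    have bdd: "bdd_above (g ` T)"
    proof (rule bdd_aboveI2)
      fix t assume t: "t \<in> T"
      have "g t \<le> (\<Sum>k<n. N (smul (of_real (t k)) (x k)) powr r)"
        unfolding g_def by (rule sum_powr_le[OF N0 tri]) simp
      also have "\<dots> \<le> (\<Sum>k<n. N (x k) powr r)"
      proof (rule sum_mono)
        fix k assume "k \<in> {..<n}"
        then have "\<bar>t k\<bar> * N (x k) \<le> 1 * N (x k)" using t N0 by (intro mult_right_mono) (auto simp: T_def)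
        then show "N (smul (of_real (t k)) (x k)) powr r \<le> N (x k) powr r"
          using r N0 by (intro powr_mono2) (auto simp: hom)
      qed
      finally show "g t \<le> (\<Sum>k<n. N (x k) powr r)" .
    qed
    define B where "B = Sup (g ` T)"
    have gB: "g t \<le> B" if "t \<in> T" for t unfolding B_def using that bdd by (intro cSup_upper) auto
    have step: "g t \<le> (1 / 2) powr r * (s powr r + B)" if t: "t \<in> T" for t
    proof -
      define e where "e = (\<lambda>k. if 0 \<le> t k then 1 else - 1 :: real)"
      define t' where "t' = (\<lambda>k. 2 * t k - e k)"
      have t': "t' \<in> T" using t by (auto simp: T_def t'_def e_def abs_le_iff)
      have "(\<Sum>k<n. smul (of_real (t k)) (x k)) =
          smul (1 / 2) ((\<Sum>k<n. smul (of_real (e k)) (x k)) + (\<Sum>k<n. smul (of_real (t' k)) (x k)))"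
        unfolding sum.distrib[symmetric] scale_left_distrib[symmetric] scale_sum_right
        by (intro sum.cong refl) (simp add: t'_def)
      then have "g t = (1 / 2) powr r * N ((\<Sum>k<n. smul (of_real (e k)) (x k)) + (\<Sum>k<n. smul (of_real (t' k)) (x k))) powr r"
        by (simp add: g_def hom powr_mult N0 powr_divide)
      also have "\<dots> \<le> (1 / 2) powr r * (N (\<Sum>k<n. smul (of_real (e k)) (x k)) powr r + g t')"
        unfolding g_def by (intro mult_left_mono tri) auto
      also have "\<dots> \<le> (1 / 2) powr r * (s powr r + B)"
        using r N0 by (intro mult_left_mono add_mono powr_mono2 gB t' s) (auto simp: e_def)
      finally show ?thesis .
    qed
    have "Sup (g ` T) \<le> (1 / 2) powr r * (s powr r + B)"
    proof (rule cSup_least)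
      have "(\<lambda>_. 0) \<in> T" by (simp add: T_def)
      then show "g ` T \<noteq> {}" by blast
      fix v assume "v \<in> g ` T"
      then show "v \<le> (1 / 2) powr r * (s powr r + B)" using step by blast
    qed
    then have "B \<le> (1 / 2) powr r * (s powr r + B)" unfolding B_def[symmetric] .
    then have "2 powr r * B \<le> s powr r + B"
      by (simp add: powr_divide field_simps)
    then have B: "B \<le> s powr r / (2 powr r - 1)" using r2 by (simp add: field_simps)
    have "(\<Sum>k<n. smul (a k) (x k)) = (\<Sum>k<n. smul (of_real (Re (a k))) (x k)) + smul \<i> (\<Sum>k<n. smul (of_real (Im (a k))) (x k))"
      unfolding scale_sum_right sum.distrib[symmetric] scale_scale scale_left_distrib[symmetric]
      by (intro sum.cong refl arg_cong2[where f = smul]) (rule complex_eq)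
    then have "N (\<Sum>k<n. smul (a k) (x k)) powr r \<le>
        g (\<lambda>k. Re (a k)) + N (smul \<i> (\<Sum>k<n. smul (of_real (Im (a k))) (x k))) powr r"
      unfolding g_def by (simp only: tri)
    also have "\<dots> = g (\<lambda>k. Re (a k)) + g (\<lambda>k. Im (a k))" by (simp add: g_def hom)
    also have "\<dots> \<le> B + B"
      using a abs_Re_le_cmod abs_Im_le_cmod by (intro add_mono gB) (auto simp: T_def intro: order_trans)
    also have "\<dots> \<le> 2 / (2 powr r - 1) * s powr r" using B by simp
    finally have "(N (\<Sum>k<n. smul (a k) (x k)) powr r) powr (1 / r) \<le> (2 / (2 powr r - 1) * s powr r) powr (1 / r)"
      using r by (intro powr_mono2) auto
    also have "\<dots> = K * (s powr r) powr (1 / r)"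
      unfolding K_def by (rule powr_mult)
    also have "(s powr r) powr (1 / r) = s" using r s0 by (simp add: powr_powr)
    finally show "N (\<Sum>k<n. smul (a k) (x k)) \<le> K * s"
      using r N0 by (simp add: powr_powr)
  qed
qed

text \<open>
  A sum over finitely many coordinates is constant on cylinders of positive measure, so the essential
  supremum is a maximum over all choices of signs.
\<close>

lemma cantor_sup_norm:
  fixes smul :: "complex \<Rightarrow> 'a::ab_group_add \<Rightarrow> 'a"
  assumes vs: "vector_space smul" and q: "quasinorm smul N"
  shows "(\<And>\<epsilon>. (\<And>k. \<epsilon> k \<in> {-1, 1}) \<Longrightarrow> ereal (N (\<Sum>k<n. smul (\<epsilon> k) (x k))) \<le> S) \<Longrightarrow>
      sup_norm cantor_haar N (\<lambda>t. \<Sum>k<n. smul (t k) (x k)) \<le> S"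
    and "(\<And>k. \<epsilon> k \<in> {-1, 1}) \<Longrightarrow>
      ereal (N (\<Sum>k<n. smul (\<epsilon> k) (x k))) \<le> sup_norm cantor_haar N (\<lambda>t. \<Sum>k<n. smul (t k) (x k))"
proof -
  let ?M = "\<lambda>k::nat. uniform_count_measure {-1, 1::complex}"
  have P: "prob_space (uniform_count_measure {-1, 1::complex})"
    by (rule prob_space_uniform_count_measure) auto
  interpret product_prob_space ?M UNIV
    using P by (simp add: product_prob_space_def product_prob_space_axioms_def product_sigma_finite_def prob_space_imp_sigma_finite)
  have sp: "space cantor_haar = {t. \<forall>k. t k \<in> {-1, 1}}"
    by (auto simp: cantor_haar_def space_PiM space_uniform_count_measure PiE_def Pi_def)
  have meas: "(\<lambda>t. ereal (N (\<Sum>k<n. smul (t k) (x k)))) \<in> borel_measurable cantor_haar"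
  proof -
    have "(\<lambda>t. t k) \<in> borel_measurable cantor_haar" for k
    proof -
      have "(\<lambda>t. t k) \<in> cantor_haar \<rightarrow>\<^sub>M uniform_count_measure {-1, 1::complex}"
        unfolding cantor_haar_def by (rule measurable_component_singleton) simp
      moreover have "(\<lambda>z. z) \<in> uniform_count_measure {-1, 1::complex} \<rightarrow>\<^sub>M borel"
        by (simp add: measurable_cong_sets[OF sets_uniform_count_measure_count_space refl])
      ultimately show ?thesis by (rule measurable_compose)
    qed
    then have "(\<lambda>t. t) \<in> borel_measurable cantor_haar"
      by (intro measurable_coordinatewise_then_product)
    moreover have "(\<lambda>t. N (\<Sum>k\<in>{..<n}. smul (t k) (x k))) \<in> borel_measurable borel"
      by (intro borel_measurable_continuous_onI quasinorm_sum_continuous[OF vs q] continuous_on_product_coordinates) auto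
    ultimately have "(\<lambda>t. N (\<Sum>k\<in>{..<n}. smul (t k) (x k))) \<in> borel_measurable cantor_haar"
      by (rule measurable_compose)
    then show ?thesis by simp
  qed
  show "sup_norm cantor_haar N (\<lambda>t. \<Sum>k<n. smul (t k) (x k)) \<le> S"
    if "\<And>\<epsilon>. (\<And>k. \<epsilon> k \<in> {-1, 1}) \<Longrightarrow> ereal (N (\<Sum>k<n. smul (\<epsilon> k) (x k))) \<le> S"
    unfolding sup_norm_def by (intro esssup_I meas AE_I2 that) (auto simp: sp)
  show "ereal (N (\<Sum>k<n. smul (\<epsilon> k) (x k))) \<le> sup_norm cantor_haar N (\<lambda>t. \<Sum>k<n. smul (t k) (x k))"
    if \<epsilon>: "\<And>k. \<epsilon> k \<in> {-1, 1}"
  proof -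
    let ?C = "{t \<in> space cantor_haar. \<forall>k\<in>{..<n}. t k \<in> {\<epsilon> k}}"
    have "emeasure cantor_haar ?C = (\<Prod>k<n. emeasure (?M k) {\<epsilon> k})"
      unfolding cantor_haar_def
      using \<epsilon> by (intro emeasure_PiM_Collect) (auto simp: sets_uniform_count_measure)
    also have "\<dots> \<noteq> 0"
      using \<epsilon> by (auto simp: emeasure_uniform_count_measure)
    finally have pos: "emeasure cantor_haar ?C \<noteq> 0" .
    have "AE t in cantor_haar. ereal (N (\<Sum>k<n. smul (t k) (x k))) \<le> sup_norm cantor_haar N (\<lambda>t. \<Sum>k<n. smul (t k) (x k))"
      unfolding sup_norm_def by (rule esssup_AE)
    moreover have "\<not> (AE t in cantor_haar. t \<notin> ?C)"
    proof
      assume ae: "AE t in cantor_haar. t \<notin> ?C"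
      have C: "?C \<in> sets cantor_haar"
      proof (rule ccontr)
        assume "?C \<notin> sets cantor_haar"
        then have "emeasure cantor_haar ?C = 0" by (rule emeasure_notin_sets)
        with pos show False by contradiction
      qed
      have "{t \<in> space cantor_haar. \<not> t \<notin> ?C} = ?C" by blast
      from iffD1[OF AE_iff_measurable[OF C this] ae] have "emeasure cantor_haar ?C = 0" .
      with pos show False by contradiction
    qed
    ultimately obtain t where "t \<in> ?C"
      "ereal (N (\<Sum>k<n. smul (t k) (x k))) \<le> sup_norm cantor_haar N (\<lambda>t. \<Sum>k<n. smul (t k) (x k))"
      by (metis (mono_tags, lifting) eventually_mono)
    then show ?thesis by simp
  qed
qed

text \<open>
  A continuous function that exceeds its essential supremum at a point does so on an arc. The arc is taken to
  the right of the point in order to stay inside \<open>[0, 2\<pi>)\<close>.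
\<close>

lemma circle_sup_norm:
  fixes smul :: "complex \<Rightarrow> 'a::ab_group_add \<Rightarrow> 'a" and f :: "complex \<Rightarrow> 'a"
  assumes cont: "continuous_on (sphere 0 1) (\<lambda>z. N (f z))"
  shows "(\<And>z. cmod z = 1 \<Longrightarrow> ereal (N (f z)) \<le> S) \<Longrightarrow> sup_norm circle_haar N f \<le> S"
    and "cmod z = 1 \<Longrightarrow> ereal (N (f z)) \<le> sup_norm circle_haar N f"
proof -
  have cis: "cis \<in> uniform_measure lborel {0..<2 * pi} \<rightarrow>\<^sub>M restrict_space borel (sphere 0 1)"
  proof (rule measurable_restrict_space2)
    have "cis \<in> borel_measurable borel" by (intro borel_measurable_continuous_onI continuous_intros)
    then show "cis \<in> uniform_measure lborel {0..<2 * pi} \<rightarrow>\<^sub>M borel" by simp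
  qed auto
  have sp: "space circle_haar = sphere 0 1" by (simp add: circle_haar_def space_restrict_space)
  have measN: "(\<lambda>z. ereal (N (f z))) \<in> borel_measurable (restrict_space borel (sphere 0 1))"
    using borel_measurable_continuous_on_restrict[OF cont] by simp
  then have meas: "(\<lambda>z. ereal (N (f z))) \<in> borel_measurable circle_haar"
    by (simp add: circle_haar_def)
  show "sup_norm circle_haar N f \<le> S" if "\<And>z. cmod z = 1 \<Longrightarrow> ereal (N (f z)) \<le> S"
    unfolding sup_norm_def by (intro esssup_I meas AE_I2 that) (auto simp: sp)
  show "ereal (N (f z)) \<le> sup_norm circle_haar N f" if z: "cmod z = 1"
  proof (rule ccontr)
    define S where "S = sup_norm circle_haar N f"
    assume "\<not> ereal (N (f z)) \<le> sup_norm circle_haar N f"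
    then have zS: "S < ereal (N (f z))" by (simp add: S_def)
    have "AE w in circle_haar. ereal (N (f w)) \<le> S" unfolding S_def sup_norm_def by (rule esssup_AE)
    moreover have "{w \<in> space (restrict_space borel (sphere 0 1)). ereal (N (f w)) \<le> S}
        \<in> sets (restrict_space borel (sphere 0 1))"
      by (rule borel_measurable_le[OF measN borel_measurable_const])
    ultimately have "AE \<theta> in uniform_measure lborel {0..<2 * pi}. ereal (N (f (cis \<theta>))) \<le> S"
      unfolding circle_haar_def by (subst (asm) AE_distr_iff[OF cis]) auto
    then have ae: "AE \<theta> in lborel. \<theta> \<in> {0..<2 * pi} \<longrightarrow> ereal (N (f (cis \<theta>))) \<le> S"
      by (subst (asm) AE_uniform_measure) auto
    obtain \<theta>0 where \<theta>0: "0 \<le> \<theta>0" "\<theta>0 < 2 * pi" "z = cis \<theta>0"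
    proof -
      have "z = cis (Arg2pi z)" using Arg2pi_eq[of z] z by (simp add: cis_conv_exp)
      then show ?thesis using that Arg2pi_ge_0 Arg2pi_lt_2pi by blast
    qed
    have "continuous_on UNIV (\<lambda>\<theta>. N (f (cis \<theta>)))"
      by (rule continuous_on_compose2[OF cont]) (auto intro!: continuous_intros)
    then have "isCont (\<lambda>\<theta>. N (f (cis \<theta>))) \<theta>0" by (simp add: continuous_on_eq_continuous_at)
    from tendsto_mono[OF at_le[OF subset_UNIV] isContD[OF this]]
    have "((\<lambda>\<theta>. N (f (cis \<theta>))) \<longlongrightarrow> N (f (cis \<theta>0))) (at_right \<theta>0)" .
    then have "((\<lambda>\<theta>. ereal (N (f (cis \<theta>)))) \<longlongrightarrow> ereal (N (f (cis \<theta>0)))) (at_right \<theta>0)"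
      by (intro tendsto_ereal)
    then have "\<forall>\<^sub>F \<theta> in at_right \<theta>0. S < ereal (N (f (cis \<theta>)))"
      using zS \<theta>0 by (intro order_tendstoD) auto
    then obtain b where b: "\<theta>0 < b" "\<And>\<theta>. \<theta>0 < \<theta> \<Longrightarrow> \<theta> < b \<Longrightarrow> S < ereal (N (f (cis \<theta>)))"
      unfolding eventually_at_right_field by auto
    define d where "d = min b (2 * pi)"
    have "AE \<theta> in lborel. \<theta> \<notin> {\<theta>0<..<d}"
      using ae
    proof eventually_elim
      case (elim \<theta>)
      show ?case
      proof
        assume "\<theta> \<in> {\<theta>0<..<d}"
        then have "\<theta> \<in> {0..<2 * pi}" "S < ereal (N (f (cis \<theta>)))" using \<theta>0 b(2) by (auto simp: d_def)
        with elim show False by (simp add: leD)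
      qed
    qed
    moreover have "{\<theta> \<in> space lborel. \<not> \<theta> \<notin> {\<theta>0<..<d}} = {\<theta>0<..<d}" by auto
    ultimately have "emeasure lborel {\<theta>0<..<d} = 0"
      using AE_iff_measurable[of "{\<theta>0<..<d}" lborel "\<lambda>\<theta>. \<theta> \<notin> {\<theta>0<..<d}"] by simp
    then show False using b \<theta>0 by (auto simp: d_def min_def split: if_splits)
  qed
qed

section \<open>Finite unions of Hadamard sequences\<close>

lemma hadamard_growth:
  assumes "hadamard_gap_sequence l"
  shows "\<exists>q::real. 1 < q \<and> (\<forall>i. 0 < l i) \<and> (\<forall>i j. i < j \<longrightarrow> q * real (l i) \<le> real (l j))"
proof -
  obtain q :: real where q: "1 < q" and step: "\<And>k. q \<le> real (l (Suc k)) / real (l k)" and pos: "\<And>k. 0 < l k"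
    using assms unfolding hadamard_gap_sequence_def by blast
  have step': "q * real (l k) \<le> real (l (Suc k))" for k
    using step[of k] pos[of k] by (simp add: field_simps)
  have "q * real (l i) \<le> real (l (i + Suc d))" for i d
  proof (induction d)
    case 0
    then show ?case using step'[of i] by simp
  next
    case (Suc d)
    have "1 * real (l (i + Suc d)) \<le> q * real (l (i + Suc d))" using q by (intro mult_right_mono) auto
    also have "\<dots> \<le> real (l (Suc (i + Suc d)))" by (rule step')
    finally show ?case using Suc by simp
  qed
  then have "q * real (l i) \<le> real (l j)" if "i < j" for i j
    using less_imp_Suc_add[OF that] by auto
  with q pos show ?thesis by blast
qed

lemma hadamard_window:
  assumes l: "hadamard_gap_sequence l"
  shows "\<exists>t>0. \<forall>s x F. s \<le> t \<longrightarrow> 0 < x \<longrightarrow>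
    card {n\<in>F \<inter> range l. x \<le> real n \<and> real n \<le> exp s * x} \<le> 1"
proof -
  obtain q :: real where q': "1 < q" "\<forall>i. 0 < l i" "\<forall>i j. i < j \<longrightarrow> q * real (l i) \<le> real (l j)"
    using hadamard_growth[OF l] by (elim exE conjE) (rule that)
  note q = q'[rule_format]
  have t: "0 < ln q / 2" using q by simp
  show ?thesis
  proof (rule exI[of _ "ln q / 2"], intro conjI t allI impI)
    fix s x :: real and F assume s: "s \<le> ln q / 2" and x: "0 < x"
    have "ln q / 2 < ln q" using q by simp
    then have "exp s < exp (ln q)" using s by (subst exp_less_cancel_iff) linarith
    then have sq: "exp s < q" using q by simp
    have no: False if "x \<le> real (l i)" "real (l j) \<le> exp s * x" "i < j" for i j
    proof -
      have "exp s * x < q * x" using sq x by (intro mult_strict_right_mono)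
      also have "\<dots> \<le> q * real (l i)" using that q by (intro mult_left_mono) auto
      also have "\<dots> \<le> real (l j)" by (rule q(3)[OF that(3)])
      finally show False using that(2) by linarith
    qed
    let ?W = "{n\<in>F \<inter> range l. x \<le> real n \<and> real n \<le> exp s * x}"
    have eq: "a = b" if "a \<in> ?W" "b \<in> ?W" for a b
    proof -
      obtain i j where ij: "a = l i" "b = l j" using \<open>a \<in> ?W\<close> \<open>b \<in> ?W\<close> by auto
      have "\<not> i < j" "\<not> j < i" using no[of i j] no[of j i] that ij by auto
      then show ?thesis using ij by simp
    qed
    show "card ?W \<le> 1"
    proof (cases "?W = {}")
      case False
      then obtain a where "a \<in> ?W" by blast
      then have "?W \<subseteq> {a}" using eq by blast
      from card_mono[OF _ this] show ?thesis by simp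
    next
      case True
      show ?thesis unfolding True by simp
    qed
  qed
qed

text \<open>
  A window shorter than the logarithm of the smallest gap ratio meets each sequence at most once.
\<close>

lemma finite_union_window_bounded:
  assumes "finite_union_of_hadamard E"
  shows "\<exists>(t::real) k. 0 < t \<and> 0 \<notin> E \<and> (\<forall>F. F \<subseteq> E \<longrightarrow> window_bounded k t F)"
proof -
  obtain \<L> where L: "finite \<L>" "\<forall>l\<in>\<L>. hadamard_gap_sequence l" "E = (\<Union>l\<in>\<L>. range l)"
    using assms unfolding finite_union_of_hadamard_def by blast
  have "\<forall>l\<in>\<L>. \<exists>t>0. \<forall>s x F. s \<le> t \<longrightarrow> 0 < x \<longrightarrow> card {n\<in>F \<inter> range l. x \<le> real n \<and> real n \<le> exp s * x} \<le> 1"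
  proof
    fix l assume "l \<in> \<L>"
    with L(2) have "hadamard_gap_sequence l" by simp
    then show "\<exists>t>0. \<forall>s x F. s \<le> t \<longrightarrow> 0 < x \<longrightarrow> card {n\<in>F \<inter> range l. x \<le> real n \<and> real n \<le> exp s * x} \<le> 1"
      by (rule hadamard_window)
  qed
  from bchoice[OF this] obtain \<tau> where
    "\<forall>l\<in>\<L>. 0 < \<tau> l \<and> (\<forall>s x F. s \<le> \<tau> l \<longrightarrow> 0 < x \<longrightarrow> card {n\<in>F \<inter> range l. x \<le> real n \<and> real n \<le> exp s * x} \<le> 1)"
    by (elim exE) (rule that)
  then have \<tau>: "\<And>l. l \<in> \<L> \<Longrightarrow> 0 < \<tau> l"
    "\<And>l s x F. l \<in> \<L> \<Longrightarrow> s \<le> \<tau> l \<Longrightarrow> 0 < x \<Longrightarrow> card {n\<in>F \<inter> range l. x \<le> real n \<and> real n \<le> exp s * x} \<le> 1"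
    by simp_all
  define t where "t = Min (insert 1 (\<tau> ` \<L>))"
  have t: "0 < t" "\<And>l. l \<in> \<L> \<Longrightarrow> t \<le> \<tau> l" using \<tau>(1) L(1) by (auto simp: t_def)
  show ?thesis
  proof (rule exI[of _ t], rule exI[of _ "card \<L>"], intro conjI t(1) allI impI)
    show "0 \<notin> E"
    proof
      assume "0 \<in> E"
      then obtain l i where "l \<in> \<L>" "l i = 0" using L(3) by auto
      with L(2) show False unfolding hadamard_gap_sequence_def by (metis less_irrefl)
    qed
    fix F assume F: "F \<subseteq> E"
    show "window_bounded (card \<L>) t F"
      unfolding window_bounded_def
    proof (intro allI impI)
      fix x :: real assume x: "0 < x"
      have "\<exists>l\<in>\<L>. n \<in> range l" if "n \<in> F" for n using subsetD[OF F that] L(3) by auto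
      then have "{n\<in>F. x \<le> real n \<and> real n \<le> exp t * x} =
          (\<Union>l\<in>\<L>. {n\<in>F \<inter> range l. x \<le> real n \<and> real n \<le> exp t * x})"
        by blast
      then have "card {n\<in>F. x \<le> real n \<and> real n \<le> exp t * x} \<le>
          (\<Sum>l\<in>\<L>. card {n\<in>F \<inter> range l. x \<le> real n \<and> real n \<le> exp t * x})"
        using card_UN_le[OF L(1)] by simp
      also have "\<dots> \<le> (\<Sum>l\<in>\<L>. 1)"
        using t x by (intro sum_mono \<tau>) auto
      finally show "card {n\<in>F. x \<le> real n \<and> real n \<le> exp t * x} \<le> card \<L>" by simp
    qed
  qed
qed

text \<open>
  The upper estimate follows from \<open>unimodular_le_signs\<close> for the original quasinorm, because the values of
  characters are unimodular. The lower estimate is \<open>psh_bound_windows\<close> for the equivalent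
  plurisubharmonic quasinorm; its constant depends on \<open>E\<close> only through \<open>k\<close> and \<open>t\<close>, hence not on the
  finite set of characters.
\<close>

lemma A_convex_C_infty:
  fixes smul :: "complex \<Rightarrow> 'a::ab_group_add \<Rightarrow> 'a" and N :: "'a \<Rightarrow> real"
  assumes E: "finite_union_of_hadamard E"
    and vs: "vector_space smul" and qN: "quasinorm smul N" and AX: "A_convex smul N"
  shows "C_infty smul N circle_haar (circle_character ` int ` E)"
proof -
  obtain N' where qN': "quasinorm smul N'" and psh: "plurisubharmonic smul N'"
    and eqv: "equivalent_quasinorms N N'"
    using AX unfolding A_convex_def by blast
  obtain c C where c0: "0 < c" "0 < C" and c': "\<forall>x. c * N x \<le> N' x \<and> N' x \<le> C * N x"
    using eqv unfolding equivalent_quasinorms_def by blast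
  have c: "0 < c" "0 < C" "\<And>x. c * N x \<le> N' x" "\<And>x. N' x \<le> C * N x"
    using c0 c' by simp_all
  obtain r where r: "0 < r" "r < 1" and tri: "\<And>x y. N' (x + y) powr r \<le> N' x powr r + N' y powr r"
    using qN' unfolding quasinorm_def by blast
  have N0: "0 \<le> N x" for x using qN unfolding quasinorm_def by blast
  have N0': "0 \<le> N' x" for x using qN' unfolding quasinorm_def by blast
  obtain t k where t: "0 < t" and E0: "0 \<notin> E" and win: "\<forall>F. F \<subseteq> E \<longrightarrow> window_bounded k t F"
    using finite_union_window_bounded[OF E] by (elim exE conjE) (rule that)
  obtain C0 where C0: "0 \<le> C0"
    and core': "\<forall>F \<Psi> A. psh_functional r F \<Psi> \<longrightarrow> 0 \<notin> F \<longrightarrow> window_bounded k t F \<longrightarrow>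
     (\<forall>u. cmod u = 1 \<longrightarrow> \<Psi> (\<lambda>k. u ^ k) \<le> A) \<longrightarrow> psh_bound F \<Psi> \<le> C0 * A"
    using psh_bound_windows[OF r t, of k] by (elim exE conjE) (rule that)
  note core = core'[rule_format]
  obtain K where K0: "0 < K"
    and K': "\<forall>(n::nat) x s a. (\<forall>\<epsilon>. (\<forall>k. \<epsilon> k \<in> {-1, 1}) \<longrightarrow> N (\<Sum>k<n. smul (\<epsilon> k) (x k)) \<le> s) \<longrightarrow>
      (\<forall>k<n. cmod (a k) \<le> 1) \<longrightarrow> N (\<Sum>k<n. smul (a k) (x k)) \<le> K * s"
    using unimodular_le_signs[OF vs qN] by (elim exE conjE) (rule that)
  note K = K0 K'[rule_format]
  define M1 where "M1 = C0 powr (1 / r) * C / c"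
  define M where "M = K + M1"
  have M1: "0 \<le> M1" using c by (simp add: M1_def)
  have M: "0 < M" "K \<le> M" "M1 \<le> M" using K M1 by (auto simp: M_def)
  show "C_infty smul N circle_haar (circle_character ` int ` E)"
    unfolding C_infty_def
  proof (rule exI[of _ M], intro conjI allI impI)
    show "0 < M" by (rule M)
    fix n :: nat and \<gamma> :: "nat \<Rightarrow> complex \<Rightarrow> complex" and x :: "nat \<Rightarrow> 'a"
    assume "inj_on \<gamma> {..<n} \<and> \<gamma> ` {..<n} \<subseteq> circle_character ` int ` E"
    then have inj: "inj_on \<gamma> {..<n}" and sub: "\<gamma> ` {..<n} \<subseteq> circle_character ` int ` E" by auto
    have "\<forall>k\<in>{..<n}. \<exists>l. l \<in> E \<and> \<gamma> k = circle_character (int l)" using sub by blast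
    from bchoice[OF this] obtain fr where "\<forall>k\<in>{..<n}. fr k \<in> E \<and> \<gamma> k = circle_character (int (fr k))"
      by (elim exE) (rule that)
    then have lam: "\<And>k. k < n \<Longrightarrow> fr k \<in> E" "\<And>k. k < n \<Longrightarrow> \<gamma> k = circle_character (int (fr k))"
      by simp_all
    have inj': "inj_on fr {..<n}"
    proof (rule inj_onI)
      fix i j assume "i \<in> {..<n}" "j \<in> {..<n}" "fr i = fr j"
      then show "i = j" using lam(2)[of i] lam(2)[of j] inj_onD[OF inj, of i j] by simp
    qed
    define F where "F = fr ` {..<n}"
    define y where "y = (\<lambda>l. x (the_inv_into {..<n} fr l))"
    have yx: "y (fr k) = x k" if "k < n" for k
      unfolding y_def using the_inv_into_f_f[OF inj'] that by simp
    have reindex: "(\<Sum>l\<in>F. smul (m l) (y l)) = (\<Sum>k<n. smul (m (fr k)) (x k))" for m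
      unfolding F_def sum.reindex[OF inj'] by (auto simp: yx)
    have FE: "F \<subseteq> E" "finite F" using lam(1) by (auto simp: F_def)
    define f where "f = (\<lambda>z. \<Sum>k<n. smul (\<gamma> k z) (x k))"
    have \<gamma>: "\<gamma> k z = z ^ fr k" if "k < n" for k z
      using lam(2)[OF that] by (simp add: circle_character_def)
    have f: "f z = (\<Sum>l\<in>F. smul (z ^ l) (y l))" for z
      unfolding f_def reindex by (simp add: \<gamma>)
    define S1 where "S1 = sup_norm circle_haar N f"
    define S2 where "S2 = sup_norm cantor_haar N (\<lambda>t. \<Sum>k<n. smul (t k) (x k))"
    have cont: "continuous_on (sphere 0 1) (\<lambda>z. N (f z))"
      unfolding f by (intro quasinorm_sum_continuous[OF vs qN] continuous_intros FE)
    have S1_ge: "ereal (N (f z)) \<le> S1" if "cmod z = 1" for z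
      unfolding S1_def by (rule circle_sup_norm(2)[where N = N and f = f, OF cont that])
    have S2_ge: "ereal (N (\<Sum>k<n. smul (\<epsilon> k) (x k))) \<le> S2" if "\<And>k. \<epsilon> k \<in> {-1, 1}" for \<epsilon>
      unfolding S2_def by (rule cantor_sup_norm(2)[OF vs qN that])
    have "ereal 0 \<le> ereal (N (f 1))" using N0 by simp
    also have "\<dots> \<le> S1" by (rule S1_ge) simp
    finally have S1_0: "0 \<le> S1" unfolding zero_ereal_def .
    have "ereal 0 \<le> ereal (N (\<Sum>k<n. smul 1 (x k)))" using N0 by simp
    also have "\<dots> \<le> S2" by (rule S2_ge[of "\<lambda>_. 1"]) simp
    finally have S2_0: "0 \<le> S2" unfolding zero_ereal_def .
    have upper: "S1 \<le> ereal M * S2"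
    proof (cases S2)
      case (real s)
      have s0: "0 \<le> s" using S2_0 real by simp
      have "ereal (N (f z)) \<le> ereal (M * s)" if z: "cmod z = 1" for z
      proof -
        have "N (\<Sum>k<n. smul (\<gamma> k z) (x k)) \<le> K * s"
        proof (rule K(2))
          fix \<epsilon> :: "nat \<Rightarrow> complex" assume "\<And>k. \<epsilon> k \<in> {-1, 1}"
          from S2_ge[OF this] show "N (\<Sum>k<n. smul (\<epsilon> k) (x k)) \<le> s" by (simp add: real)
        next
          fix k assume "k < n"
          then show "cmod (\<gamma> k z) \<le> 1" using z by (simp add: \<gamma> norm_power)
        qed
        also have "\<dots> \<le> M * s" using M s0 by (intro mult_right_mono)
        finally show ?thesis by (simp add: f_def)
      qed
      then have "S1 \<le> ereal (M * s)" unfolding S1_def by (rule circle_sup_norm(1)[where N = N and f = f, OF cont])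
      then show ?thesis by (simp add: real)
    next
      case PInf
      then show ?thesis using M by simp
    next
      case MInf
      then show ?thesis using S2_0 by simp
    qed
    have lower: "ereal (inverse M) * S2 \<le> S1"
    proof (cases S1)
      case (real s)
      have s0: "0 \<le> s" using S1_0 real by simp
      define \<Psi> where "\<Psi> = (\<lambda>m. N' (\<Sum>l\<in>F. smul (m l) (y l)) powr r)"
      have g: "psh_functional r F \<Psi>"
        unfolding \<Psi>_def by (rule psh_functional_quasinorm[OF vs qN' psh r tri FE(2)])
      have bound: "psh_bound F \<Psi> \<le> C0 * (C * s) powr r"
      proof (rule core[OF g _ win[rule_format, OF FE(1)]])
        show "0 \<notin> F" using E0 FE by auto
        fix u :: complex assume u: "cmod u = 1"
        have "N' (f u) \<le> C * N (f u)" by (rule c)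
        also have "\<dots> \<le> C * s" using S1_ge[OF u] c by (intro mult_left_mono) (auto simp: real)
        finally show "\<Psi> (\<lambda>k. u ^ k) \<le> (C * s) powr r"
          unfolding \<Psi>_def f[symmetric] using r N0' by (intro powr_mono2) auto
      qed
      have "ereal (N (\<Sum>k<n. smul (\<epsilon> k) (x k))) \<le> ereal (M * s)" if \<epsilon>: "\<And>k. \<epsilon> k \<in> {-1, 1}" for \<epsilon>
      proof -
        define m where "m = (\<lambda>l. \<epsilon> (the_inv_into {..<n} fr l))"
        have m: "(\<Sum>l\<in>F. smul (m l) (y l)) = (\<Sum>k<n. smul (\<epsilon> k) (x k))"
          unfolding reindex m_def using the_inv_into_f_f[OF inj'] by simp
        have m1: "cmod (m l) \<le> 1" for l using \<epsilon>[of "the_inv_into {..<n} fr l"] by (auto simp: m_def)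
        have "\<Psi> m \<le> 1 powr r * psh_bound F \<Psi>" by (rule psh_le_bound[OF g]) (use m1 in auto)
        then have "N' (\<Sum>k<n. smul (\<epsilon> k) (x k)) powr r \<le> C0 * (C * s) powr r"
          using bound by (simp add: \<Psi>_def m)
        then have "(N' (\<Sum>k<n. smul (\<epsilon> k) (x k)) powr r) powr (1 / r) \<le> (C0 * (C * s) powr r) powr (1 / r)"
          using r by (intro powr_mono2) auto
        also have "\<dots> = C0 powr (1 / r) * ((C * s) powr r) powr (1 / r)" by (rule powr_mult)
        also have "((C * s) powr r) powr (1 / r) = C * s" using r s0 c by (simp add: powr_powr)
        finally have "N' (\<Sum>k<n. smul (\<epsilon> k) (x k)) \<le> C0 powr (1 / r) * (C * s)"
          using r N0' by (simp add: powr_powr)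
        then have "c * N (\<Sum>k<n. smul (\<epsilon> k) (x k)) \<le> C0 powr (1 / r) * (C * s)"
          using c(3) order_trans by blast
        then have "N (\<Sum>k<n. smul (\<epsilon> k) (x k)) \<le> M1 * s"
          using c by (simp add: M1_def field_simps)
        also have "\<dots> \<le> M * s" using M s0 by (intro mult_right_mono)
        finally show ?thesis by simp
      qed
      then have "S2 \<le> ereal (M * s)" unfolding S2_def by (rule cantor_sup_norm(1)[OF vs qN])
      then have "ereal (inverse M) * S2 \<le> ereal (inverse M) * ereal (M * s)"
        using M by (intro ereal_mult_left_mono) auto
      also have "\<dots> = S1" using M by (simp add: real)
      finally show ?thesis .
    next
      case PInf
      then show ?thesis by simp
    next
      case MInf
      then show ?thesis using S1_0 by simp
    qed
    show "ereal (inverse M) * sup_norm cantor_haar N (\<lambda>t. \<Sum>k<n. smul (t k) (x k))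
        \<le> sup_norm circle_haar N (\<lambda>g. \<Sum>k<n. smul (\<gamma> k g) (x k))"
      using lower by (simp only: S1_def S2_def f_def)
    show "sup_norm circle_haar N (\<lambda>g. \<Sum>k<n. smul (\<gamma> k g) (x k))
        \<le> ereal M * sup_norm cantor_haar N (\<lambda>t. \<Sum>k<n. smul (t k) (x k))"
      using upper by (simp only: S1_def S2_def f_def)
  qed
qed

theorem theorem6:
  fixes E :: "nat set"
  assumes "finite_union_of_hadamard E"
  shows "analytic_sidon TYPE('a::ab_group_add) circle_haar (circle_character ` int ` E)"
  unfolding analytic_sidon_def quasi_banach_space_def
  using A_convex_C_infty[OF assms] by blast

end
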